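(* Let $p\ge 1$ be real, let $N>p-1$ be an integer, and let $V_1,\dots,V_d\in\mathrm{Lip}^N(\mathbb{R}^e)$. Put $\theta=\frac{N+1}{p}>1$, and let $M_1,M_2>0$. (1) There exists a positive constant $C=C(M_1)$, depending only on $M_1,p,N,M_2$ and the vector fields $V_1,\dots,V_d$ (in particular not on the Lipschitz norm of the path $x$ below), such that the following holds. Whenever (i) $x:[0,1]\to\mathbb{R}^d$ is a Lipschitz path with step-$N$ lift $\mathbf{x}=S_N(x)$ satisfying $\|\mathbf{x}\|_{1/p\text{-Hölder}}\le M_1$, and (ii) $y_0\in\mathbb{R}^e$ with $|y_0|\le M_2$, then, writing $y_t=\pi(0,y_0;x)_t$, for all $0\le s\le t\le 1$, $$|\pi(0,y_0;x)_{s,t}|\le C(M_1)\,(t-s)^{1/p}\quad\text{and}\quad \bigl|\pi(0,y_0;x)_{s,t}-I[y_s,N,\mathbf{x}_{s,t}]\bigr|\le C(M_1)\,(t-s)^{\theta}.$$ (2) Let moreover $K>0$. There exists a constant $C'=C'(M_1)$, depending only on $M_1,p,N,M_2,K$ and $V_1,\dots,V_d$, such that if, in addition to (i) and (ii), (iii) for all $0\le s<t\le1$, $x^{s,t}:[s,t]\to\mathbb{R}^d$ is a Lipschitz path with $S_N(x^{s,t})_{s,t}=\mathbf{x}_{s,t}$ and $$\int_s^t|dx^{s,t}_r|\le K M_1 (t-s)^{1/p},$$ then for all $0\le s< t\le 1$, $$\bigl|\pi(0,y_0;x)_{s,t}-\pi(s,y_s;x^{s,t})_{s,t}\bigr|\le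 C'(M_1)\,(t-s)^{\theta}.$$
   Context: The dimensions $d,e\ge1$ are fixed; dependence of constants on them is not mentioned. Vector fields: for an integer $N\ge1$, $V\in\mathrm{Lip}^N(\mathbb{R}^e)$ means that $V:\mathbb{R}^e\to\mathbb{R}^e$ is bounded and has $N$ bounded derivatives; for $N=1$ this is read as "bounded and Lipschitz continuous". A vector field $V=(V^1,\dots,V^e)$ is identified with the first order differential operator $\sum_j V^j\partial_j$; $H$ denotes the identity function on $\mathbb{R}^e$, and $V_{i_1}\cdots V_{i_k}H$ is obtained by successive application of the operators to $H$. ODE solutions: for a Lipschitz path $x:[s,t]\to\mathbb{R}^d$ and $z\in\mathbb{R}^e$, $\pi(s,z;x)$ is the unique solution $y$ on $[s,t]$ of $dy_r=\sum_{i=1}^dV_i(y_r)\,dx^i_r$, $y_s=z$. For a path $y$ in a vector space, $y_{s,t}:=y_t-y_s$. $\int_s^t|dx_r|$ is the length of $x|_{[s,t]}$. Signature: for $x$ Lipschitz, $S_N(x)_{s,t}=1+\sum_{k=1}^N\mathbf{g}^k\in T^{(N)}(\mathbb{R}^d)=\bigoplus_{k=0}^N(\mathbb{R}^d)^{\otimes k}$, where $\mathbf{g}^k$ has components $\mathbf{g}^{k,i_1,\dots,i_k}=\int_{s<u_1<\dots<u_k<t}dx^{i_1}_{u_1}\cdots dx^{i_k}_{u_k}$. The lift $\mathbf{x}=S_N(x)$ has increments $\mathbf{x}_{s,t}=S_N(x)_{s,t}$. $G^N(\mathbb{R}^d)$ is the step-$N$ free nilpotent group over $\mathbb{R}^d$,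 i.e. the set of all $S_N(\gamma)_{0,1}$ with $\gamma:[0,1]\to\mathbb{R}^d$ Lipschitz, with truncated tensor multiplication. The Carnot–Carathéodory norm of $\mathbf{g}\in G^N(\mathbb{R}^d)$ is $\|\mathbf{g}\|=\inf\{\int_0^1|\dot\gamma_t|dt:\gamma\text{ Lipschitz},\gamma(0)=0,S_N(\gamma)_{0,1}=\mathbf{g}\}$. Further, $\|\mathbf{x}\|_{1/p\text{-Hölder}}=\sup_{0\le s<t\le1}\|\mathbf{x}_{s,t}\|/(t-s)^{1/p}$. Step-$N$ Euler scheme: for $z\in\mathbb{R}^e$, $\mathbf{g}\in T^{(N)}(\mathbb{R}^d)$, $$I[z,N,\mathbf{g}]=\sum_{k=1}^N\sum_{i_1,\dots,i_k\in\{1,\dots,d\}}V_{i_1}\cdots V_{i_k}H(z)\,\mathbf{g}^{k,i_1,\dots,i_k}.$$ *)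

theory Defs
  imports "HOL-Analysis.Analysis"
begin

section \<open>Lipschitz paths, length, Stieltjes integral\<close>

definition lipschitz_path :: "real \<Rightarrow> real \<Rightarrow> (real \<Rightarrow> 'a::metric_space) \<Rightarrow> bool" where
  "lipschitz_path s t x \<longleftrightarrow> (\<exists>L. L-lipschitz_on {s..t} x)"

definition path_increment :: "(real \<Rightarrow> 'a::real_vector) \<Rightarrow> real \<Rightarrow> real \<Rightarrow> 'a" where
  "path_increment y s t = y t - y s"

text \<open>The length of \<open>x\<close> on \<open>[s,t]\<close> as total variation, with values in \<open>[0,\<infinity>]\<close>.
  For a Lipschitz path it is finite and equals the integral of the speed.\<close>
definition path_len :: "real \<Rightarrow> real \<Rightarrow> (real \<Rightarrow> 'a::real_normed_vector) \<Rightarrow> ereal" where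
  "path_len s t x = (SUP D \<in> {D. D division_of {s..t}}.
     ereal (\<Sum>k\<in>D. norm (x (Sup k) - x (Inf k))))"

text \<open>The classical Riemann-Stieltjes integral of \<open>f\<close> against the scalar integrator \<open>g\<close>
  on \<open>[s,t]\<close>, as a limit of Riemann sums as the mesh tends to zero: the gauge is a ball of constant
  radius. It exists whenever \<open>f\<close> is continuous and \<open>g\<close> is Lipschitz on \<open>[s,t]\<close>.\<close>
definition has_stieltjes_integral ::
  "real \<Rightarrow> real \<Rightarrow> (real \<Rightarrow> 'a::real_normed_vector) \<Rightarrow> (real \<Rightarrow> real) \<Rightarrow> 'a \<Rightarrow> bool" where
  "has_stieltjes_integral s t f g I \<longleftrightarrow>
     (\<forall>\<epsilon>>0. \<exists>\<delta>>0. \<forall>\<D>. \<D> tagged_division_of {s..t} \<and> (\<lambda>u. ball u \<delta>) fine \<D> \<longrightarrow>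
        norm ((\<Sum>(u,k)\<in>\<D>. (g (Sup k) - g (Inf k)) *\<^sub>R f u) - I) < \<epsilon>)"

definition stieltjes_integral ::
  "real \<Rightarrow> real \<Rightarrow> (real \<Rightarrow> 'a::real_normed_vector) \<Rightarrow> (real \<Rightarrow> real) \<Rightarrow> 'a" where
  "stieltjes_integral s t f g = (THE I. has_stieltjes_integral s t f g I)"

lemma has_stieltjes_integral_unique:
  assumes I: "has_stieltjes_integral s t f g I" and J: "has_stieltjes_integral s t f g J"
  shows "I = J"
proof (rule ccontr)
  assume "I \<noteq> J"
  then have e: "norm (I - J) / 2 > 0" by simp
  let ?S = "\<lambda>\<D>. \<Sum>(u,k)\<in>\<D>. (g (Sup k) - g (Inf k)) *\<^sub>R f u"
  obtain d1 where d1: "d1 > 0"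
    "\<And>\<D>. \<D> tagged_division_of {s..t} \<Longrightarrow> (\<lambda>u. ball u d1) fine \<D> \<Longrightarrow> norm (?S \<D> - I) < norm (I - J) / 2"
    using I e unfolding has_stieltjes_integral_def by meson
  obtain d2 where d2: "d2 > 0"
    "\<And>\<D>. \<D> tagged_division_of {s..t} \<Longrightarrow> (\<lambda>u. ball u d2) fine \<D> \<Longrightarrow> norm (?S \<D> - J) < norm (I - J) / 2"
    using J e unfolding has_stieltjes_integral_def by meson
  have "gauge (\<lambda>u::real. ball u (min d1 d2))" using d1(1) d2(1) by (intro gauge_ball) simp
  then obtain \<D> where D: "\<D> tagged_division_of {s..t}" "(\<lambda>u. ball u (min d1 d2)) fine \<D>"
    using fine_division_exists_real by blast
  have "(\<lambda>u. ball u d1) fine \<D>" "(\<lambda>u. ball u d2) fine \<D>"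
    using D(2) unfolding fine_def by fastforce+
  then have "norm (?S \<D> - I) < norm (I - J) / 2" "norm (?S \<D> - J) < norm (I - J) / 2"
    using d1(2) d2(2) D(1) by blast+
  then show False
    using norm_triangle_ineq4[of "?S \<D> - J" "?S \<D> - I"] by simp
qed

lemma stieltjes_integral_unique:
  "has_stieltjes_integral s t f g I \<Longrightarrow> stieltjes_integral s t f g = I"
  unfolding stieltjes_integral_def using has_stieltjes_integral_unique by blast

lemma stieltjes_integral_const:
  assumes "s \<le> t"
  shows "stieltjes_integral s t (\<lambda>_. c) g = (g t - g s) *\<^sub>R c"
proof (rule stieltjes_integral_unique)
  have "(\<Sum>(u,k)\<in>\<D>. (g (Sup k) - g (Inf k)) *\<^sub>R c) = (g t - g s) *\<^sub>R c"
    if "\<D> tagged_division_of {s..t}" for \<D>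
    using additive_tagged_division_1[OF assms that, of "\<lambda>u. g u *\<^sub>R c"]
    by (simp add: scaleR_diff_left)
  then show "has_stieltjes_integral s t (\<lambda>_. c) g ((g t - g s) *\<^sub>R c)"
    unfolding has_stieltjes_integral_def by (auto intro: exI[of _ 1])
qed


section \<open>Signature and Carnot-Caratheodory norm\<close>

text \<open>Elements of the truncated tensor algebra of level \<open>N\<close> over \<open>real ^ 'd\<close> are given by their
  components, indexed by words (lists of letters in \<open>'d\<close>), and vanish on words longer than \<open>N\<close>.

  In the recursion the letters come in reverse order: the head is the letter integrated at the
  largest time, and \<open>t\<close> is the right end point.\<close>
primrec iterated_integral_rev ::
  "(real \<Rightarrow> real ^ 'd) \<Rightarrow> real \<Rightarrow> 'd list \<Rightarrow> real \<Rightarrow> real" where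
  "iterated_integral_rev x s [] = (\<lambda>t. 1)"
| "iterated_integral_rev x s (i # w) =
     (\<lambda>t. stieltjes_integral s t (iterated_integral_rev x s w) (\<lambda>u. x u $ i))"

definition iterated_integral ::
  "(real \<Rightarrow> real ^ 'd) \<Rightarrow> 'd list \<Rightarrow> real \<Rightarrow> real \<Rightarrow> real" where
  "iterated_integral x w s t = iterated_integral_rev x s (rev w) t"

definition signature ::
  "nat \<Rightarrow> (real \<Rightarrow> real ^ 'd) \<Rightarrow> real \<Rightarrow> real \<Rightarrow> 'd list \<Rightarrow> real" where
  "signature N x s t = (\<lambda>w. if length w \<le> N then iterated_integral x w s t else 0)"

lemma signature_Nil: "signature N x s t [] = 1"
  by (simp add: signature_def iterated_integral_def)

lemma signature_letter:
  "s \<le> t \<Longrightarrow> N \<ge> 1 \<Longrightarrow> signature N x s t [i] = x t $ i - x s $ i"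
  by (simp add: signature_def iterated_integral_def stieltjes_integral_const)

text \<open>The set below is nonempty exactly for \<open>g\<close> in the free nilpotent group of step \<open>N\<close>, so the norm
  is finite there and \<open>\<infinity>\<close> elsewhere.\<close>
definition cc_norm :: "nat \<Rightarrow> ('d::finite list \<Rightarrow> real) \<Rightarrow> ereal" where
  "cc_norm N g = Inf {path_len 0 1 \<gamma> | \<gamma> :: real \<Rightarrow> real ^ 'd.
     lipschitz_path 0 1 \<gamma> \<and> \<gamma> 0 = 0 \<and> signature N \<gamma> 0 1 = g}"

text \<open>\<open>X s t\<close> is the increment over \<open>[s,t]\<close> of the lifted path.\<close>
definition holder_norm ::
  "nat \<Rightarrow> real \<Rightarrow> (real \<Rightarrow> real \<Rightarrow> 'd::finite list \<Rightarrow> real) \<Rightarrow> ereal" where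
  "holder_norm N p X =
     (SUP (s, t) \<in> {(s, t). 0 \<le> s \<and> s < t \<and> t \<le> 1}. cc_norm N (X s t) / ereal ((t - s) powr (1 / p)))"


section \<open>Vector fields, differential equations, Euler scheme\<close>

text \<open>\<open>f\<close> is bounded, \<open>n\<close> times differentiable, and its derivatives up to order \<open>n\<close> are bounded.
  In finite dimension the derivative \<open>Df\<close> has \<open>n\<close> bounded derivatives iff this holds for
  \<open>z \<mapsto> Df(z) v\<close> for every fixed vector \<open>v\<close>; this keeps the codomain unchanged in the recursion.\<close>
primrec bounded_derivs :: "nat \<Rightarrow> ('a::euclidean_space \<Rightarrow> 'b::real_normed_vector) \<Rightarrow> bool" where
  "bounded_derivs 0 f \<longleftrightarrow> bounded (range f)"
| "bounded_derivs (Suc n) f \<longleftrightarrow> bounded (range f) \<and> (\<forall>z. f differentiable at z) \<and>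
     (\<forall>v. bounded_derivs n (\<lambda>z. frechet_derivative f (at z) v))"

definition Lip_fields :: "nat \<Rightarrow> (real ^ 'e \<Rightarrow> real ^ 'e) set" where
  "Lip_fields N = {W. if N = 1 then bounded (range W) \<and> (\<exists>L. L-lipschitz_on UNIV W)
                      else bounded_derivs N W}"

text \<open>The first order operator \<open>\<Sum>\<^sub>j W\<^sup>j \<partial>\<^sub>j\<close>.\<close>
definition field_op ::
  "(real ^ 'e \<Rightarrow> real ^ 'e) \<Rightarrow> (real ^ 'e \<Rightarrow> real ^ 'e) \<Rightarrow> real ^ 'e \<Rightarrow> real ^ 'e" where
  "field_op W f z = (\<Sum>j\<in>UNIV. (W z $ j) *\<^sub>R frechet_derivative f (at z) (axis j 1))"

text \<open>\<open>V\<^sub>i\<^sub>1 (\<dots> (V\<^sub>i\<^sub>k H))\<close> for the word \<open>[i1, \<dots>, ik]\<close>, where \<open>H\<close> is the identity.\<close>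
definition field_word ::
  "('d \<Rightarrow> real ^ 'e \<Rightarrow> real ^ 'e) \<Rightarrow> 'd list \<Rightarrow> real ^ 'e \<Rightarrow> real ^ 'e" where
  "field_word V w = foldr (\<lambda>i. field_op (V i)) w (\<lambda>z. z)"

definition euler_scheme ::
  "('d \<Rightarrow> real ^ 'e \<Rightarrow> real ^ 'e) \<Rightarrow> real ^ 'e \<Rightarrow> nat \<Rightarrow> ('d list \<Rightarrow> real) \<Rightarrow> real ^ 'e" where
  "euler_scheme V z N g = (\<Sum>k=1..N. \<Sum>w | length w = k. g w *\<^sub>R field_word V w z)"

definition solves_on ::
  "('d::finite \<Rightarrow> real ^ 'e \<Rightarrow> real ^ 'e) \<Rightarrow> real \<Rightarrow> real \<Rightarrow> real ^ 'e \<Rightarrow>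
   (real \<Rightarrow> real ^ 'd) \<Rightarrow> (real \<Rightarrow> real ^ 'e) \<Rightarrow> bool" where
  "solves_on V s t z x y \<longleftrightarrow> continuous_on {s..t} y \<and>
     (\<forall>r\<in>{s..t}. y r = z + (\<Sum>i\<in>UNIV. stieltjes_integral s r (\<lambda>u. V i (y u)) (\<lambda>u. x u $ i)))"

text \<open>The solution on \<open>[s,t]\<close> started from \<open>z\<close> at time \<open>s\<close>; \<open>extensional\<close> fixes its irrelevant
  values outside \<open>[s,t]\<close>, so that it is unique as a function on \<open>real\<close>.\<close>
definition ode_sol ::
  "('d::finite \<Rightarrow> real ^ 'e \<Rightarrow> real ^ 'e) \<Rightarrow> real \<Rightarrow> real \<Rightarrow> real ^ 'e \<Rightarrow>
   (real \<Rightarrow> real ^ 'd) \<Rightarrow> real \<Rightarrow> real ^ 'e" where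
  "ode_sol V s t z x = (THE y. y \<in> extensional {s..t} \<and> solves_on V s t z x y)"

end

theory Submission
  imports Defs
begin

text \<open>Fix a solution \<open>y\<close> driven by \<open>x\<close> and let \<open>J s t\<close> be the norm of the Euler defect
\<open>y t - y s - I[y s, N, S(x) s t]\<close>. Everything follows from the bound \<open>J s t \<le> D (t - s) powr \<theta>\<close> with
\<open>D\<close> independent of the Lipschitz constant of \<open>x\<close>.

The Euler scheme is accurate along short paths: if the driver has length at most \<open>l\<close>, expanding the
equation \<open>N\<close> times by the chain rule leaves iterated integrals of order \<open>N\<close> whose integrands are
increments of Lipschitz functions of the solution, so the defect is at most \<open>E l ^ (N + 1)\<close>
(\<open>euler_scheme_error\<close>). Applied to \<open>x\<close> itself, this gives \<open>J s t = O((t - s)\<^sup>2)\<close>, but with a constant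
that depends on the Lipschitz constant of \<open>x\<close>. That dependence is removed by comparing scales.

The Euler scheme only sees the signature. So on \<open>[s, t]\<close> and on \<open>[t, u]\<close> the driver \<open>x\<close> may be
replaced by paths with the same signature and length \<open>O((u - s) powr (1/p))\<close>, which exist by the
bound on the Hoelder norm. By Chen's identity their concatenation has the signature of \<open>x\<close> over
\<open>[s, u]\<close>. Solving along the concatenation from \<open>y s\<close>, applying the Euler estimate to the first
piece, the second piece and the whole, and using Lipschitz dependence on the initial value on the
second piece, one gets (\<open>euler_defect_midpoint\<close>)
\<open>J s u \<le> (1 + A \<eta>) J s t + J t u + A (u - s) powr \<theta>\<close>, where \<open>\<eta> = (u - s) powr (1/p)\<close> and \<open>A\<close> depends only
on the data. Iterating at dyadic midpoints, the product of the factors \<open>1 + A \<eta>\<close> converges, the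
inhomogeneous terms sum geometrically because \<open>\<theta> > 1\<close>, and the contribution of the finest scale,
\<open>2 ^ n\<close> terms of size \<open>O(4 ^ -n)\<close>, vanishes in the limit whatever its constant
(\<open>dyadic_sewing_bound\<close>).

The first part of the theorem then follows by bounding the Euler scheme itself through a solution
along a short path with the same signature; the second follows because the solution along the given
path \<open>xx s t\<close> has the same Euler scheme, so that both increments are within \<open>O((t - s) powr \<theta>)\<close> of it.\<close>



section \<open>Primitives for the Riemann-Stieltjes integral\<close>

text \<open>An inequality between increments that holds on short intervals up to an error \<open>o(b - a)\<close> holds on
the whole interval, by summing over a uniform partition: the errors add up to less than any
given bound.\<close>
lemma norm_increment_le_of_local:
  fixes F :: "real \<Rightarrow> 'a::real_normed_vector" and G :: "real \<Rightarrow> real"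
  assumes st: "s \<le> t"
    and loc: "\<And>\<epsilon>. \<epsilon> > 0 \<Longrightarrow> \<exists>\<delta>>0. \<forall>a b. s \<le> a \<and> a \<le> b \<and> b \<le> t \<and> b - a < \<delta> \<longrightarrow>
                norm (F b - F a) \<le> G b - G a + \<epsilon> * (b - a)"
  shows "norm (F t - F s) \<le> G t - G s"
proof (rule field_le_epsilon)
  fix e :: real assume e: "e > 0"
  define \<epsilon> where "\<epsilon> = e / (t - s + 1)"
  have "\<epsilon> > 0" using e st by (simp add: \<epsilon>_def)
  then obtain \<delta> where d: "\<delta> > 0"
    and D: "\<And>a b. s \<le> a \<Longrightarrow> a \<le> b \<Longrightarrow> b \<le> t \<Longrightarrow> b - a < \<delta> \<Longrightarrow>
                norm (F b - F a) \<le> G b - G a + \<epsilon> * (b - a)"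
    using loc by meson
  obtain n :: nat where n: "(t - s) / \<delta> < real n" using reals_Archimedean2 by blast
  have "0 \<le> (t - s) / \<delta>" using st d by simp
  then have n0: "n > 0" using n by (cases n) auto
  define q where "q = (\<lambda>k. s + real k * ((t - s) / real n))"
  have q0: "q 0 = s" and qn: "q n = t" using n0 by (auto simp: q_def)
  have step: "q (Suc k) - q k = (t - s) / real n" for k
    by (simp add: q_def distrib_right diff_divide_distrib add_divide_distrib)
  have small: "(t - s) / real n < \<delta>" using n d n0 by (simp add: field_simps)
  have nn: "0 \<le> (t - s) / real n" using st by simp
  have le: "q k \<le> t" if "k \<le> n" for k
  proof -
    have "real k * ((t - s) / real n) \<le> real n * ((t - s) / real n)"
      using that nn by (intro mult_right_mono) auto
    then show ?thesis using n0 by (simp add: q_def)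
  qed
  have ge: "s \<le> q k" for k unfolding q_def using mult_nonneg_nonneg[OF of_nat_0_le_iff nn, of k] by linarith
  have "norm (F t - F s) = norm (\<Sum>k<n. F (q (Suc k)) - F (q k))"
    using sum_lessThan_telescope[of "\<lambda>k. F (q k)" n] by (simp add: q0 qn)
  also have "\<dots> \<le> (\<Sum>k<n. G (q (Suc k)) - G (q k) + \<epsilon> * (q (Suc k) - q k))"
  proof (rule sum_norm_le)
    fix k assume "k \<in> {..<n}"
    then show "norm (F (q (Suc k)) - F (q k)) \<le> G (q (Suc k)) - G (q k) + \<epsilon> * (q (Suc k) - q k)"
      using step[of k] nn small le[of "Suc k"] ge[of k] by (intro D) auto
  qed
  also have "\<dots> = (G t - G s) + \<epsilon> * (t - s)"
    using sum_lessThan_telescope[of "\<lambda>k. G (q k)" n] sum_lessThan_telescope[of q n]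
    by (simp add: sum.distrib sum_distrib_left[symmetric] q0 qn)
  also have "\<epsilon> * (t - s) \<le> e"
    using e st by (simp add: \<epsilon>_def field_simps)
  finally show "norm (F t - F s) \<le> G t - G s + e" by simp
qed

text \<open>A function \<open>F\<close> whose increments agree with \<open>(g b - g a) f u\<close> up to \<open>o(b - a)\<close>, uniformly in the tag
\<open>u\<close>. Working with such primitives makes additivity over intervals, linearity and
translation of the integral immediate; tagged divisions enter only through
\<open>stieltjes_primitive_imp_has_integral\<close>.\<close>
definition stieltjes_primitive ::
  "real \<Rightarrow> real \<Rightarrow> (real \<Rightarrow> 'a::real_normed_vector) \<Rightarrow> (real \<Rightarrow> real) \<Rightarrow> (real \<Rightarrow> 'a) \<Rightarrow> bool" where
  "stieltjes_primitive s t f g F \<longleftrightarrow>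
     (\<forall>\<epsilon>>0. \<exists>\<delta>>0. \<forall>a u b. s \<le> a \<and> a \<le> u \<and> u \<le> b \<and> b \<le> t \<and> b - a < \<delta> \<longrightarrow>
        norm (F b - F a - (g b - g a) *\<^sub>R f u) \<le> \<epsilon> * (b - a))"

lemma stieltjes_primitiveD:
  assumes "stieltjes_primitive s t f g F" and "\<epsilon> > 0"
  obtains \<delta> where "\<delta> > 0"
    "\<And>a u b. s \<le> a \<Longrightarrow> a \<le> u \<Longrightarrow> u \<le> b \<Longrightarrow> b \<le> t \<Longrightarrow> b - a < \<delta> \<Longrightarrow>
        norm (F b - F a - (g b - g a) *\<^sub>R f u) \<le> \<epsilon> * (b - a)"
  using assms unfolding stieltjes_primitive_def by meson

lemma stieltjes_primitive_subinterval:
  assumes "stieltjes_primitive s t f g F" and "s \<le> a" and "b \<le> t"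
  shows "stieltjes_primitive a b f g F"
  unfolding stieltjes_primitive_def
proof (intro allI impI)
  fix \<epsilon> :: real assume "\<epsilon> > 0"
  with assms(1) obtain \<delta> where "\<delta> > 0"
    "\<And>a u b. s \<le> a \<Longrightarrow> a \<le> u \<Longrightarrow> u \<le> b \<Longrightarrow> b \<le> t \<Longrightarrow> b - a < \<delta> \<Longrightarrow>
        norm (F b - F a - (g b - g a) *\<^sub>R f u) \<le> \<epsilon> * (b - a)"
    using stieltjes_primitiveD by blast
  then show "\<exists>\<delta>>0. \<forall>a' u b'. a \<le> a' \<and> a' \<le> u \<and> u \<le> b' \<and> b' \<le> b \<and> b' - a' < \<delta> \<longrightarrow>
        norm (F b' - F a' - (g b' - g a') *\<^sub>R f u) \<le> \<epsilon> * (b' - a')"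
    using assms(2,3) by (intro exI[of _ \<delta>]) auto
qed

lemma stieltjes_primitive_cong:
  assumes "stieltjes_primitive s t f g F"
    and "\<And>u. s \<le> u \<Longrightarrow> u \<le> t \<Longrightarrow> f' u = f u"
    and "\<And>a b. s \<le> a \<Longrightarrow> a \<le> b \<Longrightarrow> b \<le> t \<Longrightarrow> g' b - g' a = g b - g a"
    and "\<And>a b. s \<le> a \<Longrightarrow> a \<le> b \<Longrightarrow> b \<le> t \<Longrightarrow> F' b - F' a = F b - F a"
  shows "stieltjes_primitive s t f' g' F'"
  unfolding stieltjes_primitive_def
proof (intro allI impI)
  fix \<epsilon> :: real assume "\<epsilon> > 0"
  with assms(1) obtain \<delta> where "\<delta> > 0" and
    D: "\<And>a u b. s \<le> a \<Longrightarrow> a \<le> u \<Longrightarrow> u \<le> b \<Longrightarrow> b \<le> t \<Longrightarrow> b - a < \<delta> \<Longrightarrow>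
        norm (F b - F a - (g b - g a) *\<^sub>R f u) \<le> \<epsilon> * (b - a)"
    using stieltjes_primitiveD by blast
  moreover have "norm (F' b - F' a - (g' b - g' a) *\<^sub>R f' u) \<le> \<epsilon> * (b - a)"
    if "s \<le> a \<and> a \<le> u \<and> u \<le> b \<and> b \<le> t \<and> b - a < \<delta>" for a u b
    using D[of a u b] that assms(2)[of u] assms(3,4)[of a b] by simp
  ultimately show "\<exists>\<delta>>0. \<forall>a u b. s \<le> a \<and> a \<le> u \<and> u \<le> b \<and> b \<le> t \<and> b - a < \<delta> \<longrightarrow>
        norm (F' b - F' a - (g' b - g' a) *\<^sub>R f' u) \<le> \<epsilon> * (b - a)"
    by blast
qed

lemma stieltjes_primitive_add:
  assumes "stieltjes_primitive s t f g F" and "stieltjes_primitive s t f' g F'"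
  shows "stieltjes_primitive s t (\<lambda>u. f u + f' u) g (\<lambda>r. F r + F' r)"
  unfolding stieltjes_primitive_def
proof (intro allI impI)
  fix \<epsilon> :: real assume "\<epsilon> > 0"
  then have e: "\<epsilon> / 2 > 0" by simp
  obtain \<delta> where d: "\<delta> > 0"
    "\<And>a u b. s \<le> a \<Longrightarrow> a \<le> u \<Longrightarrow> u \<le> b \<Longrightarrow> b \<le> t \<Longrightarrow> b - a < \<delta> \<Longrightarrow>
        norm (F b - F a - (g b - g a) *\<^sub>R f u) \<le> \<epsilon> / 2 * (b - a)"
    using stieltjes_primitiveD[OF assms(1) e] by blast
  obtain \<delta>' where d': "\<delta>' > 0"
    "\<And>a u b. s \<le> a \<Longrightarrow> a \<le> u \<Longrightarrow> u \<le> b \<Longrightarrow> b \<le> t \<Longrightarrow> b - a < \<delta>' \<Longrightarrow>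
        norm (F' b - F' a - (g b - g a) *\<^sub>R f' u) \<le> \<epsilon> / 2 * (b - a)"
    using stieltjes_primitiveD[OF assms(2) e] by blast
  have "norm (F b + F' b - (F a + F' a) - (g b - g a) *\<^sub>R (f u + f' u)) \<le> \<epsilon> * (b - a)"
    if "s \<le> a \<and> a \<le> u \<and> u \<le> b \<and> b \<le> t \<and> b - a < min \<delta> \<delta>'" for a u b
  proof -
    have "F b + F' b - (F a + F' a) - (g b - g a) *\<^sub>R (f u + f' u)
        = (F b - F a - (g b - g a) *\<^sub>R f u) + (F' b - F' a - (g b - g a) *\<^sub>R f' u)"
      by (simp add: algebra_simps)
    also have "norm \<dots> \<le> \<epsilon> / 2 * (b - a) + \<epsilon> / 2 * (b - a)"
      using that by (intro norm_triangle_mono d d') auto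
    finally show ?thesis by simp
  qed
  then show "\<exists>\<delta>>0. \<forall>a u b. s \<le> a \<and> a \<le> u \<and> u \<le> b \<and> b \<le> t \<and> b - a < \<delta> \<longrightarrow>
      norm (F b + F' b - (F a + F' a) - (g b - g a) *\<^sub>R (f u + f' u)) \<le> \<epsilon> * (b - a)"
    using d(1) d'(1) by (intro exI[of _ "min \<delta> \<delta>'"]) auto
qed

lemma stieltjes_primitive_bounded_linear:
  assumes "stieltjes_primitive s t f g F" and "bounded_linear h"
  shows "stieltjes_primitive s t (\<lambda>u. h (f u)) g (\<lambda>r. h (F r))"
  unfolding stieltjes_primitive_def
proof (intro allI impI)
  fix \<epsilon> :: real assume e: "\<epsilon> > 0"
  interpret h: bounded_linear h by fact
  obtain K where K: "K > 0" "\<And>x. norm (h x) \<le> norm x * K" using h.pos_bounded by blast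
  obtain \<delta> where d: "\<delta> > 0"
    "\<And>a u b. s \<le> a \<Longrightarrow> a \<le> u \<Longrightarrow> u \<le> b \<Longrightarrow> b \<le> t \<Longrightarrow> b - a < \<delta> \<Longrightarrow>
        norm (F b - F a - (g b - g a) *\<^sub>R f u) \<le> \<epsilon> / K * (b - a)"
    using stieltjes_primitiveD[OF assms(1), of "\<epsilon> / K"] e K(1) by auto
  have "norm (h (F b) - h (F a) - (g b - g a) *\<^sub>R h (f u)) \<le> \<epsilon> * (b - a)"
    if "s \<le> a \<and> a \<le> u \<and> u \<le> b \<and> b \<le> t \<and> b - a < \<delta>" for a u b
  proof -
    have "h (F b) - h (F a) - (g b - g a) *\<^sub>R h (f u) = h (F b - F a - (g b - g a) *\<^sub>R f u)"
      by (simp add: h.diff h.scaleR)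
    also have "norm \<dots> \<le> \<epsilon> / K * (b - a) * K"
      using K(2) d(2)[of a u b] that K(1) by (meson less_imp_le mult_right_mono order_trans)
    finally show ?thesis using K(1) by simp
  qed
  then show "\<exists>\<delta>>0. \<forall>a u b. s \<le> a \<and> a \<le> u \<and> u \<le> b \<and> b \<le> t \<and> b - a < \<delta> \<longrightarrow>
      norm (h (F b) - h (F a) - (g b - g a) *\<^sub>R h (f u)) \<le> \<epsilon> * (b - a)"
    using d(1) by blast
qed

lemma stieltjes_primitive_diff:
  assumes "stieltjes_primitive s t f g F" and "stieltjes_primitive s t f' g F'"
  shows "stieltjes_primitive s t (\<lambda>u. f u - f' u) g (\<lambda>r. F r - F' r)"
  using stieltjes_primitive_add[OF assms(1)
      stieltjes_primitive_bounded_linear[OF assms(2) bounded_linear_minus[OF bounded_linear_ident]]]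
  by simp

text \<open>The tag may be chosen at the left end point; this is what makes convexity arguments such as the
one in \<open>driven_integral_exp_bound\<close> work for a control \<open>v\<close> that need not be continuous.\<close>
lemma stieltjes_primitive_bound:
  fixes G :: "real \<Rightarrow> real"
  assumes F: "stieltjes_primitive s t f g F" and st: "s \<le> t"
    and bd: "\<And>u b. s \<le> u \<Longrightarrow> u \<le> b \<Longrightarrow> b \<le> t \<Longrightarrow> \<bar>g b - g u\<bar> * norm (f u) \<le> G b - G u"
  shows "norm (F t - F s) \<le> G t - G s"
proof (rule norm_increment_le_of_local[OF st])
  fix \<epsilon> :: real assume "\<epsilon> > 0"
  with F obtain \<delta> where "\<delta> > 0" and
    D: "\<And>a u b. s \<le> a \<Longrightarrow> a \<le> u \<Longrightarrow> u \<le> b \<Longrightarrow> b \<le> t \<Longrightarrow> b - a < \<delta> \<Longrightarrow>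
        norm (F b - F a - (g b - g a) *\<^sub>R f u) \<le> \<epsilon> * (b - a)"
    using stieltjes_primitiveD by blast
  moreover have "norm (F b - F a) \<le> G b - G a + \<epsilon> * (b - a)"
    if "s \<le> a \<and> a \<le> b \<and> b \<le> t \<and> b - a < \<delta>" for a b
  proof -
    have "norm (F b - F a) \<le> norm (F b - F a - (g b - g a) *\<^sub>R f a) + norm ((g b - g a) *\<^sub>R f a)"
      by (metis add.commute norm_triangle_sub)
    then show ?thesis using D[of a a b] bd[of a b] that by simp
  qed
  ultimately show "\<exists>\<delta>>0. \<forall>a b. s \<le> a \<and> a \<le> b \<and> b \<le> t \<and> b - a < \<delta> \<longrightarrow>
      norm (F b - F a) \<le> G b - G a + \<epsilon> * (b - a)" by blast
qed

lemma stieltjes_primitive_imp_has_integral: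
  assumes F: "stieltjes_primitive s t f g F" and st: "s \<le> t"
  shows "has_stieltjes_integral s t f g (F t - F s)"
  unfolding has_stieltjes_integral_def
proof (intro allI impI)
  fix e :: real assume e: "e > 0"
  define \<epsilon> where "\<epsilon> = e / (t - s + 1)"
  have "\<epsilon> > 0" using e st by (simp add: \<epsilon>_def)
  then obtain \<delta> where d: "\<delta> > 0" and
    D: "\<And>a u b. s \<le> a \<Longrightarrow> a \<le> u \<Longrightarrow> u \<le> b \<Longrightarrow> b \<le> t \<Longrightarrow> b - a < \<delta> \<Longrightarrow>
        norm (F b - F a - (g b - g a) *\<^sub>R f u) \<le> \<epsilon> * (b - a)"
    using F stieltjes_primitiveD by blast
  have "norm ((\<Sum>(u,k)\<in>\<D>. (g (Sup k) - g (Inf k)) *\<^sub>R f u) - (F t - F s)) < e"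
    if T: "\<D> tagged_division_of {s..t}" and fine: "(\<lambda>u. ball u (\<delta> / 2)) fine \<D>" for \<D>
  proof -
    have "(\<Sum>(u,k)\<in>\<D>. (g (Sup k) - g (Inf k)) *\<^sub>R f u) - (F t - F s)
        = (\<Sum>(u,k)\<in>\<D>. (g (Sup k) - g (Inf k)) *\<^sub>R f u - (F (Sup k) - F (Inf k)))"
      using additive_tagged_division_1[OF st T, of F]
      by (simp add: sum_subtractf split_def)
    also have "norm \<dots> \<le> (\<Sum>(u,k)\<in>\<D>. \<epsilon> * (Sup k - Inf k))"
    proof (rule sum_norm_le, clarify)
      fix u k assume uk: "(u, k) \<in> \<D>"
      obtain c d' where k: "k = {c..d'}" using tagged_division_ofD(4)[OF T uk] by auto
      have u: "u \<in> k" using tagged_division_ofD(2)[OF T uk] .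
      then have cd: "c \<le> u" "u \<le> d'" using k by auto
      have "k \<subseteq> {s..t}" using tagged_division_ofD(3)[OF T uk] .
      then have sc: "s \<le> c" "d' \<le> t" using k cd by auto
      have "k \<subseteq> ball u (\<delta> / 2)" using fine uk unfolding fine_def by blast
      moreover have "c \<in> k" "d' \<in> k" using k cd by auto
      ultimately have "c \<in> ball u (\<delta> / 2)" "d' \<in> ball u (\<delta> / 2)" by blast+
      then have "d' - c < \<delta>" using cd by (simp add: dist_real_def)
      then have "norm (F d' - F c - (g d' - g c) *\<^sub>R f u) \<le> \<epsilon> * (d' - c)"
        using D sc cd by blast
      then show "norm ((g (Sup k) - g (Inf k)) *\<^sub>R f u - (F (Sup k) - F (Inf k))) \<le> \<epsilon> * (Sup k - Inf k)"
        using k cd by (simp add: norm_minus_commute)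
    qed
    also have "\<dots> = \<epsilon> * (t - s)"
      using additive_tagged_division_1[OF st T, of "\<lambda>u. \<epsilon> * u"]
      by (simp add: right_diff_distrib)
    also have "\<dots> < e" using e st by (simp add: \<epsilon>_def field_simps)
    finally show ?thesis .
  qed
  then show "\<exists>\<delta>>0. \<forall>\<D>. \<D> tagged_division_of {s..t} \<and> (\<lambda>u. ball u \<delta>) fine \<D> \<longrightarrow>
        norm ((\<Sum>(u,k)\<in>\<D>. (g (Sup k) - g (Inf k)) *\<^sub>R f u) - (F t - F s)) < e"
    using d by (intro exI[of _ "\<delta> / 2"]) auto
qed

lemma stieltjes_integral_primitive:
  assumes "stieltjes_primitive s t f g F" and "s \<le> a" and "a \<le> b" and "b \<le> t"
  shows "stieltjes_integral a b f g = F b - F a"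
  using stieltjes_primitive_imp_has_integral[OF stieltjes_primitive_subinterval[OF assms(1,2,4)] assms(3)]
  by (rule stieltjes_integral_unique)

text \<open>For a continuously differentiable integrand, integration by parts removes the need to
differentiate the integrator: the primitive is \<open>f g - \<integral> g f'\<close>, an ordinary integral. Expanding
around \<open>u\<close>, its deviation from \<open>(g b - g a) f u\<close> is quadratic in \<open>b - a\<close>.\<close>
lemma stieltjes_primitive_by_parts:
  fixes f :: "real \<Rightarrow> 'a::euclidean_space"
  assumes g: "L-lipschitz_on {s..t} g"
    and f': "\<And>u. (f has_vector_derivative f' u) (at u)" and cf': "continuous_on {s..t} f'"
  shows "stieltjes_primitive s t f g (\<lambda>r. g r *\<^sub>R f r - integral {s..r} (\<lambda>v. g v *\<^sub>R f' v))"
proof (cases "s \<le> t")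
  case True
  have L: "L \<ge> 0" using g lipschitz_on_nonneg by blast
  have cg: "continuous_on {s..t} g" using g lipschitz_on_continuous_on by blast
  have "bounded (f' ` {s..t})" using cf' compact_Icc compact_continuous_image compact_imp_bounded by blast
  then obtain M where M: "\<And>u. u \<in> {s..t} \<Longrightarrow> norm (f' u) \<le> M" and M0: "M > 0"
    by (metis bounded_pos imageI)
  define I where "I = (\<lambda>r. integral {s..r} (\<lambda>v. g v *\<^sub>R f' v))"
  have glip: "\<bar>g b - g a\<bar> \<le> L * (b - a)" if "s \<le> a" "a \<le> b" "b \<le> t" for a b
    using lipschitz_onD[OF g, of b a] that by (simp add: dist_real_def)
  \<comment> \<open>Writing \<open>g b = g a + (g b - g a)\<close> turns the deviation into the product of increments of \<open>g\<close> and \<open>f\<close>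
    minus the integral of an increment of \<open>g\<close> against \<open>f'\<close>; each is quadratic in \<open>b - a\<close>.\<close>
  have key: "norm (g b *\<^sub>R f b - I b - (g a *\<^sub>R f a - I a) - (g b - g a) *\<^sub>R f u)
      \<le> (2 * L * M * (b - a)) * (b - a)"
    if H: "s \<le> a" "a \<le> u" "u \<le> b" "b \<le> t" for a u b
  proof -
    have ci: "continuous_on {s..b} (\<lambda>v. g v *\<^sub>R f' v)"
      using H by (intro continuous_intros continuous_on_subset[OF cg] continuous_on_subset[OF cf']) auto
    then have i1: "(\<lambda>v. g v *\<^sub>R f' v) integrable_on {s..b}" by (rule integrable_continuous_real)
    have Iab: "I b - I a = integral {a..b} (\<lambda>v. g v *\<^sub>R f' v)"
      using Henstock_Kurzweil_Integration.integral_combine[OF _ _ i1, of a] H by (simp add: I_def algebra_simps)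
    have i2: "(\<lambda>v. g v *\<^sub>R f' v) integrable_on {a..b}"
      using integrable_on_subinterval[OF i1, of a b] H by auto
    have ftc: "(f' has_integral (f d - f c)) {c..d}" if "c \<le> d" for c d
      using that has_vector_derivative_at_within[OF f'] by (rule fundamental_theorem_of_calculus)
    have fi: "((\<lambda>v. g a *\<^sub>R f' v) has_integral g a *\<^sub>R (f b - f a)) {a..b}"
      using has_integral_cmul[OF ftc[of a b]] H by auto
    have eq: "g b *\<^sub>R f b - I b - (g a *\<^sub>R f a - I a) - (g b - g a) *\<^sub>R f u
       = (g b - g a) *\<^sub>R (f b - f u) - integral {a..b} (\<lambda>v. (g v - g a) *\<^sub>R f' v)"
    proof -
      have "integral {a..b} (\<lambda>v. (g v - g a) *\<^sub>R f' v) = (I b - I a) - g a *\<^sub>R (f b - f a)"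
        using fi i2 integral_unique[OF ftc[of a b]] H unfolding Iab
        by (simp add: scaleR_diff_left has_integral_integrable Henstock_Kurzweil_Integration.integral_diff integral_unique)
      then show ?thesis by (simp add: algebra_simps)
    qed
    have n1: "norm (f b - f u) \<le> M * (b - a)"
    proof -
      have "norm (integral {u..b} f') \<le> M * (b - u)"
        using H M by (intro integral_bound continuous_on_subset[OF cf']) auto
      also have "\<dots> \<le> M * (b - a)" using H M0 by auto
      finally show ?thesis using integral_unique[OF ftc[of u b]] H by simp
    qed
    have n2: "norm (integral {a..b} (\<lambda>v. (g v - g a) *\<^sub>R f' v)) \<le> (L * (b - a) * M) * (b - a)"
    proof (rule integral_bound)
      show "a \<le> b" using H by auto
      show "continuous_on {a..b} (\<lambda>v. (g v - g a) *\<^sub>R f' v)"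
        using H by (intro continuous_intros continuous_on_subset[OF cg] continuous_on_subset[OF cf']) auto
      fix v assume v: "v \<in> {a..b}"
      have "\<bar>g v - g a\<bar> \<le> L * (b - a)"
      proof -
        have "\<bar>g v - g a\<bar> \<le> L * (v - a)" using v H by (intro glip) auto
        also have "\<dots> \<le> L * (b - a)" using v L by (intro mult_left_mono) auto
        finally show ?thesis .
      qed
      moreover have "norm (f' v) \<le> M" using M v H by auto
      ultimately show "norm ((g v - g a) *\<^sub>R f' v) \<le> L * (b - a) * M"
        using M0 by (auto intro!: mult_mono)
    qed
    have "norm ((g b - g a) *\<^sub>R (f b - f u)) \<le> (L * (b - a)) * (M * (b - a))"
      using n1 glip[of a b] H L by (auto intro!: mult_mono)
    then have "norm ((g b - g a) *\<^sub>R (f b - f u) - integral {a..b} (\<lambda>v. (g v - g a) *\<^sub>R f' v))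
       \<le> (L * (b - a)) * (M * (b - a)) + (L * (b - a) * M) * (b - a)"
      using n2 by (intro order_trans[OF norm_triangle_ineq4] add_mono)
    then show ?thesis unfolding eq by (simp add: algebra_simps)
  qed
  have "stieltjes_primitive s t f g (\<lambda>r. g r *\<^sub>R f r - I r)" unfolding stieltjes_primitive_def
  proof (intro allI impI)
    fix \<epsilon> :: real assume e: "\<epsilon> > 0"
    define \<delta> where "\<delta> = \<epsilon> / (2 * L * M + 1)"
    have "2 * L * M + 1 > 0" using L M0 by (simp add: add_nonneg_pos)
    then have d: "\<delta> > 0" using e by (simp add: \<delta>_def)
    have "norm (g b *\<^sub>R f b - I b - (g a *\<^sub>R f a - I a) - (g b - g a) *\<^sub>R f u) \<le> \<epsilon> * (b - a)"
      if "s \<le> a \<and> a \<le> u \<and> u \<le> b \<and> b \<le> t \<and> b - a < \<delta>" for a u b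
    proof -
      have "2 * L * M * (b - a) \<le> (2 * L * M + 1) * \<delta>"
        using that L M0 \<open>2 * L * M + 1 > 0\<close> by (intro mult_mono) (auto simp del: mult_le_cancel_right)
      also have "\<dots> = \<epsilon>" using \<open>2 * L * M + 1 > 0\<close> by (simp add: \<delta>_def)
      finally have "2 * L * M * (b - a) * (b - a) \<le> \<epsilon> * (b - a)"
        using that by (intro mult_right_mono) auto
      then show ?thesis using key[of a u b] that by linarith
    qed
    then show "\<exists>\<delta>>0. \<forall>a u b. s \<le> a \<and> a \<le> u \<and> u \<le> b \<and> b \<le> t \<and> b - a < \<delta> \<longrightarrow>
       norm (g b *\<^sub>R f b - I b - (g a *\<^sub>R f a - I a) - (g b - g a) *\<^sub>R f u) \<le> \<epsilon> * (b - a)"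
      using d by blast
  qed
  then show ?thesis by (simp add: I_def)
next
  case False
  then show ?thesis unfolding stieltjes_primitive_def by (auto intro!: exI[of _ 1])
qed


section \<open>Existence and properties of the integral\<close>

lemma lipschitz_on_increment:
  fixes g :: "real \<Rightarrow> 'a::real_normed_vector"
  assumes "L-lipschitz_on {s..t} g" and "s \<le> a" and "a \<le> b" and "b \<le> t"
  shows "norm (g b - g a) \<le> L * (b - a)"
  using lipschitz_onD[OF assms(1), of b a] assms(2-4) by (simp add: dist_norm)

text \<open>Primitives depend continuously on the integrand in the uniform norm, at the level of increments and
linearly in the length of the interval.\<close>
lemma stieltjes_primitive_approx:
  assumes F: "stieltjes_primitive s t f g F" and F': "stieltjes_primitive s t f' g F'"
    and g: "L-lipschitz_on {s..t} g" and e: "\<And>u. s \<le> u \<Longrightarrow> u \<le> t \<Longrightarrow> norm (f u - f' u) \<le> e"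
    and ab: "s \<le> a" "a \<le> b" "b \<le> t"
  shows "norm ((F b - F' b) - (F a - F' a)) \<le> L * e * (b - a)"
proof -
  have L: "L \<ge> 0" using g lipschitz_on_nonneg by blast
  have e0: "e \<ge> 0" using order_trans[OF norm_ge_zero e[of a]] ab by simp
  have "norm ((F b - F' b) - (F a - F' a)) \<le> L * e * b - L * e * a"
  proof (rule stieltjes_primitive_bound[OF stieltjes_primitive_subinterval[OF stieltjes_primitive_diff[OF F F']]])
    fix u v assume uv: "a \<le> u" "u \<le> v" "v \<le> b"
    have "\<bar>g v - g u\<bar> * norm (f u - f' u) \<le> (L * (v - u)) * e"
      using lipschitz_on_increment[OF g, of u v] e[of u] uv ab L e0 by (intro mult_mono) auto
    then show "\<bar>g v - g u\<bar> * norm (f u - f' u) \<le> L * e * v - L * e * u"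
      by (simp add: algebra_simps)
  qed (use ab in auto)
  then show ?thesis by (simp add: algebra_simps)
qed

text \<open>Polynomials have primitives by integration by parts, they approximate \<open>f\<close> uniformly by Weierstrass,
and by the previous estimate their primitives converge and the limit inherits the defining local
estimate.\<close>
lemma stieltjes_primitive_exists:
  fixes f :: "real \<Rightarrow> 'a::euclidean_space"
  assumes f: "continuous_on {s..t} f" and g: "L-lipschitz_on {s..t} g"
  shows "\<exists>F. stieltjes_primitive s t f g F"
proof (cases "s \<le> t")
  case True
  have L: "L \<ge> 0" using g lipschitz_on_nonneg by blast
  have "\<exists>q F. (\<forall>u\<in>{s..t}. norm (f u - q u) \<le> e) \<and> stieltjes_primitive s t q g F \<and> F s = 0"
    if e: "e > 0" for e :: real
  proof -
    obtain q where q: "polynomial_function q" "\<forall>u\<in>{s..t}. norm (f u - q u) < e"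
      using Stone_Weierstrass_polynomial_function[OF compact_Icc f e] by blast
    obtain q' where q': "polynomial_function q'" "\<And>u. (q has_vector_derivative q' u) (at u)"
      using has_vector_derivative_polynomial_function[OF q(1)] by blast
    obtain F where "stieltjes_primitive s t q g F"
      using stieltjes_primitive_by_parts[OF g q'(2) continuous_on_polymonial_function[OF q'(1)]] by blast
    then have "stieltjes_primitive s t q g (\<lambda>r. F r - F s)"
      by (rule stieltjes_primitive_cong) auto
    then show ?thesis
      using q(2) by (intro exI[of _ q] exI[of _ "\<lambda>r. F r - F s"]) force
  qed
  then have "\<forall>n. \<exists>q F. (\<forall>u\<in>{s..t}. norm (f u - q u) \<le> inverse (real (Suc n))) \<and>
      stieltjes_primitive s t q g F \<and> F s = 0" by simp
  then obtain q F where q: "\<And>n u. u \<in> {s..t} \<Longrightarrow> norm (f u - q n u) \<le> inverse (real (Suc n))"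
    and F: "\<And>n. stieltjes_primitive s t (q n) g (F n)" and F0: "\<And>n. F n s = 0"
    by metis
  have near: "norm ((F n b - F m b) - (F n a - F m a)) \<le> L * (2 * inverse (real (Suc n))) * (b - a)"
    if "n \<le> m" "s \<le> a" "a \<le> b" "b \<le> t" for n m a b
  proof (rule stieltjes_primitive_approx[OF F F g _ that(2-4)])
    fix u assume u: "s \<le> u" "u \<le> t"
    have "inverse (real (Suc m)) \<le> inverse (real (Suc n))"
      using that(1) by (intro le_imp_inverse_le) auto
    moreover have "norm (q n u - q m u) \<le> norm (f u - q m u) + norm (f u - q n u)"
      using norm_triangle_ineq4[of "f u - q m u" "f u - q n u"] by simp
    moreover have "norm (f u - q n u) \<le> inverse (real (Suc n))" "norm (f u - q m u) \<le> inverse (real (Suc m))"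
      using q u by auto
    ultimately show "norm (q n u - q m u) \<le> 2 * inverse (real (Suc n))"
      by linarith
  qed
  have "convergent (\<lambda>n. F n r)" if r: "s \<le> r" "r \<le> t" for r
  proof -
    define c where "c = L * 2 * (r - s)"
    have "c \<ge> 0" using L r by (simp add: c_def)
    have "Cauchy (\<lambda>n. F n r)"
      unfolding Cauchy_altdef2
    proof (intro allI impI)
      fix e :: real assume "e > 0"
      obtain n where n: "c / e < real (Suc n)"
        by (metis lessI of_nat_less_iff less_trans reals_Archimedean2)
      then have "c * inverse (real (Suc n)) < e"
        using \<open>e > 0\<close> by (simp add: field_simps)
      moreover have "norm (F n r - F m r) \<le> c * inverse (real (Suc n))" if "m \<ge> n" for m
        using near[OF that, of s r] r F0 by (simp add: c_def algebra_simps)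
      ultimately have "\<forall>m\<ge>n. dist (F m r) (F n r) < e"
        by (metis dist_commute dist_norm order_le_less_trans)
      then show "\<exists>N. \<forall>n\<ge>N. dist (F n r) (F N r) < e" by blast
    qed
    then show ?thesis by (simp add: Cauchy_convergent_iff)
  qed
  then have lim: "(\<lambda>n. F n r) \<longlonglongrightarrow> lim (\<lambda>n. F n r)" if "s \<le> r" "r \<le> t" for r
    using that convergent_LIMSEQ_iff by blast
  define G where "G = (\<lambda>r. lim (\<lambda>n. F n r))"
  have dG: "norm ((F n b - G b) - (F n a - G a)) \<le> L * (2 * inverse (real (Suc n))) * (b - a)"
    if H: "s \<le> a" "a \<le> b" "b \<le> t" for n a b
  proof (rule tendsto_upperbound)
    show "(\<lambda>m. norm ((F n b - F m b) - (F n a - F m a))) \<longlonglongrightarrow> norm ((F n b - G b) - (F n a - G a))"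
      unfolding G_def using H by (intro tendsto_intros lim) auto
    show "\<forall>\<^sub>F m in sequentially. norm ((F n b - F m b) - (F n a - F m a))
        \<le> L * (2 * inverse (real (Suc n))) * (b - a)"
      using eventually_ge_at_top[of n] by eventually_elim (use near H in blast)
  qed simp
  have tri: "norm (X - Y - Z) \<le> A + B + C" if "norm X \<le> A" "norm Y \<le> B" "norm Z \<le> C"
    for X Y Z :: 'a and A B C
    using that norm_triangle_ineq4[of "X - Y" Z] norm_triangle_ineq4[of X Y] by linarith
  have "stieltjes_primitive s t f g G" unfolding stieltjes_primitive_def
  proof (intro allI impI)
    fix \<epsilon> :: real assume e: "\<epsilon> > 0"
    obtain n where n: "6 * L / \<epsilon> < real (Suc n)"
      by (metis lessI of_nat_less_iff less_trans reals_Archimedean2)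
    define \<eta> where "\<eta> = inverse (real (Suc n))"
    have Le: "3 * (L * \<eta>) \<le> \<epsilon> / 2"
      using n e unfolding \<eta>_def by (simp add: field_simps)
    obtain \<delta> where d: "\<delta> > 0" and D: "\<And>a u b. s \<le> a \<Longrightarrow> a \<le> u \<Longrightarrow> u \<le> b \<Longrightarrow> b \<le> t \<Longrightarrow> b - a < \<delta> \<Longrightarrow>
        norm (F n b - F n a - (g b - g a) *\<^sub>R q n u) \<le> \<epsilon> / 2 * (b - a)"
      using stieltjes_primitiveD[OF F[of n], of "\<epsilon> / 2"] e by auto
    have "norm (G b - G a - (g b - g a) *\<^sub>R f u) \<le> \<epsilon> * (b - a)"
      if H: "s \<le> a \<and> a \<le> u \<and> u \<le> b \<and> b \<le> t \<and> b - a < \<delta>" for a u b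
    proof -
      have 1: "norm (F n b - F n a - (g b - g a) *\<^sub>R q n u) \<le> \<epsilon> / 2 * (b - a)"
        using D H by blast
      have 2: "norm ((F n b - G b) - (F n a - G a)) \<le> L * (2 * \<eta>) * (b - a)"
        using dG H by (simp add: \<eta>_def)
      have 3: "norm ((g b - g a) *\<^sub>R (f u - q n u)) \<le> (L * (b - a)) * \<eta>"
        using lipschitz_on_increment[OF g, of a b] q[of u n] H L
        unfolding norm_scaleR \<eta>_def by (intro mult_mono) auto
      have "G b - G a - (g b - g a) *\<^sub>R f u = (F n b - F n a - (g b - g a) *\<^sub>R q n u)
          - ((F n b - G b) - (F n a - G a)) - (g b - g a) *\<^sub>R (f u - q n u)"
        by (simp add: algebra_simps)
      also have "norm \<dots> \<le> \<epsilon> / 2 * (b - a) + L * (2 * \<eta>) * (b - a) + (L * (b - a)) * \<eta>"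
        using 1 2 3 tri by blast
      also have "\<dots> = (\<epsilon> / 2 + 3 * (L * \<eta>)) * (b - a)" by (simp add: algebra_simps)
      also have "\<dots> \<le> \<epsilon> * (b - a)" using Le H by (intro mult_right_mono) auto
      finally show ?thesis .
    qed
    then show "\<exists>\<delta>>0. \<forall>a u b. s \<le> a \<and> a \<le> u \<and> u \<le> b \<and> b \<le> t \<and> b - a < \<delta> \<longrightarrow>
        norm (G b - G a - (g b - g a) *\<^sub>R f u) \<le> \<epsilon> * (b - a)"
      using d by blast
  qed
  then show ?thesis by blast
next
  case False
  then show ?thesis unfolding stieltjes_primitive_def by (auto intro!: exI[of _ 1])
qed

lemma stieltjes_primitive_integral:
  fixes f :: "real \<Rightarrow> 'a::euclidean_space"
  assumes "continuous_on {s..t} f" and "L-lipschitz_on {s..t} g"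
  shows "stieltjes_primitive s t f g (\<lambda>r. stieltjes_integral s r f g)"
proof -
  obtain F where F: "stieltjes_primitive s t f g F"
    using stieltjes_primitive_exists[OF assms] by blast
  show ?thesis
    by (rule stieltjes_primitive_cong[OF F]) (auto simp: stieltjes_integral_primitive[OF F])
qed

lemma stieltjes_integral_refl [simp]: "stieltjes_integral s s f g = 0"
proof -
  have "b = a" if "s \<le> a \<and> a \<le> u \<and> u \<le> b \<and> b \<le> s \<and> b - a < 1" for a b u :: real
    using that by linarith
  then have "stieltjes_primitive s s f g (\<lambda>_. 0)"
    unfolding stieltjes_primitive_def by (fastforce intro!: exI[of _ 1])
  then show ?thesis using stieltjes_integral_primitive[of s s f g "\<lambda>_. 0" s s] by simp
qed

lemma stieltjes_integral_combine:
  fixes f :: "real \<Rightarrow> 'a::euclidean_space"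
  assumes "continuous_on {s..u} f" and "L-lipschitz_on {s..u} g" and "s \<le> t" and "t \<le> u"
  shows "stieltjes_integral s u f g = stieltjes_integral s t f g + stieltjes_integral t u f g"
proof -
  obtain F where F: "stieltjes_primitive s u f g F"
    using stieltjes_primitive_exists[OF assms(1,2)] by blast
  then show ?thesis using assms(3,4) by (simp add: stieltjes_integral_primitive[OF F])
qed

lemma stieltjes_integral_cong:
  fixes f f' :: "real \<Rightarrow> 'a::euclidean_space"
  assumes f: "continuous_on {s..t} f" and g: "L-lipschitz_on {s..t} g" and st: "s \<le> t"
    and ff: "\<And>u. s \<le> u \<Longrightarrow> u \<le> t \<Longrightarrow> f' u = f u"
    and gg: "\<And>a b. s \<le> a \<Longrightarrow> a \<le> b \<Longrightarrow> b \<le> t \<Longrightarrow> g' b - g' a = g b - g a"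
  shows "stieltjes_integral s t f' g' = stieltjes_integral s t f g"
proof -
  obtain F where F: "stieltjes_primitive s t f g F"
    using stieltjes_primitive_exists[OF f g] by blast
  have F': "stieltjes_primitive s t f' g' F"
    by (rule stieltjes_primitive_cong[OF F ff gg]) auto
  show ?thesis using st
    by (simp add: stieltjes_integral_primitive[OF F] stieltjes_integral_primitive[OF F'])
qed

lemma stieltjes_integral_add:
  fixes f f' :: "real \<Rightarrow> 'a::euclidean_space"
  assumes "continuous_on {s..t} f" "continuous_on {s..t} f'" and "L-lipschitz_on {s..t} g" and "s \<le> t"
  shows "stieltjes_integral s t (\<lambda>u. f u + f' u) g = stieltjes_integral s t f g + stieltjes_integral s t f' g"
proof -
  obtain F F' where F: "stieltjes_primitive s t f g F" and F': "stieltjes_primitive s t f' g F'"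
    using stieltjes_primitive_exists assms by metis
  then show ?thesis using assms(4)
    by (simp add: stieltjes_integral_primitive[OF F] stieltjes_integral_primitive[OF F']
        stieltjes_integral_primitive[OF stieltjes_primitive_add[OF F F']])
qed

lemma stieltjes_integral_bounded_linear:
  fixes f :: "real \<Rightarrow> 'a::euclidean_space"
  assumes "continuous_on {s..t} f" and "L-lipschitz_on {s..t} g" and "s \<le> t" and "bounded_linear h"
  shows "stieltjes_integral s t (\<lambda>u. h (f u)) g = h (stieltjes_integral s t f g)"
proof -
  interpret h: bounded_linear h by fact
  obtain F where F: "stieltjes_primitive s t f g F"
    using stieltjes_primitive_exists assms by metis
  then show ?thesis using assms(3)
    by (simp add: stieltjes_integral_primitive[OF F] h.diff
        stieltjes_integral_primitive[OF stieltjes_primitive_bounded_linear[OF F assms(4)]])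
qed

lemma stieltjes_integral_diff:
  fixes f f' :: "real \<Rightarrow> 'a::euclidean_space"
  assumes "continuous_on {s..t} f" "continuous_on {s..t} f'" and "L-lipschitz_on {s..t} g" and "s \<le> t"
  shows "stieltjes_integral s t (\<lambda>u. f u - f' u) g = stieltjes_integral s t f g - stieltjes_integral s t f' g"
proof -
  obtain F F' where F: "stieltjes_primitive s t f g F" and F': "stieltjes_primitive s t f' g F'"
    using stieltjes_primitive_exists assms by metis
  then show ?thesis using assms(4)
    by (simp add: stieltjes_integral_primitive[OF F] stieltjes_integral_primitive[OF F']
        stieltjes_integral_primitive[OF stieltjes_primitive_diff[OF F F']])
qed

lemma stieltjes_integral_sum:
  fixes f :: "'i \<Rightarrow> real \<Rightarrow> 'a::euclidean_space"
  assumes "finite A" and "\<And>i. i \<in> A \<Longrightarrow> continuous_on {s..t} (f i)" and "L-lipschitz_on {s..t} g" and "s \<le> t"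
  shows "stieltjes_integral s t (\<lambda>u. \<Sum>i\<in>A. f i u) g = (\<Sum>i\<in>A. stieltjes_integral s t (f i) g)"
  using assms(1,2)
proof (induction A rule: finite_induct)
  case empty
  then show ?case using stieltjes_integral_const[OF assms(4), of 0 g] by simp
next
  case (insert i A)
  then show ?case using assms(3,4)
    by (simp add: stieltjes_integral_add continuous_on_sum)
qed

lemma lipschitz_on_stieltjes_integral:
  fixes f :: "real \<Rightarrow> 'a::euclidean_space"
  assumes f: "continuous_on {s..t} f" and g: "L-lipschitz_on {s..t} g"
  shows "\<exists>M. M-lipschitz_on {s..t} (\<lambda>r. stieltjes_integral s r f g)"
proof -
  have L: "L \<ge> 0" using g lipschitz_on_nonneg by blast
  have "bounded (f ` {s..t})" using f compact_Icc compact_continuous_image compact_imp_bounded by blast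
  then obtain B where B: "B > 0" "\<And>u. u \<in> {s..t} \<Longrightarrow> norm (f u) \<le> B"
    by (metis bounded_pos imageI)
  have P: "stieltjes_primitive s t f g (\<lambda>r. stieltjes_integral s r f g)"
    by (rule stieltjes_primitive_integral[OF f g])
  have Z: "stieltjes_primitive s t (\<lambda>_. 0) g (\<lambda>r. 0)"
    unfolding stieltjes_primitive_def by (auto intro!: exI[of _ 1])
  have "norm (stieltjes_integral s b f g - stieltjes_integral s a f g) \<le> L * B * (b - a)"
    if "s \<le> a" "a \<le> b" "b \<le> t" for a b
    using stieltjes_primitive_approx[OF P Z g _ that, of B] B(2) by simp
  then have "(L * B)-lipschitz_on {s..t} (\<lambda>r. stieltjes_integral s r f g)"
    using L B(1) by (intro lipschitz_on_leI) (auto simp: dist_norm norm_minus_commute)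
  then show ?thesis by blast
qed

lemma continuous_on_stieltjes_integral:
  fixes f :: "real \<Rightarrow> 'a::euclidean_space"
  assumes "continuous_on {s..t} f" and "L-lipschitz_on {s..t} g"
  shows "continuous_on {s..t} (\<lambda>r. stieltjes_integral s r f g)"
  using lipschitz_on_stieltjes_integral[OF assms] lipschitz_on_continuous_on by blast


section \<open>Equations driven by a Lipschitz path\<close>

text \<open>\<open>v t - v s\<close> bounds the length of \<open>x\<close> on \<open>[s, t]\<close>. Unlike the total variation itself, such an additive
majorant restricts to subintervals and concatenates trivially.\<close>
definition length_control :: "real \<Rightarrow> real \<Rightarrow> (real \<Rightarrow> 'a::real_normed_vector) \<Rightarrow> (real \<Rightarrow> real) \<Rightarrow> bool" where
  "length_control s t x v \<longleftrightarrow>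
     (\<forall>a b. s \<le> a \<and> a \<le> b \<and> b \<le> t \<longrightarrow> norm (x b - x a) \<le> v b - v a)"

lemma length_controlD:
  "length_control s t x v \<Longrightarrow> s \<le> a \<Longrightarrow> a \<le> b \<Longrightarrow> b \<le> t \<Longrightarrow> norm (x b - x a) \<le> v b - v a"
  unfolding length_control_def by blast

lemma length_control_mono:
  assumes "length_control s t x v" and "s \<le> a" and "a \<le> b" and "b \<le> t"
  shows "v a \<le> v b"
  using length_controlD[OF assms] norm_ge_zero[of "x b - x a"] by linarith

lemma length_control_subinterval:
  "length_control s t x v \<Longrightarrow> s \<le> a \<Longrightarrow> b \<le> t \<Longrightarrow> length_control a b x v"
  unfolding length_control_def by auto

lemma length_control_lipschitz:
  assumes "L-lipschitz_on {s..t} x"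
  shows "length_control s t x (\<lambda>u. L * u)"
  unfolding length_control_def
  using lipschitz_on_increment[OF assms] by (simp add: right_diff_distrib)

lemma length_control_component:
  fixes x :: "real \<Rightarrow> real ^ 'd"
  assumes "length_control s t x v" and "s \<le> a" and "a \<le> b" and "b \<le> t"
  shows "\<bar>x b $ i - x a $ i\<bar> \<le> v b - v a"
  using component_le_norm_cart[of "x b - x a" i] length_controlD[OF assms] by simp

lemma lipschitz_on_component:
  fixes x :: "real \<Rightarrow> real ^ 'd"
  assumes "L-lipschitz_on S x"
  shows "L-lipschitz_on S (\<lambda>u. x u $ i)"
proof (rule lipschitz_onI)
  show "0 \<le> L" using assms lipschitz_on_nonneg by blast
  fix a b assume "a \<in> S" "b \<in> S"
  then show "dist (x a $ i) (x b $ i) \<le> L * dist a b"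
    using dist_vec_nth_le[of "x a" i "x b"] lipschitz_onD[OF assms] order_trans by blast
qed

abbreviation driven_integral ::
  "(real \<Rightarrow> real ^ 'd::finite) \<Rightarrow> ('d \<Rightarrow> real \<Rightarrow> 'a::real_normed_vector) \<Rightarrow> real \<Rightarrow> real \<Rightarrow> 'a" where
  "driven_integral x f s t \<equiv> (\<Sum>i\<in>UNIV. stieltjes_integral s t (f i) (\<lambda>u. x u $ i))"

lemma stieltjes_integral_bound:
  fixes f :: "real \<Rightarrow> 'a::euclidean_space" and x :: "real \<Rightarrow> real ^ 'd::finite"
  assumes f: "continuous_on {s..t} f" and x: "L-lipschitz_on {s..t} x"
    and v: "length_control s t x v" and st: "s \<le> t"
    and B: "\<And>u. s \<le> u \<Longrightarrow> u \<le> t \<Longrightarrow> norm (f u) \<le> B"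
  shows "norm (stieltjes_integral s t f (\<lambda>u. x u $ i)) \<le> B * (v t - v s)"
proof -
  obtain F where F: "stieltjes_primitive s t f (\<lambda>u. x u $ i) F"
    using stieltjes_primitive_exists[OF f lipschitz_on_component[OF x]] by blast
  have "norm (F t - F s) \<le> B * v t - B * v s"
  proof (rule stieltjes_primitive_bound[OF F st])
    fix u b assume ub: "s \<le> u" "u \<le> b" "b \<le> t"
    have "\<bar>x b $ i - x u $ i\<bar> * norm (f u) \<le> (v b - v u) * B"
      using length_control_component[OF v ub] B[of u] ub length_control_mono[OF v ub]
      by (intro mult_mono) auto
    then show "\<bar>x b $ i - x u $ i\<bar> * norm (f u) \<le> B * v b - B * v u"
      by (simp add: algebra_simps)
  qed
  then show ?thesis
    using stieltjes_integral_primitive[OF F, of s t] st by (simp add: right_diff_distrib)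
qed

lemma driven_integral_bound:
  fixes f :: "'d::finite \<Rightarrow> real \<Rightarrow> 'a::euclidean_space" and x :: "real \<Rightarrow> real ^ 'd"
  assumes "\<And>i. continuous_on {s..t} (f i)" and "L-lipschitz_on {s..t} x"
    and "length_control s t x v" and "s \<le> t"
    and "\<And>i u. s \<le> u \<Longrightarrow> u \<le> t \<Longrightarrow> norm (f i u) \<le> B"
  shows "norm (driven_integral x f s t) \<le> real CARD('d) * (B * (v t - v s))"
  using sum_norm_bound[of UNIV "\<lambda>i. stieltjes_integral s t (f i) (\<lambda>u. x u $ i)" "B * (v t - v s)"]
    stieltjes_integral_bound[OF assms(1-4)] assms(5) by simp

text \<open>The Gronwall step, measured in length instead of time. The weight \<open>E = exp (\<kappa> (v - v s))\<close> satisfies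
\<open>\<kappa> (v b - v u) E u \<le> E b - E u\<close> by convexity of the exponential, so integrating it gains a factor
\<open>1 / \<kappa>\<close>.\<close>
lemma driven_integral_exp_bound:
  fixes f :: "'d::finite \<Rightarrow> real \<Rightarrow> 'a::euclidean_space" and x :: "real \<Rightarrow> real ^ 'd"
  assumes f: "\<And>i. continuous_on {s..t} (f i)" and x: "L-lipschitz_on {s..t} x"
    and v: "length_control s t x v" and st: "s \<le> t" and lam: "\<kappa> > 0"
    and B: "\<And>i u. s \<le> u \<Longrightarrow> u \<le> t \<Longrightarrow> norm (f i u) \<le> m * exp (\<kappa> * (v u - v s))"
  shows "norm (driven_integral x f s t) \<le> real CARD('d) * (m / \<kappa> * (exp (\<kappa> * (v t - v s)) - 1))"
proof -
  define E where "E = (\<lambda>u. exp (\<kappa> * (v u - v s)))"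
  have "0 \<le> m * exp (\<kappa> * (v s - v s))" using B[of s undefined] st order_trans[OF norm_ge_zero] by auto
  then have m: "m \<ge> 0" by simp
  have "norm (stieltjes_integral s t (f i) (\<lambda>u. x u $ i)) \<le> m / \<kappa> * (E t - 1)" for i
  proof -
    obtain F where F: "stieltjes_primitive s t (f i) (\<lambda>u. x u $ i) F"
      using stieltjes_primitive_exists[OF f lipschitz_on_component[OF x]] by blast
    have "norm (F t - F s) \<le> m / \<kappa> * E t - m / \<kappa> * E s"
    proof (rule stieltjes_primitive_bound[OF F st])
      fix u b assume ub: "s \<le> u" "u \<le> b" "b \<le> t"
      have conv: "\<kappa> * (v b - v u) * E u \<le> E b - E u"
      proof -
        have "E b = E u * exp (\<kappa> * (v b - v u))"
          by (simp add: E_def exp_add[symmetric] algebra_simps)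
        moreover have "1 + \<kappa> * (v b - v u) \<le> exp (\<kappa> * (v b - v u))" by (rule exp_ge_add_one_self)
        moreover have "E u > 0" by (simp add: E_def)
        ultimately have "E u * (1 + \<kappa> * (v b - v u)) \<le> E b" by simp
        then show ?thesis by (simp add: algebra_simps)
      qed
      have "\<bar>x b $ i - x u $ i\<bar> * norm (f i u) \<le> (v b - v u) * (m * E u)"
        using length_control_component[OF v ub] B[of u i] ub length_control_mono[OF v ub]
        by (intro mult_mono) (auto simp: E_def)
      also have "\<dots> = m / \<kappa> * (\<kappa> * (v b - v u) * E u)" using lam by simp
      also have "\<dots> \<le> m / \<kappa> * (E b - E u)" using conv m lam by (intro mult_left_mono) auto
      finally show "\<bar>x b $ i - x u $ i\<bar> * norm (f i u) \<le> m / \<kappa> * E b - m / \<kappa> * E u"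
        by (simp add: right_diff_distrib)
    qed
    then show ?thesis
      using stieltjes_integral_primitive[OF F, of s t] st by (simp add: E_def right_diff_distrib)
  qed
  then show ?thesis
    using sum_norm_bound[of UNIV "\<lambda>i. stieltjes_integral s t (f i) (\<lambda>u. x u $ i)" "m / \<kappa> * (E t - 1)"]
    by (simp add: E_def)
qed

lemma solves_onD:
  assumes "solves_on V s t z x y"
  shows "continuous_on {s..t} y"
    and "s \<le> r \<Longrightarrow> r \<le> t \<Longrightarrow> y r = z + driven_integral x (\<lambda>i u. V i (y u)) s r"
  using assms unfolding solves_on_def by auto

lemma solves_on_initial:
  assumes "solves_on V s t z x y" and "s \<le> t"
  shows "y s = z"
  using solves_onD(2)[OF assms(1), of s] assms(2) by simp

lemma continuous_on_lipschitz_compose: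
  assumes "C-lipschitz_on UNIV h" and "continuous_on S y"
  shows "continuous_on S (\<lambda>u. h (y u))"
  using continuous_on_compose2[OF lipschitz_on_continuous_on[OF assms(1)] assms(2)] by auto

text \<open>Let \<open>m\<close> be the supremum of the distance of the two solutions divided by the weight \<open>E\<close>. The integral
equation and \<open>driven_integral_exp_bound\<close> bound this quotient by \<open>norm (z - z') + m / 2\<close>, hence
\<open>m \<le> 2 norm (z - z')\<close>. The second estimate is small for short drivers, whatever their Lipschitz
constant.\<close>
lemma solves_on_stability:
  fixes V :: "'d::finite \<Rightarrow> real ^ 'e::finite \<Rightarrow> real ^ 'e" and x :: "real \<Rightarrow> real ^ 'd"
  assumes V: "\<And>i. C-lipschitz_on UNIV (V i)" and C: "C > 0"
    and x: "L-lipschitz_on {s..t} x" and v: "length_control s t x v"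
    and y: "solves_on V s t z x y" and y': "solves_on V s t z' x y'"
    and r: "s \<le> r" "r \<le> t"
  defines "\<kappa> \<equiv> 2 * real CARD('d) * C"
  shows "norm (y r - y' r) \<le> 2 * norm (z - z') * exp (\<kappa> * (v r - v s))"
    and "norm ((y r - z) - (y' r - z')) \<le> norm (z - z') * (exp (\<kappa> * (v r - v s)) - 1)"
proof -
  have st: "s \<le> t" using r by simp
  \<comment> \<open>This \<open>\<kappa>\<close> makes the factor gained from the weight equal to \<open>1/2\<close>.\<close>
  have lam: "\<kappa> > 0" using C by (simp add: \<kappa>_def)
  define E where "E = (\<lambda>u. exp (\<kappa> * (v u - v s)))"
  have E1: "1 \<le> E u" if "s \<le> u" "u \<le> t" for u
    using length_control_mono[OF v, of s u] that lam by (simp add: E_def)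
  note cy = solves_onD(1)[OF y] and cy' = solves_onD(1)[OF y']
  define D where "D = (\<lambda>u. norm (y u - y' u))"
  have "bounded (D ` {s..t})" unfolding D_def
    by (intro compact_imp_bounded compact_continuous_image continuous_intros cy cy' compact_Icc)
  then obtain B where "\<forall>w\<in>D ` {s..t}. norm w \<le> B"
    unfolding bounded_iff by blast
  then have B: "\<And>u. u \<in> {s..t} \<Longrightarrow> D u \<le> B" by (force simp: D_def)
  define q where "q = (\<lambda>u. D u / E u)"
  have qB: "q u \<le> B" if "u \<in> {s..t}" for u
  proof -
    have "q u \<le> D u / 1" unfolding q_def using E1[of u] that by (intro divide_left_mono) (auto simp: D_def)
    then show ?thesis using B[OF that] by simp
  qed
  define m where "m = (SUP u\<in>{s..t}. q u)"
  have qm: "q u \<le> m" if "u \<in> {s..t}" for u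
    unfolding m_def using that qB by (intro cSUP_upper bdd_aboveI2) auto
  have Dm: "D u \<le> m * E u" if "s \<le> u" "u \<le> t" for u
    using qm[of u] E1[of u] that by (simp add: q_def field_simps)
  have step: "norm ((y r - z) - (y' r - z')) \<le> m / 2 * (E r - 1)" if r: "s \<le> r" "r \<le> t" for r
  proof -
    have cV: "continuous_on {s..r} (\<lambda>u. V i (y u))" "continuous_on {s..r} (\<lambda>u. V i (y' u))" for i
      using r by (auto intro!: continuous_on_lipschitz_compose[OF V]
          intro: continuous_on_subset[OF cy] continuous_on_subset[OF cy'])
    have xr: "L-lipschitz_on {s..r} x" using lipschitz_on_subset[OF x] r by auto
    have vr: "length_control s r x v" using length_control_subinterval[OF v] r by auto
    have "(y r - z) - (y' r - z') = driven_integral x (\<lambda>i u. V i (y u) - V i (y' u)) s r"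
      using solves_onD(2)[OF y r] solves_onD(2)[OF y' r]
      by (simp add: stieltjes_integral_diff[OF cV lipschitz_on_component[OF xr] r(1)] sum_subtractf)
    also have "norm \<dots> \<le> real CARD('d) * (C * m / \<kappa> * (exp (\<kappa> * (v r - v s)) - 1))"
    proof (rule driven_integral_exp_bound[OF _ xr vr r(1) lam])
      show "continuous_on {s..r} (\<lambda>u. V i (y u) - V i (y' u))" for i
        using cV by (intro continuous_intros)
      fix i u assume u: "s \<le> u" "u \<le> r"
      have "norm (V i (y u) - V i (y' u)) \<le> C * D u"
        using lipschitz_onD[OF V, of "y u" "y' u"] by (simp add: dist_norm D_def)
      also have "\<dots> \<le> C * (m * E u)" using Dm[of u] u r C by (intro mult_left_mono) auto
      finally show "norm (V i (y u) - V i (y' u)) \<le> C * m * exp (\<kappa> * (v u - v s))"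
        by (simp add: E_def mult_ac)
    qed
    also have "\<dots> = m / 2 * (E r - 1)" using C by (simp add: \<kappa>_def E_def)
    finally show ?thesis .
  qed
  have m0: "m \<ge> 0"
  proof -
    have "q s \<ge> 0" by (simp add: q_def D_def E_def)
    then show ?thesis using qm[of s] st by simp
  qed
  have "q r \<le> norm (z - z') + m / 2" if r: "r \<in> {s..t}" for r
  proof -
    have "D r \<le> norm ((y r - z) - (y' r - z')) + norm (z - z')"
      unfolding D_def using norm_triangle_ineq[of "(y r - z) - (y' r - z')" "z - z'"] by simp
    also have "\<dots> \<le> m / 2 * (E r - 1) + norm (z - z')" using step r by simp
    also have "\<dots> \<le> m / 2 * E r + norm (z - z') * E r"
      using m0 E1[of r] r mult_left_mono[of 1 "E r" "norm (z - z')"]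
        mult_left_mono[of "E r - 1" "E r" "m / 2"] by simp
    finally have "D r \<le> (norm (z - z') + m / 2) * E r" by (simp add: algebra_simps)
    then show ?thesis using E1[of r] r by (simp add: q_def divide_le_eq)
  qed
  then have "m \<le> norm (z - z') + m / 2" unfolding m_def using st by (intro cSUP_least) auto
  then have m: "m \<le> 2 * norm (z - z')" by simp
  have "D r \<le> m * E r" using Dm r by blast
  also have "\<dots> \<le> 2 * norm (z - z') * E r" using m E1[OF r] by (intro mult_right_mono) auto
  finally show "norm (y r - y' r) \<le> 2 * norm (z - z') * exp (\<kappa> * (v r - v s))"
    by (simp add: D_def E_def)
  have "norm ((y r - z) - (y' r - z')) \<le> m / 2 * (E r - 1)" using step r by blast
  also have "\<dots> \<le> norm (z - z') * (E r - 1)" using m E1[OF r] by (intro mult_right_mono) auto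
  finally show "norm ((y r - z) - (y' r - z')) \<le> norm (z - z') * (exp (\<kappa> * (v r - v s)) - 1)"
    by (simp add: E_def)
qed

text \<open>Picard iteration on the whole interval at once: with the weight \<open>E\<close> of the stability
estimate for \<open>v u = L u\<close>, in the unknown \<open>\<phi> = y / E\<close> the integral equation is a
fixed point problem for a contraction with constant \<open>1/2\<close> on bounded continuous functions. Functions
on \<open>[s, t]\<close> are extended to the line by clamping the argument.\<close>
lemma solves_on_exists:
  fixes V :: "'d::finite \<Rightarrow> real ^ 'e::finite \<Rightarrow> real ^ 'e" and x :: "real \<Rightarrow> real ^ 'd"
  assumes V: "\<And>i. C-lipschitz_on UNIV (V i)" and C: "C > 0"
    and x: "L-lipschitz_on {s..t} x" and st: "s \<le> t"
  shows "\<exists>y. solves_on V s t z x y"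
proof -
  have L: "L \<ge> 0" using x lipschitz_on_nonneg by blast
  define v where "v = (\<lambda>u. L * u)"
  have v: "length_control s t x v" unfolding v_def by (rule length_control_lipschitz[OF x])
  define \<kappa> where "\<kappa> = 2 * real CARD('d) * C"
  have lam: "\<kappa> > 0" using C by (simp add: \<kappa>_def)
  define E where "E = (\<lambda>u. exp (\<kappa> * (v u - v s)))"
  have cE: "continuous_on S E" for S unfolding E_def v_def by (intro continuous_intros)
  have E0: "E u > 0" for u by (simp add: E_def)
  define h where "h = (\<lambda>\<phi> :: real \<Rightarrow> real ^ 'e. \<lambda>r.
     (1 / E r) *\<^sub>R (z + driven_integral x (\<lambda>i u. V i (E u *\<^sub>R \<phi> u)) s r))"
  have cV: "continuous_on {s..t} (\<lambda>u. V i (E u *\<^sub>R \<phi> u))" if "continuous_on UNIV \<phi>"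
    for \<phi> :: "real \<Rightarrow> real ^ 'e" and i
    by (intro continuous_on_lipschitz_compose[OF V] continuous_intros cE continuous_on_subset[OF that]) auto
  have ch: "continuous_on {s..t} (h \<phi>)" if "continuous_on UNIV \<phi>" for \<phi>
    unfolding h_def using E0
    by (intro continuous_intros cE continuous_on_stieltjes_integral[OF cV[OF that] lipschitz_on_component[OF x]])
      (auto simp: less_le)
  define c where "c = (\<lambda>r. max s (min t r))"
  have c: "s \<le> c r" "c r \<le> t" for r using st by (auto simp: c_def)
  have cid: "c r = r" if "s \<le> r" "r \<le> t" for r using that by (auto simp: c_def)
  have cc: "continuous_on UNIV c" unfolding c_def by (intro continuous_intros)
  have bc: "(\<lambda>r. h \<phi> (c r)) \<in> bcontfun" if "continuous_on UNIV \<phi>" for \<phi>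
  proof -
    have "continuous_on UNIV (\<lambda>r. h \<phi> (c r))"
      using c by (intro continuous_on_compose2[OF ch[OF that] cc]) auto
    moreover have "bounded (h \<phi> ` {s..t})"
      using compact_imp_bounded[OF compact_continuous_image[OF ch[OF that] compact_Icc]] .
    then have "bounded (range (\<lambda>r. h \<phi> (c r)))" using c by (elim bounded_subset) auto
    ultimately show ?thesis by (simp add: bcontfun_def)
  qed
  define T where "T = (\<lambda>\<phi> :: real \<Rightarrow>\<^sub>C (real ^ 'e). Bcontfun (\<lambda>r. h (apply_bcontfun \<phi>) (c r)))"
  have Tap: "apply_bcontfun (T \<phi>) r = h (apply_bcontfun \<phi>) (c r)" for \<phi> r
    unfolding T_def using Bcontfun_inverse[OF bc[OF continuous_on_apply_bcontfun]] by simp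
  have contr: "dist (T \<phi>) (T \<psi>) \<le> 1 / 2 * dist \<phi> \<psi>" for \<phi> \<psi>
  proof (rule dist_bound)
    fix r0 define r where "r = c r0"
    have r: "s \<le> r" "r \<le> t" using c by (auto simp: r_def)
    define M where "M = dist \<phi> \<psi>"
    have xr: "L-lipschitz_on {s..r} x" using lipschitz_on_subset[OF x] r by auto
    have vr: "length_control s r x v" using length_control_subinterval[OF v] r by auto
    have cVr: "continuous_on {s..r} (\<lambda>u. V i (E u *\<^sub>R apply_bcontfun \<xi> u))" for i and \<xi> :: "real \<Rightarrow>\<^sub>C (real ^ 'e)"
      using continuous_on_subset[OF cV[OF continuous_on_apply_bcontfun]] r by auto
    have "h \<phi> r - h \<psi> r = (1 / E r) *\<^sub>R driven_integral x (\<lambda>i u. V i (E u *\<^sub>R \<phi> u) - V i (E u *\<^sub>R \<psi> u)) s r"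
      unfolding h_def
      by (simp add: stieltjes_integral_diff[OF cVr cVr lipschitz_on_component[OF xr] r(1)] sum_subtractf
          algebra_simps)
    then have "norm (h \<phi> r - h \<psi> r) = (1 / E r) *
        norm (driven_integral x (\<lambda>i u. V i (E u *\<^sub>R \<phi> u) - V i (E u *\<^sub>R \<psi> u)) s r)"
      using E0[of r] by simp
    also have "\<dots> \<le> (1 / E r) * (real CARD('d) * (C * M / \<kappa> * (exp (\<kappa> * (v r - v s)) - 1)))"
    proof (intro mult_left_mono driven_integral_exp_bound[OF _ xr vr r(1) lam])
      show "continuous_on {s..r} (\<lambda>u. V i (E u *\<^sub>R \<phi> u) - V i (E u *\<^sub>R \<psi> u))" for i
        using cVr by (intro continuous_intros)
      fix i u
      have "norm (V i (E u *\<^sub>R \<phi> u) - V i (E u *\<^sub>R \<psi> u)) \<le> C * dist (E u *\<^sub>R \<phi> u) (E u *\<^sub>R \<psi> u)"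
        using lipschitz_onD[OF V, of "E u *\<^sub>R \<phi> u" "E u *\<^sub>R \<psi> u"] by (simp add: dist_norm)
      also have "\<dots> \<le> C * (E u * M)"
        using dist_bounded[of \<phi> u \<psi>] E0[of u] C unfolding M_def
        by (intro mult_left_mono) (auto simp: dist_norm simp flip: scaleR_diff_right)
      finally show "norm (V i (E u *\<^sub>R \<phi> u) - V i (E u *\<^sub>R \<psi> u)) \<le> C * M * exp (\<kappa> * (v u - v s))"
        by (simp add: E_def mult_ac)
    qed (use E0[of r] in auto)
    also have "\<dots> = (1 / E r) * (M / 2 * (E r - 1))" using C by (simp add: \<kappa>_def E_def)
    also have "\<dots> \<le> 1 / 2 * M" using E0[of r] by (simp add: M_def field_simps)
    finally show "dist (apply_bcontfun (T \<phi>) r0) (apply_bcontfun (T \<psi>) r0) \<le> 1 / 2 * dist \<phi> \<psi>"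
      by (simp add: Tap dist_norm r_def M_def)
  qed
  have "\<exists>!\<phi>. T \<phi> = \<phi>" by (rule banach_fix_type[of "1/2"]) (use contr in auto)
  then obtain \<phi> where \<phi>: "T \<phi> = \<phi>" by blast
  define y where "y = (\<lambda>r. E r *\<^sub>R apply_bcontfun \<phi> r)"
  have "y r = z + driven_integral x (\<lambda>i u. V i (y u)) s r" if "r \<in> {s..t}" for r
  proof -
    have "apply_bcontfun \<phi> r = h (apply_bcontfun \<phi>) r"
      using Tap[of \<phi> r] cid[of r] that by (simp add: \<phi>)
    then show ?thesis using E0[of r] by (simp add: y_def h_def)
  qed
  moreover have "continuous_on {s..t} y"
    unfolding y_def by (intro continuous_intros cE continuous_on_subset[OF continuous_on_apply_bcontfun]) auto
  ultimately show ?thesis unfolding solves_on_def by blast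
qed

lemma solves_on_cong:
  fixes V :: "'d::finite \<Rightarrow> real ^ 'e::finite \<Rightarrow> real ^ 'e" and x :: "real \<Rightarrow> real ^ 'd"
  assumes V: "\<And>i. C-lipschitz_on UNIV (V i)" and x: "L-lipschitz_on {s..t} x"
    and y: "solves_on V s t z x y" and y': "\<And>r. s \<le> r \<Longrightarrow> r \<le> t \<Longrightarrow> y' r = y r"
  shows "solves_on V s t z x y'"
  unfolding solves_on_def
proof (intro conjI ballI)
  note cy = solves_onD(1)[OF y]
  show "continuous_on {s..t} y'" using continuous_on_cong[of "{s..t}" "{s..t}" y' y] y' cy by auto
  fix r assume r: "r \<in> {s..t}"
  have "stieltjes_integral s r (\<lambda>u. V i (y' u)) (\<lambda>u. x u $ i) = stieltjes_integral s r (\<lambda>u. V i (y u)) (\<lambda>u. x u $ i)" for i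
    using r y' by (intro stieltjes_integral_cong[where L = L] lipschitz_on_component lipschitz_on_subset[OF x]
        continuous_on_lipschitz_compose[OF V] continuous_on_subset[OF cy]) auto
  then show "y' r = z + driven_integral x (\<lambda>i u. V i (y' u)) s r"
    using solves_onD(2)[OF y] y' r by simp
qed

lemma solves_on_ode_sol:
  fixes V :: "'d::finite \<Rightarrow> real ^ 'e::finite \<Rightarrow> real ^ 'e" and x :: "real \<Rightarrow> real ^ 'd"
  assumes V: "\<And>i. C-lipschitz_on UNIV (V i)" and C: "C > 0"
    and x: "L-lipschitz_on {s..t} x" and st: "s \<le> t"
  shows "solves_on V s t z x (ode_sol V s t z x)"
proof -
  obtain y0 where y0: "solves_on V s t z x y0" using solves_on_exists[where V = V, OF V C x st] by blast
  define y where "y = restrict y0 {s..t}"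
  have y: "solves_on V s t z x y"
    by (rule solves_on_cong[OF V x y0]) (simp add: y_def)
  have "\<exists>!y. y \<in> extensional {s..t} \<and> solves_on V s t z x y"
  proof (rule ex1I[of _ y])
    show "y \<in> extensional {s..t} \<and> solves_on V s t z x y" using y by (simp add: y_def)
    fix y' assume y': "y' \<in> extensional {s..t} \<and> solves_on V s t z x y'"
    show "y' = y"
    proof (rule extensionalityI[of _ "{s..t}"])
      fix r assume "r \<in> {s..t}"
      then show "y' r = y r"
        using solves_on_stability(1)[where V = V and y = y' and y' = y and z = z and z' = z and r = r,
            OF V C x length_control_lipschitz[OF x] _ y] y' by auto
    qed (use y' in \<open>auto simp: y_def\<close>)
  qed
  from theI'[OF this] show ?thesis unfolding ode_sol_def by (rule conjunct2)
qed

lemma solves_on_subinterval: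
  fixes V :: "'d::finite \<Rightarrow> real ^ 'e::finite \<Rightarrow> real ^ 'e" and x :: "real \<Rightarrow> real ^ 'd"
  assumes V: "\<And>i. C-lipschitz_on UNIV (V i)" and x: "L-lipschitz_on {s..t} x"
    and y: "solves_on V s t z x y" and ab: "s \<le> a" "a \<le> b" "b \<le> t"
  shows "solves_on V a b (y a) x y"
  unfolding solves_on_def
proof (intro conjI ballI)
  note cy = solves_onD(1)[OF y]
  show "continuous_on {a..b} y" using cy ab by (auto elim: continuous_on_subset)
  fix r assume r: "r \<in> {a..b}"
  have "stieltjes_integral s r (\<lambda>u. V i (y u)) (\<lambda>u. x u $ i)
      = stieltjes_integral s a (\<lambda>u. V i (y u)) (\<lambda>u. x u $ i) + stieltjes_integral a r (\<lambda>u. V i (y u)) (\<lambda>u. x u $ i)" for i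
    using r ab by (intro stieltjes_integral_combine[where L = L] lipschitz_on_component lipschitz_on_subset[OF x]
        continuous_on_lipschitz_compose[OF V] continuous_on_subset[OF cy]) auto
  then show "y r = y a + driven_integral x (\<lambda>i u. V i (y u)) a r"
    using solves_onD(2)[OF y, of r] solves_onD(2)[OF y, of a] r ab by (simp add: sum.distrib)
qed

lemma solves_on_increment_bound:
  fixes V :: "'d::finite \<Rightarrow> real ^ 'e::finite \<Rightarrow> real ^ 'e" and x :: "real \<Rightarrow> real ^ 'd"
  assumes V: "\<And>i. C-lipschitz_on UNIV (V i)" and B: "\<And>i z. norm (V i z) \<le> B"
    and x: "L-lipschitz_on {s..t} x" and v: "length_control s t x v"
    and y: "solves_on V s t z x y" and ab: "s \<le> a" "a \<le> b" "b \<le> t"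
  shows "norm (y b - y a) \<le> real CARD('d) * (B * (v b - v a))"
proof -
  have y2: "solves_on V a b (y a) x y" by (rule solves_on_subinterval[OF V x y ab])
  have "norm (driven_integral x (\<lambda>i u. V i (y u)) a b) \<le> real CARD('d) * (B * (v b - v a))"
    using ab B by (intro driven_integral_bound[where L = L] continuous_on_lipschitz_compose[OF V] solves_onD(1)[OF y2]
        lipschitz_on_subset[OF x] length_control_subinterval[OF v]) auto
  then show ?thesis using solves_onD(2)[OF y2, of b] ab by simp
qed


section \<open>Iterated integrals and Chen's identity\<close>

text \<open>Iterated integrals with a function \<open>f\<close> in the innermost place, the head of the word being integrated
at the largest time. They are the remainders of the iterated expansion of a solution; \<open>f = 1\<close> gives
the components of the signature.\<close>
primrec iterated_integral_of ::
  "(real \<Rightarrow> real ^ 'd) \<Rightarrow> real \<Rightarrow> (real \<Rightarrow> 'a::real_normed_vector) \<Rightarrow> 'd list \<Rightarrow> real \<Rightarrow> 'a" where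
  "iterated_integral_of x s f [] = f"
| "iterated_integral_of x s f (i # w) =
     (\<lambda>t. stieltjes_integral s t (iterated_integral_of x s f w) (\<lambda>u. x u $ i))"

lemma iterated_integral_rev_eq: "iterated_integral_rev x s w = iterated_integral_of x s (\<lambda>_. 1) w"
  by (induction w) auto

lemma iterated_integral_of_snoc:
  "iterated_integral_of x s f (w @ [j]) =
   iterated_integral_of x s (\<lambda>r. stieltjes_integral s r f (\<lambda>u. x u $ j)) w"
  by (induction w) auto

lemma continuous_on_iterated_integral_of:
  fixes f :: "real \<Rightarrow> 'a::euclidean_space" and x :: "real \<Rightarrow> real ^ 'd::finite"
  assumes "L-lipschitz_on {s..t} x" and "continuous_on {s..t} f"
  shows "continuous_on {s..t} (iterated_integral_of x s f w)"
  using assms(2)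
  by (induction w) (auto intro!: continuous_on_stieltjes_integral lipschitz_on_component[OF assms(1)])

lemma iterated_integral_of_bound:
  fixes f :: "real \<Rightarrow> 'a::euclidean_space" and x :: "real \<Rightarrow> real ^ 'd::finite"
  assumes x: "L-lipschitz_on {s..t} x" and f: "continuous_on {s..t} f"
    and v: "length_control s t x v" and l: "v t - v s \<le> l"
    and B: "\<And>u. s \<le> u \<Longrightarrow> u \<le> t \<Longrightarrow> norm (f u) \<le> B"
    and r: "s \<le> r" "r \<le> t"
  shows "norm (iterated_integral_of x s f w r) \<le> B * l ^ length w"
  using r
proof (induction w arbitrary: r)
  case Nil
  then show ?case using B by simp
next
  case (Cons i w)
  have vr: "v r - v s \<le> l" "v s \<le> v r"
    using length_control_mono[OF v, of r t] length_control_mono[OF v, of s r] l Cons.prems by auto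
  have B0: "0 \<le> B * l ^ length w"
    using order_trans[OF norm_ge_zero Cons.IH[OF Cons.prems]] .
  have "norm (iterated_integral_of x s f (i # w) r) \<le> B * l ^ length w * (v r - v s)"
    unfolding iterated_integral_of.simps
  proof (rule stieltjes_integral_bound[where L = L])
    show "continuous_on {s..r} (iterated_integral_of x s f w)"
      using continuous_on_subset[OF continuous_on_iterated_integral_of[OF x f]] Cons.prems by auto
  qed (use Cons x v in \<open>auto intro: lipschitz_on_subset length_control_subinterval\<close>)
  also have "\<dots> \<le> B * l ^ length w * l" using vr B0 by (intro mult_left_mono) auto
  finally show ?case by (simp add: mult_ac)
qed

lemma iterated_integral_of_const:
  fixes c :: "'a::euclidean_space" and x :: "real \<Rightarrow> real ^ 'd::finite"
  assumes x: "L-lipschitz_on {s..t} x" and r: "s \<le> r" "r \<le> t"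
  shows "iterated_integral_of x s (\<lambda>_. c) w r = iterated_integral_rev x s w r *\<^sub>R c"
  using r
proof (induction w arbitrary: r)
  case (Cons i w)
  have c: "continuous_on {s..r} (iterated_integral_rev x s w)"
    unfolding iterated_integral_rev_eq
    using continuous_on_subset[OF continuous_on_iterated_integral_of[OF x, of "\<lambda>_. 1 :: real"]] Cons.prems by auto
  have xr: "L-lipschitz_on {s..r} (\<lambda>u. x u $ i)"
    using Cons.prems lipschitz_on_component[OF lipschitz_on_subset[OF x]] by auto
  have "stieltjes_integral s r (iterated_integral_of x s (\<lambda>_. c) w) (\<lambda>u. x u $ i)
      = stieltjes_integral s r (\<lambda>u. iterated_integral_rev x s w u *\<^sub>R c) (\<lambda>u. x u $ i)"
    using Cons c by (intro stieltjes_integral_cong[OF _ xr] continuous_intros) auto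
  also have "\<dots> = stieltjes_integral s r (iterated_integral_rev x s w) (\<lambda>u. x u $ i) *\<^sub>R c"
    using Cons.prems by (intro stieltjes_integral_bounded_linear[OF c xr] bounded_linear_intros)
  finally show ?case by simp
qed simp

lemma iterated_integral_of_add:
  fixes f f' :: "real \<Rightarrow> 'a::euclidean_space" and x :: "real \<Rightarrow> real ^ 'd::finite"
  assumes x: "L-lipschitz_on {s..t} x" and f: "continuous_on {s..t} f" "continuous_on {s..t} f'"
    and h: "\<And>u. s \<le> u \<Longrightarrow> u \<le> t \<Longrightarrow> h u = f u + f' u"
    and r: "s \<le> r" "r \<le> t"
  shows "iterated_integral_of x s h w r = iterated_integral_of x s f w r + iterated_integral_of x s f' w r"
  using r
proof (induction w arbitrary: r)
  case (Cons i w)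
  have c: "continuous_on {s..r} (iterated_integral_of x s f w)" "continuous_on {s..r} (iterated_integral_of x s f' w)"
    using continuous_on_subset[OF continuous_on_iterated_integral_of[OF x f(1)]]
      continuous_on_subset[OF continuous_on_iterated_integral_of[OF x f(2)]] Cons.prems by auto
  have xr: "L-lipschitz_on {s..r} (\<lambda>u. x u $ i)"
    using Cons.prems lipschitz_on_component[OF lipschitz_on_subset[OF x]] by auto
  have "stieltjes_integral s r (iterated_integral_of x s h w) (\<lambda>u. x u $ i)
      = stieltjes_integral s r (\<lambda>u. iterated_integral_of x s f w u + iterated_integral_of x s f' w u) (\<lambda>u. x u $ i)"
    using Cons c by (intro stieltjes_integral_cong[OF _ xr] continuous_intros) auto
  also have "\<dots> = stieltjes_integral s r (iterated_integral_of x s f w) (\<lambda>u. x u $ i)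
      + stieltjes_integral s r (iterated_integral_of x s f' w) (\<lambda>u. x u $ i)"
    using Cons.prems by (intro stieltjes_integral_add[OF c xr])
  finally show ?case by simp
qed (use h in simp)

lemma iterated_integral_of_sum:
  fixes f :: "'i \<Rightarrow> real \<Rightarrow> 'a::euclidean_space" and x :: "real \<Rightarrow> real ^ 'd::finite"
  assumes x: "L-lipschitz_on {s..t} x" and A: "finite A" and f: "\<And>j. j \<in> A \<Longrightarrow> continuous_on {s..t} (f j)"
    and r: "s \<le> r" "r \<le> t"
  shows "iterated_integral_of x s (\<lambda>u. \<Sum>j\<in>A. f j u) w r = (\<Sum>j\<in>A. iterated_integral_of x s (f j) w r)"
  using A f
proof (induction A rule: finite_induct)
  case empty
  show ?case using iterated_integral_of_const[OF x r, of 0 w] by simp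
next
  case (insert j A)
  have "iterated_integral_of x s (\<lambda>u. \<Sum>j\<in>insert j A. f j u) w r
      = iterated_integral_of x s (f j) w r + iterated_integral_of x s (\<lambda>u. \<Sum>j\<in>A. f j u) w r"
    using insert by (intro iterated_integral_of_add[OF x _ _ _ r] continuous_on_sum) auto
  then show ?case using insert by simp
qed

text \<open>Chen's identity. The outermost integral over \<open>[s, r]\<close> splits at \<open>t\<close>; on \<open>[t, r]\<close> the identity for the
shorter word applies under the integral, with the factors over \<open>[s, t]\<close> constant.\<close>
lemma iterated_integral_rev_chen:
  fixes x :: "real \<Rightarrow> real ^ 'd::finite"
  assumes x: "L-lipschitz_on {s..u} x" and st: "s \<le> t" and r: "t \<le> r" "r \<le> u"
  shows "iterated_integral_rev x s w r =
    (\<Sum>k\<le>length w. iterated_integral_rev x t (take k w) r * iterated_integral_rev x s (drop k w) t)"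
  using r
proof (induction w arbitrary: r)
  case (Cons i w)
  have cs: "continuous_on {s..u} (iterated_integral_rev x s w)" for w
    unfolding iterated_integral_rev_eq by (intro continuous_on_iterated_integral_of[OF x] continuous_intros)
  have xt: "L-lipschitz_on {t..u} x" using st by (auto intro: lipschitz_on_subset[OF x])
  have ct: "continuous_on {t..r} (iterated_integral_rev x t w)" for w
    unfolding iterated_integral_rev_eq
    using continuous_on_subset[OF continuous_on_iterated_integral_of[OF xt, of "\<lambda>_. 1 :: real"]] Cons.prems by auto
  have xi: "L-lipschitz_on S (\<lambda>u. x u $ i)" if "S \<subseteq> {s..u}" for S
    using lipschitz_on_component[OF lipschitz_on_subset[OF x that]] .
  let ?I = "\<lambda>a b f. stieltjes_integral a b f (\<lambda>u. x u $ i)"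
  have "?I s r (iterated_integral_rev x s w)
      = ?I s t (iterated_integral_rev x s w) + ?I t r (iterated_integral_rev x s w)"
    using Cons.prems st
    by (intro stieltjes_integral_combine[where L = L] xi continuous_on_subset[OF cs]) auto
  also have "?I t r (iterated_integral_rev x s w) =
      ?I t r (\<lambda>v. \<Sum>k\<le>length w. iterated_integral_rev x t (take k w) v * iterated_integral_rev x s (drop k w) t)"
    using Cons st by (intro stieltjes_integral_cong[where L = L] xi continuous_intros ct) auto
  also have "\<dots> = (\<Sum>k\<le>length w. ?I t r (\<lambda>v. iterated_integral_rev x t (take k w) v * iterated_integral_rev x s (drop k w) t))"
    using Cons.prems st by (intro stieltjes_integral_sum[where L = L] xi continuous_intros ct) auto
  also have "\<dots> = (\<Sum>k\<le>length w. ?I t r (iterated_integral_rev x t (take k w)) * iterated_integral_rev x s (drop k w) t)"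
    using Cons.prems st
    by (intro sum.cong refl stieltjes_integral_bounded_linear[where L = L] xi ct bounded_linear_mult_left) auto
  finally show ?case
    by (simp add: sum.atMost_Suc_shift del: sum.atMost_Suc)
qed simp

lemma signature_eq_iff:
  "signature N x s t = signature N x' s' t' \<longleftrightarrow>
    (\<forall>w. length w \<le> N \<longrightarrow> iterated_integral_rev x s w t = iterated_integral_rev x' s' w t')"
proof -
  have "signature N x s t = signature N x' s' t' \<longleftrightarrow>
    (\<forall>w. length w \<le> N \<longrightarrow> iterated_integral_rev x s (rev w) t = iterated_integral_rev x' s' (rev w) t')"
    unfolding signature_def fun_eq_iff iterated_integral_def by auto
  also have "\<dots> \<longleftrightarrow> (\<forall>w. length w \<le> N \<longrightarrow> iterated_integral_rev x s w t = iterated_integral_rev x' s' w t')"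
    by (metis length_rev rev_rev_ident)
  finally show ?thesis .
qed

text \<open>By Chen's identity the signature over the union of two adjacent intervals is a function of the
signatures over the two pieces.\<close>
lemma signature_eq_concat:
  fixes x x' :: "real \<Rightarrow> real ^ 'd::finite"
  assumes x: "L-lipschitz_on {s..u} x" and t: "s \<le> t" "t \<le> u"
    and x': "L'-lipschitz_on {s'..u'} x'" and t': "s' \<le> t'" "t' \<le> u'"
    and e1: "signature N x s t = signature N x' s' t'" and e2: "signature N x t u = signature N x' t' u'"
  shows "signature N x s u = signature N x' s' u'"
  unfolding signature_eq_iff
proof (intro allI impI)
  fix w :: "'d list" assume w: "length w \<le> N"
  show "iterated_integral_rev x s w u = iterated_integral_rev x' s' w u'"
    unfolding iterated_integral_rev_chen[OF x t order_refl] iterated_integral_rev_chen[OF x' t' order_refl]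
    using e1 e2 w unfolding signature_eq_iff by (intro sum.cong) auto
qed


section \<open>Concatenation, length and short paths with a given signature\<close>

lemma stieltjes_primitive_shift:
  assumes "stieltjes_primitive s t f g F"
  shows "stieltjes_primitive (s + h) (t + h) (\<lambda>u. f (u - h)) (\<lambda>u. g (u - h)) (\<lambda>u. F (u - h))"
  unfolding stieltjes_primitive_def
proof (intro allI impI)
  fix \<epsilon> :: real assume "\<epsilon> > 0"
  with assms obtain \<delta> where "\<delta> > 0" and D: "\<And>a u b. s \<le> a \<Longrightarrow> a \<le> u \<Longrightarrow> u \<le> b \<Longrightarrow> b \<le> t \<Longrightarrow> b - a < \<delta> \<Longrightarrow>
        norm (F b - F a - (g b - g a) *\<^sub>R f u) \<le> \<epsilon> * (b - a)"
    using stieltjes_primitiveD by blast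
  moreover have "norm (F (b - h) - F (a - h) - (g (b - h) - g (a - h)) *\<^sub>R f (u - h)) \<le> \<epsilon> * (b - a)"
    if "s + h \<le> a \<and> a \<le> u \<and> u \<le> b \<and> b \<le> t + h \<and> b - a < \<delta>" for a u b
    using D[of "a - h" "u - h" "b - h"] that by simp
  ultimately show "\<exists>\<delta>>0. \<forall>a u b. s + h \<le> a \<and> a \<le> u \<and> u \<le> b \<and> b \<le> t + h \<and> b - a < \<delta> \<longrightarrow>
      norm (F (b - h) - F (a - h) - (g (b - h) - g (a - h)) *\<^sub>R f (u - h)) \<le> \<epsilon> * (b - a)"
    by blast
qed

lemma iterated_integral_rev_shift:
  fixes x x' :: "real \<Rightarrow> real ^ 'd::finite"
  assumes x: "L-lipschitz_on {s..t} x"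
    and xx: "\<And>a b. s \<le> a \<Longrightarrow> a \<le> b \<Longrightarrow> b \<le> t \<Longrightarrow> x' (b + h) - x' (a + h) = x b - x a"
    and r: "s \<le> r" "r \<le> t"
  shows "iterated_integral_rev x' (s + h) w (r + h) = iterated_integral_rev x s w r"
  using r
proof (induction w arbitrary: r)
  case (Cons i w)
  have c: "continuous_on {s..t} (iterated_integral_rev x s w)"
    unfolding iterated_integral_rev_eq by (intro continuous_on_iterated_integral_of[OF x] continuous_intros)
  obtain F where F: "stieltjes_primitive s t (iterated_integral_rev x s w) (\<lambda>u. x u $ i) F"
    using stieltjes_primitive_exists[OF c lipschitz_on_component[OF x]] by blast
  have F': "stieltjes_primitive (s + h) (t + h) (iterated_integral_rev x' (s + h) w) (\<lambda>u. x' u $ i) (\<lambda>u. F (u - h))"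
  proof (rule stieltjes_primitive_cong[OF stieltjes_primitive_shift[OF F]])
    show "iterated_integral_rev x' (s + h) w u = iterated_integral_rev x s w (u - h)"
      if "s + h \<le> u" "u \<le> t + h" for u
      using Cons.IH[of "u - h"] that by simp
    show "x' b $ i - x' a $ i = x (b - h) $ i - x (a - h) $ i"
      if "s + h \<le> a" "a \<le> b" "b \<le> t + h" for a b
      using xx[of "a - h" "b - h"] that by (metis add_le_imp_le_right diff_add_cancel vector_minus_component)
  qed auto
  show ?case
    using Cons.prems stieltjes_integral_primitive[OF F, of s r] stieltjes_integral_primitive[OF F', of "s + h" "r + h"]
    by simp
qed simp

text \<open>The second path is run on \<open>[1, 2]\<close> after a translation in time and space, under which signatures
are invariant. Placing the pieces on \<open>[0, 1]\<close> and \<open>[1, 2]\<close> avoids reparametrisation.\<close>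
lemma concatenation_exists:
  fixes \<gamma>1 \<gamma>2 :: "real \<Rightarrow> real ^ 'd::finite"
  assumes g1: "L1-lipschitz_on {0..1} \<gamma>1" and g2: "L2-lipschitz_on {0..1} \<gamma>2"
    and v1: "length_control 0 1 \<gamma>1 v1" and v2: "length_control 0 1 \<gamma>2 v2"
  obtains z L v where "L-lipschitz_on {0..2} z" and "length_control 0 2 z v"
    and "v 1 - v 0 = v1 1 - v1 0" and "v 2 - v 1 = v2 1 - v2 0"
    and "signature N z 0 1 = signature N \<gamma>1 0 1" and "signature N z 1 2 = signature N \<gamma>2 0 1"
proof -
  define z where "z = (\<lambda>r. if r \<le> 1 then \<gamma>1 r else \<gamma>1 1 + \<gamma>2 (r - 1) - \<gamma>2 0)"
  define v where "v = (\<lambda>r. if r \<le> 1 then v1 r else v1 1 + v2 (r - 1) - v2 0)"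
  define L where "L = max L1 L2"
  have z1: "z r = \<gamma>1 r" if "r \<le> 1" for r using that by (simp add: z_def)
  have z2: "z r = \<gamma>1 1 + \<gamma>2 (r - 1) - \<gamma>2 0" if "1 \<le> r" for r
    using that by (cases "r = 1") (auto simp: z_def)
  have w1: "v r = v1 r" if "r \<le> 1" for r using that by (simp add: v_def)
  have w2: "v r = v1 1 + v2 (r - 1) - v2 0" if "1 \<le> r" for r
    using that by (cases "r = 1") (auto simp: v_def)
  have h2: "L2-lipschitz_on {1..2} (\<lambda>r. \<gamma>1 1 + \<gamma>2 (r - 1) - \<gamma>2 0)"
  proof (rule lipschitz_onI)
    show "0 \<le> L2" using g2 lipschitz_on_nonneg by blast
    fix a b :: real assume "a \<in> {1..2}" "b \<in> {1..2}"
    then show "dist (\<gamma>1 1 + \<gamma>2 (a - 1) - \<gamma>2 0) (\<gamma>1 1 + \<gamma>2 (b - 1) - \<gamma>2 0) \<le> L2 * dist a b"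
      using lipschitz_onD[OF g2, of "a - 1" "b - 1"] by (simp add: dist_norm)
  qed
  have zL: "L-lipschitz_on {0..2} z" unfolding z_def
    by (rule lipschitz_on_concat[OF lipschitz_on_le[OF g1] lipschitz_on_le[OF h2]]) (auto simp: L_def)
  have zv1: "length_control 0 1 z v"
    using v1 unfolding length_control_def by (auto simp: z1 w1)
  have zv2: "length_control 1 2 z v"
    unfolding length_control_def
  proof (intro allI impI)
    fix a b :: real assume ab: "1 \<le> a \<and> a \<le> b \<and> b \<le> 2"
    then show "norm (z b - z a) \<le> v b - v a"
      using length_controlD[OF v2, of "a - 1" "b - 1"] z2[of a] z2[of b] w2[of a] w2[of b] by simp
  qed
  have "length_control 0 2 z v" unfolding length_control_def
  proof (intro allI impI)
    fix a b :: real assume ab: "0 \<le> a \<and> a \<le> b \<and> b \<le> 2"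
    consider "b \<le> 1" | "1 \<le> a" | "a \<le> 1" "1 \<le> b" by linarith
    then show "norm (z b - z a) \<le> v b - v a"
    proof cases
      case 3
      have "norm (z b - z a) \<le> norm (z b - z 1) + norm (z 1 - z a)"
        using norm_triangle_ineq[of "z b - z 1" "z 1 - z a"] by simp
      also have "\<dots> \<le> (v b - v 1) + (v 1 - v a)"
        using 3 ab by (intro add_mono length_controlD[OF zv1] length_controlD[OF zv2]) auto
      finally show ?thesis by simp
    qed (use ab in \<open>auto intro: length_controlD[OF zv1] length_controlD[OF zv2]\<close>)
  qed
  moreover have "iterated_integral_rev z (0 + 0) w (1 + 0) = iterated_integral_rev \<gamma>1 0 w 1" for w
    by (rule iterated_integral_rev_shift[OF g1]) (auto simp: z1)
  moreover have "iterated_integral_rev z (0 + 1) w (1 + 1) = iterated_integral_rev \<gamma>2 0 w 1" for w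
    by (rule iterated_integral_rev_shift[OF g2]) (auto simp: z2)
  ultimately show ?thesis
    using that[OF zL, of v] by (simp add: signature_eq_iff w1 w2)
qed

text \<open>A division of \<open>[s, a]\<close> together with the interval \<open>[a, b]\<close> is a division of \<open>[s, b]\<close>.\<close>
lemma path_len_superadditive:
  assumes "s \<le> a" and "a \<le> b"
  shows "path_len s a x + ereal (norm (x b - x a)) \<le> path_len s b x"
proof -
  have "path_len s a x \<le> path_len s b x - ereal (norm (x b - x a))"
    unfolding path_len_def[of s a]
  proof (rule SUP_least)
    fix D assume "D \<in> {D. D division_of {s..a}}"
    then have D: "D division_of {s..a}" by simp
    have "ereal (\<Sum>k\<in>D. norm (x (Sup k) - x (Inf k))) + ereal (norm (x b - x a)) \<le> path_len s b x"
    proof (cases "a = b")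
      case True
      then show ?thesis unfolding path_len_def using D by (auto intro: SUP_upper)
    next
      case False
      then have ab: "a < b" using assms by simp
      have ab1: "{{a..b}} division_of {a..b}" using ab by (intro division_ofI) auto
      have "interior {s..a} \<inter> interior {a..b} = {}" by (simp add: interior_atLeastAtMost_real)
      from division_disjoint_union[OF D ab1 this]
      have D': "insert {a..b} D division_of {s..b}"
        using assms by (simp add: ivl_disj_un_two_touch)
      have "{a..b} \<notin> D"
        using division_ofD(2)[OF D, of "{a..b}"] ab by auto
      then have "(\<Sum>k\<in>insert {a..b} D. norm (x (Sup k) - x (Inf k)))
          = (\<Sum>k\<in>D. norm (x (Sup k) - x (Inf k))) + norm (x b - x a)"
        using division_ofD(1)[OF D] ab by simp
      moreover have "ereal (\<Sum>k\<in>insert {a..b} D. norm (x (Sup k) - x (Inf k))) \<le> path_len s b x"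
        unfolding path_len_def using D' by (intro SUP_upper) simp
      ultimately show ?thesis by simp
    qed
    then show "ereal (\<Sum>k\<in>D. norm (x (Sup k) - x (Inf k))) \<le> path_len s b x - ereal (norm (x b - x a))"
      by (simp add: ereal_le_minus)
  qed
  then show ?thesis by (simp add: ereal_le_minus)
qed

text \<open>The control is the arc length \<open>r \<mapsto> path_len s r x\<close>. By superadditivity it dominates the increments
of \<open>x\<close>, and it is finite on \<open>[s, t]\<close> because it increases to \<open>path_len s t x\<close>.\<close>
lemma path_len_imp_length_control:
  assumes "path_len s t x \<le> ereal l" and "s \<le> t"
  obtains v where "length_control s t x v" and "v t - v s \<le> l"
proof -
  have pos: "0 \<le> path_len s r x" if "s \<le> r" for r
  proof -
    have "ereal (\<Sum>k\<in>{{s..r}}. norm (x (Sup k) - x (Inf k))) \<le> path_len s r x"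
      unfolding path_len_def using that by (intro SUP_upper) (auto intro!: division_ofI)
    then show ?thesis by (rule order_trans[rotated]) simp
  qed
  have mono: "path_len s r x \<le> ereal l" if "s \<le> r" "r \<le> t" for r
  proof -
    have "path_len s r x \<le> path_len s r x + ereal (norm (x t - x r))"
      by (cases "path_len s r x") auto
    then show ?thesis using path_len_superadditive[OF that, of x] assms(1) by order
  qed
  define v where "v = (\<lambda>r. real_of_ereal (path_len s r x))"
  have v: "path_len s r x = ereal (v r)" if "s \<le> r" "r \<le> t" for r
    using pos[OF that(1)] mono[OF that] unfolding v_def by (cases "path_len s r x") auto
  have "length_control s t x v"
    unfolding length_control_def
  proof (intro allI impI)
    fix a b assume ab: "s \<le> a \<and> a \<le> b \<and> b \<le> t"
    then show "norm (x b - x a) \<le> v b - v a"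
      using path_len_superadditive[of s a b x] v[of a] v[of b] by simp
  qed
  moreover have "v t - v s \<le> l"
    using v[of t] v[of s] pos[of s] assms by simp
  ultimately show ?thesis using that by blast
qed

text \<open>The factor \<open>2\<close> puts the Carnot-Caratheodory norm strictly below the stated bound; being an infimum
over paths, it then yields a path below that bound.\<close>
lemma holder_norm_near_geodesic:
  fixes x :: "real \<Rightarrow> real ^ 'd::finite"
  assumes h: "holder_norm N p (signature N x) \<le> ereal M" and M: "M > 0"
    and st: "0 \<le> s" "s < t" "t \<le> 1"
  obtains \<gamma> :: "real \<Rightarrow> real ^ 'd" and L v where "L-lipschitz_on {0..1} \<gamma>"
    and "signature N \<gamma> 0 1 = signature N x s t"
    and "length_control 0 1 \<gamma> v" and "v 1 - v 0 \<le> 2 * M * (t - s) powr (1 / p)"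
proof -
  define \<tau> where "\<tau> = (t - s) powr (1 / p)"
  have tau: "\<tau> > 0" using st by (simp add: \<tau>_def)
  have "cc_norm N (signature N x s t) / ereal \<tau> \<le> holder_norm N p (signature N x)"
    unfolding holder_norm_def \<tau>_def using st by (intro SUP_upper2[of "(s, t)"]) auto
  also note h
  finally have "cc_norm N (signature N x s t) \<le> ereal \<tau> * ereal M"
    using tau by (simp add: ereal_divide_le_pos)
  also have "\<dots> < ereal (2 * M * \<tau>)" using tau M by simp
  finally have "cc_norm N (signature N x s t) < ereal (2 * M * \<tau>)" .
  then obtain \<gamma> :: "real \<Rightarrow> real ^ 'd" where g: "lipschitz_path 0 1 \<gamma>" "signature N \<gamma> 0 1 = signature N x s t"
    "path_len 0 1 \<gamma> < ereal (2 * M * \<tau>)"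
    unfolding cc_norm_def Inf_less_iff by blast
  obtain L where L: "L-lipschitz_on {0..1} \<gamma>" using g(1) unfolding lipschitz_path_def by blast
  obtain v where "length_control 0 1 \<gamma> v" "v 1 - v 0 \<le> 2 * M * \<tau>"
    using path_len_imp_length_control[OF less_imp_le[OF g(3)] zero_le_one] by blast
  then show ?thesis using that[OF L g(2)] by (simp add: \<tau>_def)
qed


section \<open>Regularity of iterated vector fields\<close>

lemma bounded_derivs_imp_bounded: "bounded_derivs n f \<Longrightarrow> bounded (range f)"
  by (cases n) auto

lemma bounded_derivs_Suc_imp: "bounded_derivs (Suc n) f \<Longrightarrow> bounded_derivs n f"
  by (induction n arbitrary: f) auto

lemma bounded_derivs_mono: "bounded_derivs n f \<Longrightarrow> m \<le> n \<Longrightarrow> bounded_derivs m f"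
proof (induction n)
  case (Suc n)
  then show ?case using bounded_derivs_Suc_imp[of n f] by (cases "m = Suc n") auto
qed auto

lemma bounded_derivs_add:
  assumes "bounded_derivs n f" and "bounded_derivs n g"
  shows "bounded_derivs n (\<lambda>z. f z + g z)"
  using assms
proof (induction n arbitrary: f g)
  case 0
  then show ?case by (simp add: bounded_plus_comp)
next
  case (Suc n)
  have "((\<lambda>z. f z + g z) has_derivative
      (\<lambda>v. frechet_derivative f (at z) v + frechet_derivative g (at z) v)) (at z)" for z
    using Suc.prems by (intro has_derivative_add) (auto simp: frechet_derivative_works)
  then have "frechet_derivative (\<lambda>z. f z + g z) (at z) =
      (\<lambda>v. frechet_derivative f (at z) v + frechet_derivative g (at z) v)" for z
    by (intro frechet_derivative_at[symmetric])
  then show ?case using Suc by (simp add: bounded_plus_comp)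
qed

lemma bounded_derivs_zero: "bounded_derivs n (\<lambda>z. 0)"
  by (induction n) (auto simp: frechet_derivative_const)

lemma bounded_derivs_sum:
  "finite A \<Longrightarrow> (\<And>j. j \<in> A \<Longrightarrow> bounded_derivs n (f j)) \<Longrightarrow> bounded_derivs n (\<lambda>z. \<Sum>j\<in>A. f j z)"
  by (induction A rule: finite_induct) (auto simp: bounded_derivs_zero bounded_derivs_add)

text \<open>The product rule: differentiating costs one derivative of each factor, so the class is closed under
multiplication by induction on the order.\<close>
lemma bounded_derivs_component_scaleR:
  fixes g :: "'a::euclidean_space \<Rightarrow> real ^ 'e::finite"
  assumes "bounded_derivs n g" and "bounded_derivs n f"
  shows "bounded_derivs n (\<lambda>z. (g z $ j) *\<^sub>R f z)"
  using assms
proof (induction n arbitrary: f g)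
  case 0
  obtain B1 where B1: "\<And>z. norm (g z) \<le> B1" using 0 by (auto simp: bounded_iff)
  obtain B2 where B2: "\<And>z. norm (f z) \<le> B2" using 0 by (auto simp: bounded_iff)
  have "norm ((g z $ j) *\<^sub>R f z) \<le> B1 * B2" for z
    using B1[of z] B2[of z] component_le_norm_cart[of "g z" j]
    unfolding norm_scaleR by (intro mult_mono) (auto intro: order_trans[OF norm_ge_zero])
  then show ?case by (auto simp: bounded_iff simp del: norm_scaleR)
next
  case (Suc n)
  have bd: "bounded (range (\<lambda>z. (g z $ j) *\<^sub>R f z))"
    using bounded_derivs_imp_bounded[OF Suc.IH[OF Suc.prems[THEN bounded_derivs_Suc_imp]]] .
  have der: "((\<lambda>z. (g z $ j) *\<^sub>R f z) has_derivative
      (\<lambda>v. (g z $ j) *\<^sub>R frechet_derivative f (at z) v + (frechet_derivative g (at z) v $ j) *\<^sub>R f z)) (at z)" for z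
    using Suc.prems
    by (intro has_derivative_scaleR bounded_linear.has_derivative[OF bounded_linear_vec_nth])
      (auto simp: frechet_derivative_works)
  then have eq: "frechet_derivative (\<lambda>z. (g z $ j) *\<^sub>R f z) (at z) =
      (\<lambda>v. (g z $ j) *\<^sub>R frechet_derivative f (at z) v + (frechet_derivative g (at z) v $ j) *\<^sub>R f z)" for z
    by (intro frechet_derivative_at[symmetric])
  have "bounded_derivs n (\<lambda>z. (g z $ j) *\<^sub>R frechet_derivative f (at z) v +
      (frechet_derivative g (at z) v $ j) *\<^sub>R f z)" for v
    using Suc.prems Suc.prems[THEN bounded_derivs_Suc_imp]
    by (intro bounded_derivs_add Suc.IH) auto
  moreover have "(\<lambda>z. (g z $ j) *\<^sub>R f z) differentiable at z" for z
    using der unfolding differentiable_def by blast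
  ultimately show ?case using bd by (simp add: eq)
qed

lemma bounded_derivs_field_op:
  assumes "bounded_derivs n W" and "bounded_derivs (Suc n) f"
  shows "bounded_derivs n (field_op W f)"
  unfolding field_op_def[abs_def] using assms
  by (intro bounded_derivs_sum bounded_derivs_component_scaleR) auto

lemma sum_component_axis:
  fixes v :: "real ^ 'e::finite"
  shows "(\<Sum>j\<in>UNIV. (v $ j) *\<^sub>R axis j 1) = v"
  using basis_expansion[of v] unfolding scalar_mult_eq_scaleR .

text \<open>The class only provides bounds for each fixed direction. The derivative is linear and
the coordinate directions span, so finitely many of these bounds control its operator norm.\<close>
lemma bounded_derivs_imp_lipschitz:
  fixes f :: "real ^ 'e::finite \<Rightarrow> 'b::real_normed_vector"
  assumes "bounded_derivs (Suc n) f"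
  shows "\<exists>C. C-lipschitz_on UNIV f"
proof -
  have "\<exists>B. \<forall>z. norm (frechet_derivative f (at z) (axis j 1)) \<le> B" for j
    using assms bounded_derivs_imp_bounded[of n "\<lambda>z. frechet_derivative f (at z) (axis j 1)"]
    by (auto simp: bounded_iff)
  then obtain B where B: "\<And>j z. norm (frechet_derivative f (at z) (axis j 1)) \<le> B j" by metis
  have B0: "0 \<le> B j" for j using order_trans[OF norm_ge_zero B] .
  define K where "K = (\<Sum>j\<in>UNIV. B j)"
  have "norm (frechet_derivative f (at z) v) \<le> K * norm v" for z v
  proof -
    interpret linear "frechet_derivative f (at z)"
      using assms by (intro linear_frechet_derivative) auto
    have "frechet_derivative f (at z) v = frechet_derivative f (at z) (\<Sum>j\<in>UNIV. (v $ j) *\<^sub>R axis j 1)"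
      by (simp add: sum_component_axis)
    also have "\<dots> = (\<Sum>j\<in>UNIV. (v $ j) *\<^sub>R frechet_derivative f (at z) (axis j 1))"
      by (simp add: sum scaleR)
    also have "norm \<dots> \<le> (\<Sum>j\<in>UNIV. norm v * B j)"
    proof (rule sum_norm_le)
      fix j
      show "norm ((v $ j) *\<^sub>R frechet_derivative f (at z) (axis j 1)) \<le> norm v * B j"
        unfolding norm_scaleR using B[of z j] component_le_norm_cart[of v j] by (intro mult_mono) auto
    qed
    finally show ?thesis by (simp add: K_def sum_distrib_left mult.commute)
  qed
  then have on: "onorm (frechet_derivative f (at z)) \<le> K" for z by (rule onorm_le)
  have "K-lipschitz_on UNIV f"
  proof (rule lipschitz_onI)
    show "0 \<le> K" unfolding K_def using B0 by (intro sum_nonneg) auto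
    fix a b :: "real ^ 'e"
    have "norm (f a - f b) \<le> K * norm (a - b)"
      using assms on by (intro differentiable_bound[of UNIV f "\<lambda>z. frechet_derivative f (at z)"])
        (auto simp: frechet_derivative_works)
    then show "dist (f a) (f b) \<le> K * dist a b" by (simp add: dist_norm)
  qed
  then show ?thesis by blast
qed

lemma field_word_Nil [simp]: "field_word V [] = (\<lambda>z. z)"
  by (simp add: field_word_def)

lemma field_word_Cons: "field_word V (i # w) = field_op (V i) (field_word V w)"
  by (simp add: field_word_def)

lemma field_word_letter:
  fixes V :: "'d \<Rightarrow> real ^ 'e::finite \<Rightarrow> real ^ 'e"
  shows "field_word V [i] = V i"
proof
  fix z
  have "frechet_derivative (\<lambda>z. z) (at z) = (\<lambda>v :: real ^ 'e. v)"
    using frechet_derivative_at[OF has_derivative_ident] by (rule sym)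
  then show "field_word V [i] z = V i z"
    by (simp add: field_word_Cons field_op_def sum_component_axis)
qed

text \<open>Each operator in a word costs one derivative, except for the first one applied to the identity, since
\<open>V\<^sub>i H = V\<^sub>i\<close>. This accounts for the \<open>Suc\<close>: words of length \<open>N\<close> still have one bounded derivative.\<close>
lemma bounded_derivs_field_word:
  assumes V: "\<And>i. bounded_derivs N (V i)" and "w \<noteq> []" and "length w \<le> N"
  shows "bounded_derivs (Suc N - length w) (field_word V w)"
  using assms(2,3)
proof (induction w)
  case (Cons i w)
  show ?case
  proof (cases "w = []")
    case True
    then show ?thesis using V by (simp add: field_word_letter)
  next
    case False
    have eq: "Suc N - length w = Suc (Suc N - length (i # w))" using Cons.prems by auto
    have "bounded_derivs (Suc N - length (i # w)) (V i)"
      using V by (rule bounded_derivs_mono) simp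
    moreover have "bounded_derivs (Suc (Suc N - length (i # w))) (field_word V w)"
      using Cons.IH[OF False] Cons.prems unfolding eq by simp
    ultimately show ?thesis unfolding field_word_Cons by (rule bounded_derivs_field_op)
  qed
qed simp

text \<open>All that is used about the vector fields. For \<open>N = 1\<close> the only words in question are letters, and
their Lipschitz continuity is assumed; for larger \<open>N\<close> it follows from a bounded derivative.\<close>
lemma Lip_fields_regularity:
  fixes V :: "'d::finite \<Rightarrow> real ^ 'e::finite \<Rightarrow> real ^ 'e"
  assumes V: "\<And>i. V i \<in> Lip_fields N" and N: "N \<ge> 1"
  obtains B C where "B > 0" and "C > 0" and "\<And>i z. norm (V i z) \<le> B"
    and "\<And>w. w \<noteq> [] \<Longrightarrow> length w \<le> N \<Longrightarrow> C-lipschitz_on UNIV (field_word V w)"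
    and "\<And>w z. w \<noteq> [] \<Longrightarrow> length w < N \<Longrightarrow> field_word V w differentiable at z"
proof -
  have "bounded (range (V i))" for i
    using V[of i] bounded_derivs_imp_bounded by (auto simp: Lip_fields_def split: if_splits)
  then have "\<exists>b. \<forall>z. norm (V i z) \<le> b" for i by (auto simp: bounded_iff)
  then obtain b where b: "\<And>i z. norm (V i z) \<le> b i" by metis
  define B where "B = 1 + (\<Sum>i\<in>UNIV. b i)"
  have b0: "0 \<le> b i" for i using order_trans[OF norm_ge_zero b] .
  have bB: "norm (V i z) \<le> B" for i z
    using b[of i z] member_le_sum[of i UNIV b] b0 by (simp add: B_def)
  have B: "B > 0" using b0 by (auto simp: B_def intro!: add_pos_nonneg sum_nonneg)
  have "\<exists>C. C-lipschitz_on UNIV (field_word V w)" if w: "w \<noteq> []" "length w \<le> N" for w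
  proof (cases "N = 1")
    case True
    then obtain i where "w = [i]" using w by (cases w) auto
    then show ?thesis using V[of i] True by (simp add: field_word_letter Lip_fields_def)
  next
    case False
    then have "bounded_derivs (Suc N - length w) (field_word V w)"
      using V w by (intro bounded_derivs_field_word) (auto simp: Lip_fields_def)
    moreover have "Suc N - length w = Suc (N - length w)" using w by simp
    ultimately show ?thesis using bounded_derivs_imp_lipschitz by metis
  qed
  then obtain c where c: "\<And>w. w \<noteq> [] \<Longrightarrow> length w \<le> N \<Longrightarrow> (c w)-lipschitz_on UNIV (field_word V w)" by metis
  define S where "S = {w :: 'd list. w \<noteq> [] \<and> length w \<le> N}"
  have fS: "finite S"
    using finite_lists_length_le[of "UNIV :: 'd set" N] by (rule rev_finite_subset) (auto simp: S_def)
  have c0: "0 \<le> c w" if "w \<in> S" for w using c[of w] that lipschitz_on_nonneg unfolding S_def by blast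
  define C where "C = 1 + sum c S"
  have cC: "C-lipschitz_on UNIV (field_word V w)" if w: "w \<noteq> []" "length w \<le> N" for w
  proof (rule lipschitz_on_le[OF c[OF w]])
    show "c w \<le> C" using member_le_sum[of w S c] fS c0 w by (simp add: C_def S_def)
  qed
  have C: "C > 0" using c0 by (auto simp: C_def intro!: add_pos_nonneg sum_nonneg)
  have "field_word V w differentiable at z" if w: "w \<noteq> []" "length w < N" for w z
  proof -
    have "N \<noteq> 1" using w by (cases w) auto
    then have "bounded_derivs (Suc N - length w) (field_word V w)"
      using V w by (intro bounded_derivs_field_word) (auto simp: Lip_fields_def)
    moreover have "Suc N - length w = Suc (N - length w)" using w by simp
    ultimately show ?thesis by simp
  qed
  then show ?thesis using that[OF B C bB cC] by blast
qed


section \<open>The Euler estimate along a path of given length\<close>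

lemma driven_integral_local:
  fixes f :: "'d::finite \<Rightarrow> real \<Rightarrow> 'a::euclidean_space" and x :: "real \<Rightarrow> real ^ 'd"
  assumes f: "\<And>i. continuous_on {s..t} (f i)" and x: "L-lipschitz_on {s..t} x" and e: "\<epsilon> > 0"
  shows "\<exists>\<delta>>0. \<forall>u\<in>{s..t}. \<forall>v\<in>{s..t}. \<bar>v - u\<bar> < \<delta> \<longrightarrow>
    norm (driven_integral x f s v - driven_integral x f s u - (\<Sum>i\<in>UNIV. (x v $ i - x u $ i) *\<^sub>R f i u))
      \<le> \<epsilon> * \<bar>v - u\<bar>"
proof -
  define d where "d = real CARD('d)"
  have d: "d > 0" by (simp add: d_def)
  let ?P = "\<lambda>i r. stieltjes_integral s r (f i) (\<lambda>u. x u $ i)"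
  have "\<exists>\<delta>>0. \<forall>u\<in>{s..t}. \<forall>v\<in>{s..t}. \<bar>v - u\<bar> < \<delta> \<longrightarrow>
      norm (?P i v - ?P i u - (x v $ i - x u $ i) *\<^sub>R f i u) \<le> \<epsilon> / d * \<bar>v - u\<bar>" for i
  proof -
    obtain \<delta> where "\<delta> > 0" and D: "\<And>a u b. s \<le> a \<Longrightarrow> a \<le> u \<Longrightarrow> u \<le> b \<Longrightarrow> b \<le> t \<Longrightarrow> b - a < \<delta> \<Longrightarrow>
        norm (?P i b - ?P i a - (x b $ i - x a $ i) *\<^sub>R f i u) \<le> \<epsilon> / d * (b - a)"
      using stieltjes_primitiveD[OF stieltjes_primitive_integral[OF f lipschitz_on_component[OF x]], of "\<epsilon> / d" i i]
        e d by auto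
    moreover have "norm (?P i v - ?P i u - (x v $ i - x u $ i) *\<^sub>R f i u) \<le> \<epsilon> / d * \<bar>v - u\<bar>"
      if "u \<in> {s..t}" "v \<in> {s..t}" "\<bar>v - u\<bar> < \<delta>" for u v
    proof (cases "u \<le> v")
      case True
      then show ?thesis using D[of u u v] that by simp
    next
      case False
      have "?P i v - ?P i u - (x v $ i - x u $ i) *\<^sub>R f i u = - (?P i u - ?P i v - (x u $ i - x v $ i) *\<^sub>R f i u)"
        by (simp add: algebra_simps)
      then show ?thesis using D[of v u u] that False by (simp only: norm_minus_cancel) auto
    qed
    ultimately show ?thesis by blast
  qed
  then obtain \<delta> where d0: "\<And>i. \<delta> i > 0" and D: "\<And>i u v. u \<in> {s..t} \<Longrightarrow> v \<in> {s..t} \<Longrightarrow> \<bar>v - u\<bar> < \<delta> i \<Longrightarrow>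
      norm (?P i v - ?P i u - (x v $ i - x u $ i) *\<^sub>R f i u) \<le> \<epsilon> / d * \<bar>v - u\<bar>"
    by metis
  define m where "m = Min (range \<delta>)"
  have m: "m > 0" "\<And>i. m \<le> \<delta> i" using d0 by (auto simp: m_def)
  have "norm (driven_integral x f s v - driven_integral x f s u - (\<Sum>i\<in>UNIV. (x v $ i - x u $ i) *\<^sub>R f i u))
      \<le> \<epsilon> * \<bar>v - u\<bar>" if H: "u \<in> {s..t}" "v \<in> {s..t}" "\<bar>v - u\<bar> < m" for u v
  proof -
    have "norm (\<Sum>i\<in>UNIV. ?P i v - ?P i u - (x v $ i - x u $ i) *\<^sub>R f i u) \<le> real CARD('d) * (\<epsilon> / d * \<bar>v - u\<bar>)"
      using D[OF H(1,2)] H(3) m(2) by (intro sum_norm_bound) (meson order_less_le_trans)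
    then show ?thesis using d by (simp add: sum_subtractf d_def)
  qed
  then show ?thesis using m(1) by blast
qed

text \<open>Neither \<open>y\<close> nor the integral need be differentiable in time, but the increments of both sides are
\<open>\<Sum>\<^sub>i (V\<^sub>i f) (y u) (x\<^sup>i v - x\<^sup>i u)\<close> up to \<open>o(v - u)\<close>. So their difference has derivative zero everywhere and
is constant.\<close>
lemma solves_on_chain_rule:
  fixes V :: "'d::finite \<Rightarrow> real ^ 'e::finite \<Rightarrow> real ^ 'e" and x :: "real \<Rightarrow> real ^ 'd"
    and f :: "real ^ 'e \<Rightarrow> real ^ 'e"
  assumes V: "\<And>i. C-lipschitz_on UNIV (V i)" and B: "\<And>i z. norm (V i z) \<le> B"
    and x: "L-lipschitz_on {s..t} x" and y: "solves_on V s t z x y"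
    and f: "\<And>z. f differentiable at z" and cf: "\<And>i. continuous_on UNIV (field_op (V i) f)"
    and r: "s \<le> r" "r \<le> t"
  shows "f (y r) = f (y s) + driven_integral x (\<lambda>i u. field_op (V i) f (y u)) s r"
proof -
  note cy = solves_onD(1)[OF y]
  let ?P = "driven_integral x (\<lambda>i u. field_op (V i) f (y u)) s"
  define \<Phi> where "\<Phi> = (\<lambda>r. f (y r) - ?P r)"
  have cfy: "continuous_on {s..t} (\<lambda>u. field_op (V i) f (y u))" for i
    using continuous_on_compose2[OF cf cy] by simp
  have cVy: "continuous_on {s..t} (\<lambda>u. V i (y u))" for i
    using continuous_on_lipschitz_compose[OF V cy] .
  define M where "M = real CARD('d) * (B * L)"
  have M0: "M \<ge> 0" unfolding M_def using order_trans[OF norm_ge_zero B] lipschitz_on_nonneg[OF x] by simp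
  have yM: "norm (y b - y a) \<le> M * \<bar>b - a\<bar>" if "a \<in> {s..t}" "b \<in> {s..t}" for a b
  proof -
    have "norm (y b - y a) \<le> M * (b - a)" if "s \<le> a" "a \<le> b" "b \<le> t" for a b
      using solves_on_increment_bound[OF V B x length_control_lipschitz[OF x] y that]
      by (simp add: M_def right_diff_distrib)
    from this[of a b] this[of b a] show ?thesis
      using that by (cases "a \<le> b") (auto simp: norm_minus_commute)
  qed
  have tri: "norm (X + Y - Z) \<le> a + b + c" if "norm X \<le> a" "norm Y \<le> b" "norm Z \<le> c"
    for X Y Z :: "real ^ 'e" and a b c
    using that norm_triangle_ineq4[of "X + Y" Z] norm_triangle_ineq[of X Y] by linarith
  have "(\<Phi> has_derivative (\<lambda>h. 0)) (at u within {s..t})" if u: "u \<in> {s..t}" for u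
    unfolding has_derivative_within_alt
  proof (intro conjI allI impI)
    show "bounded_linear (\<lambda>h::real. 0 :: real ^ 'e)" by (rule bounded_linear_zero)
    fix e :: real assume e: "e > 0"
    define Df where "Df = frechet_derivative f (at (y u))"
    have Df: "(f has_derivative Df) (at (y u))" using f by (simp add: Df_def frechet_derivative_works)
    interpret Df: bounded_linear Df using Df by (rule has_derivative_bounded_linear)
    obtain K where K: "K > 0" "\<And>h. norm (Df h) \<le> norm h * K" using Df.pos_bounded by blast
    have DV: "Df (V i (y u)) = field_op (V i) f (y u)" for i
    proof -
      have "Df (V i (y u)) = Df (\<Sum>j\<in>UNIV. (V i (y u) $ j) *\<^sub>R axis j 1)"
        by (simp add: sum_component_axis)
      also have "\<dots> = (\<Sum>j\<in>UNIV. (V i (y u) $ j) *\<^sub>R Df (axis j 1))"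
        by (simp only: Df.sum Df.scaleR)
      finally show ?thesis by (simp add: field_op_def Df_def)
    qed
    define e1 where "e1 = e / 3 / (M + 1)"
    have e1: "e1 > 0" "e1 * M \<le> e / 3" using e M0 by (auto simp: e1_def field_simps)
    define e2 where "e2 = e / 3 / K"
    have e2: "e2 > 0" "e2 * K = e / 3" using e K by (auto simp: e2_def)
    obtain d1 where d1: "d1 > 0" "\<And>w. norm (w - y u) < d1 \<Longrightarrow> norm (f w - f (y u) - Df (w - y u)) \<le> e1 * norm (w - y u)"
      using Df e1(1) unfolding has_derivative_at_alt by blast
    obtain d2 where d2: "d2 > 0" "\<And>v. v \<in> {s..t} \<Longrightarrow> \<bar>v - u\<bar> < d2 \<Longrightarrow>
        norm (driven_integral x (\<lambda>i u. V i (y u)) s v - driven_integral x (\<lambda>i u. V i (y u)) s u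
          - (\<Sum>i\<in>UNIV. (x v $ i - x u $ i) *\<^sub>R V i (y u))) \<le> e2 * \<bar>v - u\<bar>"
      using driven_integral_local[of s t "\<lambda>i u. V i (y u)", OF cVy x e2(1)] u by blast
    obtain d3 where d3: "d3 > 0" "\<And>v. v \<in> {s..t} \<Longrightarrow> \<bar>v - u\<bar> < d3 \<Longrightarrow>
        norm (?P v - ?P u - (\<Sum>i\<in>UNIV. (x v $ i - x u $ i) *\<^sub>R field_op (V i) f (y u))) \<le> e / 3 * \<bar>v - u\<bar>"
      using driven_integral_local[of s t "\<lambda>i u. field_op (V i) f (y u)", OF cfy x, of "e / 3"] u e by fastforce
    define d where "d = min (d1 / (M + 1)) (min d2 d3)"
    have d: "d > 0" using d1 d2 d3 M0 by (simp add: d_def)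
    have "norm (\<Phi> v - \<Phi> u) \<le> e * \<bar>v - u\<bar>" if v: "v \<in> {s..t}" "\<bar>v - u\<bar> < d" for v
    proof -
      define S where "S = (\<Sum>i\<in>UNIV. (x v $ i - x u $ i) *\<^sub>R V i (y u))"
      define S' where "S' = (\<Sum>i\<in>UNIV. (x v $ i - x u $ i) *\<^sub>R field_op (V i) f (y u))"
      have DS: "Df S = S'" by (simp add: S_def S'_def Df.sum Df.scaleR DV)
      have dy: "y v - y u = driven_integral x (\<lambda>i u. V i (y u)) s v - driven_integral x (\<lambda>i u. V i (y u)) s u"
        using solves_onD(2)[OF y, of v] solves_onD(2)[OF y, of u] u v by simp
      have "norm (y v - y u) \<le> (M + 1) * \<bar>v - u\<bar>"
        using yM[OF u v(1)] by (simp add: algebra_simps)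
      also have "\<dots> < d1" using v(2) M0 by (simp add: d_def field_simps)
      finally have "norm (f (y v) - f (y u) - Df (y v - y u)) \<le> e1 * norm (y v - y u)"
        by (rule d1(2))
      also have "\<dots> \<le> e1 * (M * \<bar>v - u\<bar>)" using yM[OF u v(1)] e1 by (intro mult_left_mono) auto
      also have "\<dots> \<le> e / 3 * \<bar>v - u\<bar>" using mult_right_mono[OF e1(2), of "\<bar>v - u\<bar>"] by (simp add: mult_ac)
      finally have n1: "norm (f (y v) - f (y u) - Df (y v - y u)) \<le> e / 3 * \<bar>v - u\<bar>" .
      have "norm (Df (y v - y u - S)) \<le> norm (y v - y u - S) * K" by (rule K(2))
      also have "\<dots> \<le> e2 * \<bar>v - u\<bar> * K"
        using d2(2)[OF v(1)] v(2) K(1) unfolding dy S_def by (intro mult_right_mono) (auto simp: d_def)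
      also have "\<dots> = e / 3 * \<bar>v - u\<bar>" using e2(2) by (metis mult.assoc mult.commute)
      finally have n2: "norm (Df (y v - y u - S)) \<le> e / 3 * \<bar>v - u\<bar>" .
      have n3: "norm (?P v - ?P u - S') \<le> e / 3 * \<bar>v - u\<bar>"
        unfolding S'_def using d3(2)[OF v(1)] v(2) by (simp add: d_def)
      have "\<Phi> v - \<Phi> u = (f (y v) - f (y u) - Df (y v - y u)) + Df (y v - y u - S) - (?P v - ?P u - S')"
        unfolding Df.diff[of "y v - y u" S] DS by (simp add: \<Phi>_def)
      also have "norm \<dots> \<le> e / 3 * \<bar>v - u\<bar> + e / 3 * \<bar>v - u\<bar> + e / 3 * \<bar>v - u\<bar>"
        using n1 n2 n3 tri by blast
      finally show ?thesis by simp
    qed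
    then show "\<exists>d>0. \<forall>v\<in>{s..t}. norm (v - u) < d \<longrightarrow> norm (\<Phi> v - \<Phi> u - 0) \<le> e * norm (v - u)"
      using d by auto
  qed
  then have "\<Phi> r = \<Phi> s"
    using r by (intro has_derivative_zero_unique[of "{s..t}"]) auto
  then show ?thesis by (simp add: \<Phi>_def algebra_simps)
qed

lemma sum_words_Suc:
  fixes F :: "'d::finite list \<Rightarrow> 'a::comm_monoid_add"
  shows "(\<Sum>w | length w = Suc k. F w) = (\<Sum>w | length w = k. \<Sum>i\<in>UNIV. F (i # w))"
proof -
  have "(\<Sum>w | length w = k. \<Sum>i\<in>UNIV. F (i # w)) = (\<Sum>(w, i)\<in>{w. length w = k} \<times> UNIV. F (i # w))"
    by (simp add: sum.cartesian_product)
  also have "\<dots> = (\<Sum>w | length w = Suc k. F w)"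
    by (rule sum.reindex_bij_witness[of _ "\<lambda>w. (tl w, hd w)" "\<lambda>(w, i). i # w"])
      (auto simp: length_Suc_conv)
  finally show ?thesis by simp
qed

lemma card_words: "card {w :: 'd::finite list. length w = k} = CARD('d) ^ k"
  using card_lists_length_eq[of "UNIV :: 'd set" k] by simp

text \<open>Taylor expansion of a solution to order \<open>k\<close>. Applying the chain rule to \<open>V\<^sub>w H (y)\<close> for every word
\<open>w\<close> of length \<open>k\<close> splits the remainder into its frozen value at \<open>s\<close>, a term of the Euler scheme,
and an integral with one further letter in the innermost place.\<close>
lemma solves_on_expansion:
  fixes V :: "'d::finite \<Rightarrow> real ^ 'e::finite \<Rightarrow> real ^ 'e" and x :: "real \<Rightarrow> real ^ 'd"
  assumes V: "\<And>w. w \<noteq> [] \<Longrightarrow> length w \<le> N \<Longrightarrow> C-lipschitz_on UNIV (field_word V w)"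
    and dV: "\<And>w z. w \<noteq> [] \<Longrightarrow> length w < N \<Longrightarrow> field_word V w differentiable at z"
    and B: "\<And>i z. norm (V i z) \<le> B"
    and x: "L-lipschitz_on {s..t} x" and y: "solves_on V s t z x y" and st: "s \<le> t"
    and k: "1 \<le> k" "k \<le> N"
  shows "y t - y s =
    (\<Sum>j\<in>{1..<k}. \<Sum>w | length w = j. iterated_integral_rev x s (rev w) t *\<^sub>R field_word V w (y s)) +
    (\<Sum>w | length w = k. iterated_integral_of x s (\<lambda>u. field_word V w (y u)) (rev w) t)"
  using k
proof (induction k rule: nat_induct_at_least)
  case base
  have "(\<Sum>w | length w = 1. iterated_integral_of x s (\<lambda>u. field_word V w (y u)) (rev w) t)
      = driven_integral x (\<lambda>i u. V i (y u)) s t"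
    using sum_words_Suc[of "\<lambda>w. iterated_integral_of x s (\<lambda>u. field_word V w (y u)) (rev w) t" 0]
    by (simp add: field_word_letter)
  then show ?case
    using solves_onD(2)[OF y st order_refl] solves_on_initial[OF y st] by simp
next
  case (Suc k)
  note cy = solves_onD(1)[OF y]
  have V1: "C-lipschitz_on UNIV (V i)" for i
    using V[of "[i]"] Suc by (simp add: field_word_letter)
  have "iterated_integral_of x s (\<lambda>u. field_word V w (y u)) (rev w) t
      = iterated_integral_rev x s (rev w) t *\<^sub>R field_word V w (y s)
       + (\<Sum>i\<in>UNIV. iterated_integral_of x s (\<lambda>u. field_word V (i # w) (y u)) (rev (i # w)) t)"
    if w: "length w = k" for w
  proof -
    have w0: "w \<noteq> []" using w Suc by auto
    have li: "C-lipschitz_on UNIV (field_word V (i # w))" for i using V[of "i # w"] w Suc by simp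
    have c: "continuous_on {s..t} (\<lambda>u. field_word V (i # w) (y u))" for i
      by (rule continuous_on_lipschitz_compose[OF li cy])
    have cI: "continuous_on {s..t} (\<lambda>r. stieltjes_integral s r (\<lambda>u. field_word V (i # w) (y u)) (\<lambda>u. x u $ i))" for i
      by (rule continuous_on_stieltjes_integral[OF c lipschitz_on_component[OF x]])
    have "field_word V w (y r) = field_word V w (y s) + driven_integral x (\<lambda>i u. field_word V (i # w) (y u)) s r"
      if r: "s \<le> r" "r \<le> t" for r
      unfolding field_word_Cons
    proof (rule solves_on_chain_rule[OF V1 B x y _ _ r])
      show "field_word V w differentiable at z" for z using dV[OF w0] w Suc by simp
      show "continuous_on UNIV (field_op (V i) (field_word V w))" for i
        using lipschitz_on_continuous_on[OF li] by (simp add: field_word_Cons)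
    qed
    note expand = this
    have "iterated_integral_of x s (\<lambda>u. field_word V w (y u)) (rev w) t
      = iterated_integral_of x s (\<lambda>u. field_word V w (y s)) (rev w) t
       + iterated_integral_of x s (driven_integral x (\<lambda>i u. field_word V (i # w) (y u)) s) (rev w) t"
    proof (rule iterated_integral_of_add[OF x _ _ _ st order_refl])
      show "continuous_on {s..t} (driven_integral x (\<lambda>i u. field_word V (i # w) (y u)) s)"
        by (intro continuous_on_sum cI)
    qed (rule continuous_on_const, rule expand)
    also have "iterated_integral_of x s (driven_integral x (\<lambda>i u. field_word V (i # w) (y u)) s) (rev w) t
      = (\<Sum>i\<in>UNIV. iterated_integral_of x s (\<lambda>r. stieltjes_integral s r (\<lambda>u. field_word V (i # w) (y u)) (\<lambda>u. x u $ i)) (rev w) t)"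
      by (rule iterated_integral_of_sum[OF x _ cI st order_refl]) simp
    finally show ?thesis
      using iterated_integral_of_const[OF x st order_refl, of "field_word V w (y s)" "rev w"]
      by (simp add: iterated_integral_of_snoc)
  qed
  then have "(\<Sum>w | length w = k. iterated_integral_of x s (\<lambda>u. field_word V w (y u)) (rev w) t)
    = (\<Sum>w | length w = k. iterated_integral_rev x s (rev w) t *\<^sub>R field_word V w (y s))
     + (\<Sum>w | length w = Suc k. iterated_integral_of x s (\<lambda>u. field_word V w (y u)) (rev w) t)"
    unfolding sum_words_Suc by (simp add: sum.distrib)
  then show ?case using Suc by (simp add: add.assoc)
qed

text \<open>In the remainder of the expansion of order \<open>N\<close>, subtracting the integrands at time \<open>s\<close> completes the Euler
scheme. What remains is a sum over words of length \<open>N\<close> of iterated integrals of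
\<open>V\<^sub>w H (y u) - V\<^sub>w H (y s)\<close>, which is \<open>O(l)\<close> by Lipschitz continuity; the \<open>N\<close> integrations contribute
the factor \<open>l ^ N\<close>.\<close>
lemma euler_scheme_error:
  fixes V :: "'d::finite \<Rightarrow> real ^ 'e::finite \<Rightarrow> real ^ 'e" and x :: "real \<Rightarrow> real ^ 'd"
  assumes V: "\<And>w. w \<noteq> [] \<Longrightarrow> length w \<le> N \<Longrightarrow> C-lipschitz_on UNIV (field_word V w)"
    and dV: "\<And>w z. w \<noteq> [] \<Longrightarrow> length w < N \<Longrightarrow> field_word V w differentiable at z"
    and B: "\<And>i z. norm (V i z) \<le> B" and N: "N \<ge> 1"
    and x: "L-lipschitz_on {s..t} x" and y: "solves_on V s t z x y" and st: "s \<le> t"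
    and v: "length_control s t x v" and l: "v t - v s \<le> l"
  shows "norm (y t - y s - euler_scheme V (y s) N (signature N x s t))
    \<le> real CARD('d) ^ N * (C * (real CARD('d) * B)) * l ^ (N + 1)"
proof -
  note cy = solves_onD(1)[OF y]
  have V1: "C-lipschitz_on UNIV (V i)" for i
    using V[of "[i]"] N by (simp add: field_word_letter)
  have C0: "C \<ge> 0" using V1 lipschitz_on_nonneg by blast
  have B0: "B \<ge> 0" using order_trans[OF norm_ge_zero B] .
  let ?D = "\<lambda>w u. field_word V w (y u) - field_word V w (y s)"
  have c: "continuous_on {s..t} (\<lambda>u. field_word V w (y u))" if "length w = N" for w
    using that N by (intro continuous_on_lipschitz_compose[OF V cy]) auto
  have "iterated_integral_of x s (\<lambda>u. field_word V w (y u)) (rev w) t =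
      iterated_integral_of x s (\<lambda>u. field_word V w (y s)) (rev w) t + iterated_integral_of x s (?D w) (rev w) t"
    if "length w = N" for w
    using c[OF that] st by (intro iterated_integral_of_add[OF x] continuous_intros) auto
  moreover have "iterated_integral_of x s (\<lambda>u. field_word V w (y s)) (rev w) t
      = iterated_integral_rev x s (rev w) t *\<^sub>R field_word V w (y s)" for w
    by (rule iterated_integral_of_const[OF x st order_refl])
  ultimately have "(\<Sum>w | length w = N. iterated_integral_of x s (\<lambda>u. field_word V w (y u)) (rev w) t)
      = (\<Sum>w | length w = N. iterated_integral_rev x s (rev w) t *\<^sub>R field_word V w (y s))
       + (\<Sum>w | length w = N. iterated_integral_of x s (?D w) (rev w) t)"
    by (simp add: sum.distrib)
  moreover have "euler_scheme V (y s) N (signature N x s t)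
    = (\<Sum>j\<in>{1..<N}. \<Sum>w | length w = j. iterated_integral_rev x s (rev w) t *\<^sub>R field_word V w (y s))
     + (\<Sum>w | length w = N. iterated_integral_rev x s (rev w) t *\<^sub>R field_word V w (y s))"
  proof -
    have "{1..N} = insert N {1..<N}" using N by auto
    then show ?thesis unfolding euler_scheme_def signature_def iterated_integral_def by simp
  qed
  ultimately have "y t - y s - euler_scheme V (y s) N (signature N x s t)
    = (\<Sum>w | length w = N. iterated_integral_of x s (?D w) (rev w) t)"
    using solves_on_expansion[OF V dV B x y st N order_refl] by (simp add: algebra_simps)
  also have "norm \<dots> \<le> real (card {w :: 'd list. length w = N}) * (C * (real CARD('d) * B) * l ^ (N + 1))"
  proof (rule sum_norm_bound)
    fix w :: "'d list" assume "w \<in> {w. length w = N}"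
    then have w: "length w = N" "w \<noteq> []" using N by auto
    have "norm (iterated_integral_of x s (?D w) (rev w) t) \<le> C * (real CARD('d) * (B * l)) * l ^ length (rev w)"
    proof (rule iterated_integral_of_bound[OF x _ v l _ st order_refl])
      show "continuous_on {s..t} (?D w)" using c[OF w(1)] by (intro continuous_intros)
      fix u assume u: "s \<le> u" "u \<le> t"
      have "norm (?D w u) \<le> C * norm (y u - y s)"
        using lipschitz_onD[OF V[OF w(2)], of "y u" "y s"] w(1) by (simp add: dist_norm)
      also have "norm (y u - y s) \<le> real CARD('d) * (B * (v u - v s))"
        using solves_on_increment_bound[OF V1 B x v y _ u] by simp
      also have "\<dots> \<le> real CARD('d) * (B * l)"
        using length_control_mono[OF v u(1) u(2) order_refl] l B0 by (intro mult_left_mono) auto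
      finally show "norm (?D w u) \<le> C * (real CARD('d) * (B * l))"
        using C0 by (simp add: mult_left_mono)
    qed
    then show "norm (iterated_integral_of x s (?D w) (rev w) t) \<le> C * (real CARD('d) * B) * l ^ (N + 1)"
      using w by (simp add: mult_ac)
  qed
  finally show ?thesis by (simp add: card_words mult_ac)
qed


section \<open>Removing the dependence on the Lipschitz constant\<close>

text \<open>By induction on \<open>n\<close>, with \<open>\<delta> = u - s\<close>,
\<open>J s u \<le> exp (\<kappa> \<delta> powr a) (L \<delta>\<^sup>2 / 2 ^ n + R \<delta> powr \<theta>)\<close>. The constants are fixed points of one bisection: \<open>\<kappa>\<close> solves
\<open>A + \<kappa> 2 powr - a = \<kappa>\<close>, so that the exponential absorbs the factor \<open>1 + A \<delta> powr a\<close>, and \<open>R\<close> solves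
\<open>A + q R = R\<close>, where \<open>q = 2 powr (1 - \<theta>) < 1\<close> is the factor by which two halves of \<open>\<delta> powr \<theta>\<close> shrink.
Letting \<open>n\<close> tend to infinity removes \<open>L\<close> from the bound.\<close>
lemma dyadic_sewing_bound:
  fixes J :: "real \<Rightarrow> real \<Rightarrow> real"
  assumes A: "A \<ge> 0" and a: "a > 0" and \<theta>: "\<theta> > 1" and L: "L \<ge> 0"
    and step: "\<And>s u. 0 \<le> s \<Longrightarrow> s < u \<Longrightarrow> u \<le> 1 \<Longrightarrow>
      J s u \<le> (1 + A * (u - s) powr a) * J s ((s + u) / 2) + J ((s + u) / 2) u + A * (u - s) powr \<theta>"
    and small: "\<And>s u. 0 \<le> s \<Longrightarrow> s < u \<Longrightarrow> u \<le> 1 \<Longrightarrow> J s u \<le> L * (u - s)\<^sup>2"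
    and su: "0 \<le> s" "s < u" "u \<le> 1"
  shows "J s u \<le> exp (A / (1 - 2 powr - a)) * (A / (1 - 2 powr (1 - \<theta>))) * (u - s) powr \<theta>"
proof -
  define \<kappa> where "\<kappa> = A / (1 - 2 powr - a)"
  define q where "q = 2 powr (1 - \<theta>)"
  have c: "2 powr - a < 1" using a powr_less_cancel_iff[of 2 "- a" 0] by simp
  have k0: "\<kappa> \<ge> 0" using A c by (simp add: \<kappa>_def)
  have geo: "A + A / (1 - r) * r = A / (1 - r)" if "r < 1" for r
    using that by (simp add: field_simps)
  have k: "A + \<kappa> * 2 powr - a = \<kappa>" unfolding \<kappa>_def by (rule geo[OF c])
  have q: "q < 1" "q > 0" using \<theta> powr_less_cancel_iff[of 2 "1 - \<theta>" 0] by (auto simp: q_def)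
  define R where "R = A / (1 - q)"
  have R: "R \<ge> 0" "A + q * R = R" using A q geo[of q] by (auto simp: R_def mult.commute)
  have main: "J s u \<le> exp (\<kappa> * (u - s) powr a) * (L * (u - s)\<^sup>2 / 2 ^ n + R * (u - s) powr \<theta>)"
    if "0 \<le> s" "s < u" "u \<le> 1" for s u n
    using that
  proof (induction n arbitrary: s u)
    case 0
    have "J s u \<le> 1 * (L * (u - s)\<^sup>2)" using small 0 by simp
    also have "\<dots> \<le> exp (\<kappa> * (u - s) powr a) * (L * (u - s)\<^sup>2 / 2 ^ 0 + R * (u - s) powr \<theta>)"
      using k0 L R by (intro mult_mono) auto
    finally show ?case .
  next
    case (Suc n)
    define \<delta> where "\<delta> = u - s"
    have d: "\<delta> > 0" using Suc.prems by (simp add: \<delta>_def)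
    define b where "b = exp (\<kappa> * (\<delta> / 2) powr a) * (L * (\<delta> / 2)\<^sup>2 / 2 ^ n + R * (\<delta> / 2) powr \<theta>)"
    have half: "(s + u) / 2 - s = \<delta> / 2" "u - (s + u) / 2 = \<delta> / 2" by (auto simp: \<delta>_def field_simps)
    have h1: "J s ((s + u) / 2) \<le> b" and h2: "J ((s + u) / 2) u \<le> b"
      using Suc.IH[of s "(s + u) / 2"] Suc.IH[of "(s + u) / 2" u] Suc.prems unfolding half b_def by auto
    have b0: "b \<ge> 0" using L R by (simp add: b_def)
    define \<eta> where "\<eta> = \<delta> powr a"
    have eta: "\<eta> \<ge> 0" by (simp add: \<eta>_def)
    have ha: "(\<delta> / 2) powr a = 2 powr - a * \<eta>"
      using d by (simp add: \<eta>_def powr_divide powr_minus field_simps)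
    have ht: "2 * (\<delta> / 2) powr \<theta> = q * \<delta> powr \<theta>"
      using d by (simp add: q_def powr_divide powr_diff field_simps)
    have e: "(1 + A * \<eta>) * exp (\<kappa> * (\<delta> / 2) powr a) \<le> exp (\<kappa> * \<eta>)"
    proof -
      have "(1 + A * \<eta>) * exp (\<kappa> * (\<delta> / 2) powr a) \<le> exp (A * \<eta>) * exp (\<kappa> * (\<delta> / 2) powr a)"
        by (intro mult_right_mono exp_ge_add_one_self) auto
      also have "\<dots> = exp ((A + \<kappa> * 2 powr - a) * \<eta>)"
        by (simp add: ha exp_add[symmetric] algebra_simps)
      finally show ?thesis by (simp add: k)
    qed
    have "J s u \<le> (1 + A * \<eta>) * J s ((s + u) / 2) + J ((s + u) / 2) u + A * \<delta> powr \<theta>"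
      using step[OF Suc.prems] by (simp add: \<eta>_def \<delta>_def)
    also have "\<dots> \<le> (1 + A * \<eta>) * b + (1 + A * \<eta>) * b + A * \<delta> powr \<theta>"
      using h1 h2 b0 A eta mult_right_mono[of 1 "1 + A * \<eta>" b]
      by (intro add_mono mult_left_mono) auto
    also have "\<dots> = ((1 + A * \<eta>) * exp (\<kappa> * (\<delta> / 2) powr a))
        * (2 * (L * (\<delta> / 2)\<^sup>2 / 2 ^ n) + R * (2 * (\<delta> / 2) powr \<theta>)) + A * \<delta> powr \<theta>"
      by (simp add: b_def algebra_simps add_divide_distrib)
    also have "\<dots> \<le> exp (\<kappa> * \<eta>) * (2 * (L * (\<delta> / 2)\<^sup>2 / 2 ^ n) + R * (2 * (\<delta> / 2) powr \<theta>))
        + exp (\<kappa> * \<eta>) * (A * \<delta> powr \<theta>)"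
      using e L R A k0 eta mult_right_mono[of 1 "exp (\<kappa> * \<eta>)" "A * \<delta> powr \<theta>"]
      by (intro add_mono mult_right_mono) auto
    also have "\<dots> = exp (\<kappa> * \<eta>) * (L * \<delta>\<^sup>2 / 2 ^ Suc n + (A + q * R) * \<delta> powr \<theta>)"
      unfolding ht by (simp add: power2_eq_square algebra_simps)
    finally show ?case unfolding R(2) by (simp add: \<eta>_def \<delta>_def)
  qed
  have "(\<lambda>n. L * (u - s)\<^sup>2 * (1 / 2) ^ n) \<longlonglongrightarrow> L * (u - s)\<^sup>2 * 0"
    by (intro tendsto_mult tendsto_const LIMSEQ_power_zero) simp
  then have lim: "(\<lambda>n. L * (u - s)\<^sup>2 / 2 ^ n) \<longlonglongrightarrow> 0" by (simp add: power_divide)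
  have "(\<lambda>n. exp (\<kappa> * (u - s) powr a) * (L * (u - s)\<^sup>2 / 2 ^ n + R * (u - s) powr \<theta>))
      \<longlonglongrightarrow> exp (\<kappa> * (u - s) powr a) * (0 + R * (u - s) powr \<theta>)"
    by (intro tendsto_intros lim)
  then have "J s u \<le> exp (\<kappa> * (u - s) powr a) * (0 + R * (u - s) powr \<theta>)"
    by (rule LIMSEQ_le_const) (use main[OF su] in blast)
  also have "\<dots> \<le> exp \<kappa> * (R * (u - s) powr \<theta>)"
  proof -
    have "(u - s) powr a \<le> 1" using su a by (intro powr_le1) auto
    then have "\<kappa> * (u - s) powr a \<le> \<kappa>" using k0 mult_left_mono[of "(u - s) powr a" 1 \<kappa>] by simp
    then show ?thesis using R by (simp add: mult_right_mono)
  qed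
  finally show ?thesis by (simp add: \<kappa>_def R_def q_def mult_ac)
qed

lemma exp_minus_one_le:
  fixes r :: real
  shows "exp r - 1 \<le> r * exp r"
  using mult_right_mono[OF exp_ge_add_one_self[of "- r"], of "exp r"]
  by (simp add: algebra_simps exp_add[symmetric])

text \<open>The defect over \<open>[s, u]\<close> is compared with those over \<open>[s, t]\<close> and \<open>[t, u]\<close> by means of a short path \<open>z\<close>
on \<open>[0, 2]\<close> with the signature of \<open>x\<close> over each of the three intervals. The solution \<open>Y\<close> along \<open>z\<close> from
\<open>y s\<close> realises the Euler schemes at \<open>y s\<close>, the solution \<open>Y'\<close> along the second half from \<open>y t\<close> the
scheme at \<open>y t\<close>. On the second half their increments differ by at most the initial distance
\<open>norm (Y 1 - y t) \<le> J s t + O(l ^ (N + 1))\<close> times a factor that is small with \<open>l\<close>.\<close>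
lemma euler_defect_midpoint:
  fixes V :: "'d::finite \<Rightarrow> real ^ 'e::finite \<Rightarrow> real ^ 'e" and x :: "real \<Rightarrow> real ^ 'd"
    and y :: "real \<Rightarrow> real ^ 'e"
  assumes V: "\<And>w. w \<noteq> [] \<Longrightarrow> length w \<le> N \<Longrightarrow> C-lipschitz_on UNIV (field_word V w)"
    and dV: "\<And>w z. w \<noteq> [] \<Longrightarrow> length w < N \<Longrightarrow> field_word V w differentiable at z"
    and B: "\<And>i z. norm (V i z) \<le> B" and N: "N \<ge> 1" and C: "C > 0"
    and x: "L-lipschitz_on {0..1} x"
    and h: "holder_norm N p (signature N x) \<le> ereal M" and M: "M > 0" and p: "p \<ge> 1"
    and stu: "0 \<le> s" "s < t" "t < u" "u \<le> 1"
  defines "l \<equiv> 2 * M * (u - s) powr (1 / p)"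
    and "E \<equiv> real CARD('d) ^ N * (C * (real CARD('d) * B))"
    and "J \<equiv> \<lambda>a b. norm (y b - y a - euler_scheme V (y a) N (signature N x a b))"
  shows "J s u \<le> J s t + J t u + E * l ^ (N + 1) * (2 + 2 ^ (N + 1))
     + (J s t + E * l ^ (N + 1)) * (exp (2 * real CARD('d) * C * l) - 1)"
proof -
  have V1: "C-lipschitz_on UNIV (V i)" for i
    using V[of "[i]"] N by (simp add: field_word_letter)
  have len: "2 * M * (b - a) powr (1 / p) \<le> l" if "s \<le> a" "a < b" "b \<le> u" for a b
    unfolding l_def using that M p by (intro mult_left_mono powr_mono2) auto
  have t1: "t \<le> 1" and t0: "0 \<le> t" using stu by auto
  obtain g1 L1 w1 where g1: "L1-lipschitz_on {0..1} g1" "signature N g1 0 1 = signature N x s t"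
    "length_control 0 1 g1 w1" and "w1 1 - w1 0 \<le> 2 * M * (t - s) powr (1 / p)"
    by (rule holder_norm_near_geodesic[OF h M stu(1,2) t1])
  then have l1: "w1 1 - w1 0 \<le> l" using len[of s t] stu by simp
  obtain g2 L2 w2 where g2: "L2-lipschitz_on {0..1} g2" "signature N g2 0 1 = signature N x t u"
    "length_control 0 1 g2 w2" and "w2 1 - w2 0 \<le> 2 * M * (u - t) powr (1 / p)"
    by (rule holder_norm_near_geodesic[OF h M t0 stu(3,4)])
  then have l2: "w2 1 - w2 0 \<le> l" using len[of t u] stu by simp
  obtain z Lz v where z: "Lz-lipschitz_on {0..2} z" and zv: "length_control 0 2 z v"
    and "v 1 - v 0 = w1 1 - w1 0" and "v 2 - v 1 = w2 1 - w2 0"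
    and "signature N z 0 1 = signature N g1 0 1" and "signature N z 1 2 = signature N g2 0 1"
    by (rule concatenation_exists[OF g1(1) g2(1) g1(3) g2(3)])
  then have v1: "v 1 - v 0 \<le> l" and v2: "v 2 - v 1 \<le> l"
    and s1: "signature N z 0 1 = signature N x s t" and s2: "signature N z 1 2 = signature N x t u"
    using g1(2) g2(2) l1 l2 by auto
  have z1: "Lz-lipschitz_on {0..1} z" and z2: "Lz-lipschitz_on {1..2} z"
    using lipschitz_on_subset[OF z] by auto
  have zv1: "length_control 0 1 z v" and zv2: "length_control 1 2 z v"
    using length_control_subinterval[OF zv] by auto
  have s12: "signature N z 0 2 = signature N x s u"
    using stu by (intro signature_eq_concat[OF z _ _ lipschitz_on_subset[OF x] _ _ s1 s2]) auto
  obtain Y where Y: "solves_on V 0 2 (y s) z Y"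
    using solves_on_exists[where V = V, OF V1 C z] by auto
  have Y0: "Y 0 = y s" using solves_on_initial[OF Y] by simp
  have Y1: "solves_on V 0 1 (Y 0) z Y" and Y2: "solves_on V 1 2 (Y 1) z Y"
    using solves_on_subinterval[OF V1 z Y, of 0 1] solves_on_subinterval[OF V1 z Y, of 1 2] by auto
  obtain Y' where Y': "solves_on V 1 2 (y t) z Y'"
    using solves_on_exists[where V = V, OF V1 C z2] by auto
  have Y'1: "Y' 1 = y t" using solves_on_initial[OF Y'] by simp
  let ?e = "\<lambda>a b. euler_scheme V (y a) N (signature N x a b)"
  have n1: "norm (Y 2 - Y 0 - ?e s u) \<le> E * (2 * l) ^ (N + 1)"
    using euler_scheme_error[OF V dV B N z Y _ zv, of "2 * l"] v1 v2 by (simp add: Y0 s12 E_def)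
  have n2: "norm (Y 1 - Y 0 - ?e s t) \<le> E * l ^ (N + 1)"
    using euler_scheme_error[OF V dV B N z1 Y1 _ zv1 v1] by (simp add: Y0 s1 E_def)
  have n3: "norm (Y' 2 - y t - ?e t u) \<le> E * l ^ (N + 1)"
    using euler_scheme_error[OF V dV B N z2 Y' _ zv2 v2] by (simp add: Y'1 s2 E_def)
  have "norm (Y 1 - y t) \<le> norm (Y 1 - Y 0 - ?e s t) + norm (y t - y s - ?e s t)"
    using norm_triangle_ineq4[of "Y 1 - Y 0 - ?e s t" "y t - y s - ?e s t"] by (simp add: Y0)
  then have n4: "norm (Y 1 - y t) \<le> J s t + E * l ^ (N + 1)" using n2 by (simp add: J_def)
  have "norm ((Y 2 - Y 1) - (Y' 2 - y t)) \<le> norm (Y 1 - y t) * (exp (2 * real CARD('d) * C * (v 2 - v 1)) - 1)"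
    by (rule solves_on_stability(2)[where V = V, OF V1 C z2 zv2 Y2 Y']) auto
  also have "\<dots> \<le> (J s t + E * l ^ (N + 1)) * (exp (2 * real CARD('d) * C * l) - 1)"
  proof (intro mult_mono n4)
    have "2 * real CARD('d) * C * (v 2 - v 1) \<le> 2 * real CARD('d) * C * l"
      using v2 C by (intro mult_left_mono) auto
    then show "exp (2 * real CARD('d) * C * (v 2 - v 1)) - 1 \<le> exp (2 * real CARD('d) * C * l) - 1" by simp
    show "0 \<le> exp (2 * real CARD('d) * C * (v 2 - v 1)) - 1"
      using length_control_mono[OF zv2, of 1 2] C by simp
    show "0 \<le> J s t + E * l ^ (N + 1)" using n4 order_trans[OF norm_ge_zero] by blast
  qed
  finally have n5: "norm ((Y 2 - Y 1) - (Y' 2 - y t)) \<le> \<dots>" .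
  have split: "norm (P + Q - R - S + T - U) \<le> norm P + norm Q + norm R + norm S + norm T + norm U"
    for P Q R S T U :: "real ^ 'e"
    using norm_triangle_ineq[of P Q] norm_triangle_ineq4[of "P + Q" R] norm_triangle_ineq4[of "P + Q - R" S]
      norm_triangle_ineq[of "P + Q - R - S" T] norm_triangle_ineq4[of "P + Q - R - S + T" U] by linarith
  have "y u - y s - ?e s u = (y t - y s - ?e s t) + (y u - y t - ?e t u) - (Y 1 - Y 0 - ?e s t)
      - (Y' 2 - y t - ?e t u) + (Y 2 - Y 0 - ?e s u) - ((Y 2 - Y 1) - (Y' 2 - y t))"
    by simp
  then have "J s u \<le> J s t + J t u + norm (Y 1 - Y 0 - ?e s t) + norm (Y' 2 - y t - ?e t u)
      + norm (Y 2 - Y 0 - ?e s u) + norm ((Y 2 - Y 1) - (Y' 2 - y t))"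
    unfolding J_def using split by metis
  also have "\<dots> \<le> J s t + J t u + E * l ^ (N + 1) + E * l ^ (N + 1) + E * (2 * l) ^ (N + 1)
      + (J s t + E * l ^ (N + 1)) * (exp (2 * real CARD('d) * C * l) - 1)"
    using n1 n2 n3 n5 by linarith
  finally show ?thesis by (simp add: power_mult_distrib algebra_simps)
qed

lemma powr_inverse_power:
  assumes "r > 0" and "p > 0" and "\<theta> = (real N + 1) / p"
  shows "(r powr (1 / p)) ^ (N + 1) = r powr \<theta>"
proof -
  have "(r powr (1 / p)) ^ (N + 1) = (r powr (1 / p)) powr real (N + 1)"
    using assms(1) by (intro powr_realpow[symmetric]) simp
  then show ?thesis using assms(3) by (simp add: powr_powr add.commute)
qed

text \<open>The constant \<open>D\<close> is chosen before the driver \<open>x\<close>, hence is uniform over all drivers with the given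
Hoelder bound.\<close>
lemma euler_defect_bound:
  fixes V :: "'d::finite \<Rightarrow> real ^ 'e::finite \<Rightarrow> real ^ 'e"
  assumes V: "\<And>w. w \<noteq> [] \<Longrightarrow> length w \<le> N \<Longrightarrow> C-lipschitz_on UNIV (field_word V w)"
    and dV: "\<And>w z. w \<noteq> [] \<Longrightarrow> length w < N \<Longrightarrow> field_word V w differentiable at z"
    and B: "\<And>i z. norm (V i z) \<le> B" and N: "N \<ge> 1" and C: "C > 0"
    and M: "M > 0" and p: "p \<ge> 1" and \<theta>: "\<theta> = (real N + 1) / p" and Np: "real N > p - 1"
  shows "\<exists>D\<ge>0. \<forall>(x :: real \<Rightarrow> real ^ 'd) y y0 L s u.
    L-lipschitz_on {0..1} x \<longrightarrow> holder_norm N p (signature N x) \<le> ereal M \<longrightarrow>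
    solves_on V 0 1 y0 x y \<longrightarrow> 0 \<le> s \<longrightarrow> s < u \<longrightarrow> u \<le> 1 \<longrightarrow>
    norm (y u - y s - euler_scheme V (y s) N (signature N x s u)) \<le> D * (u - s) powr \<theta>"
proof -
  define E where "E = real CARD('d) ^ N * (C * (real CARD('d) * B))"
  define k where "k = 2 * real CARD('d) * C"
  \<comment> \<open>For \<open>l = 2 M \<eta>\<close> with \<open>0 \<le> \<eta> \<le> 1\<close>, \<open>A1 \<eta>\<close> bounds \<open>exp (k l) - 1\<close>, the growth of the distance of two
    solutions over a driver of length \<open>l\<close>.\<close>
  define A1 where "A1 = k * (2 * M) * exp (k * (2 * M))"
  define E1 where "E1 = E * (2 * M) ^ (N + 1)"
  define A where "A = A1 + E1 * (2 + 2 ^ (N + 1) + A1)"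
  have B0: "B \<ge> 0" using order_trans[OF norm_ge_zero B] .
  have E0: "E \<ge> 0" using B0 C by (simp add: E_def)
  have k0: "k > 0" using C by (simp add: k_def)
  have A10: "A1 \<ge> 0" using k0 M by (simp add: A1_def)
  have E10: "E1 \<ge> 0" using E0 M by (simp add: E1_def)
  have A0: "A \<ge> 0" using A10 E10 by (simp add: A_def)
  have p0: "p > 0" using p by simp
  have th: "\<theta> > 1" using p Np by (simp add: \<theta> field_simps)
  have V1: "C-lipschitz_on UNIV (V i)" for i
    using V[of "[i]"] N by (simp add: field_word_letter)
  define D where "D = exp (A / (1 - 2 powr - (1 / p))) * (A / (1 - 2 powr (1 - \<theta>)))"
  have "2 powr (1 - \<theta>) < 1" using th powr_less_cancel_iff[of 2 "1 - \<theta>" 0] by simp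
  then have D0: "D \<ge> 0" using A0 by (simp add: D_def)
  have "norm (y u - y s - euler_scheme V (y s) N (signature N x s u)) \<le> D * (u - s) powr \<theta>"
    if x: "L-lipschitz_on {0..1} x" and h: "holder_norm N p (signature N x) \<le> ereal M"
      and y: "solves_on V 0 1 y0 x y" and su: "0 \<le> s" "s < u" "u \<le> 1" for x y y0 L s u
  proof -
    define J where "J = (\<lambda>a b. norm (y b - y a - euler_scheme V (y a) N (signature N x a b)))"
    have L0: "L \<ge> 0" using x lipschitz_on_nonneg by blast
    have "J s u \<le> D * (u - s) powr \<theta>"
      unfolding D_def
    proof (rule dyadic_sewing_bound[OF A0 _ th _ _ _ su])
      show "1 / p > 0" using p0 by simp
      show "0 \<le> E * L ^ (N + 1)" using E0 L0 by simp
      fix s u :: real assume su: "0 \<le> s" "s < u" "u \<le> 1"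
      define \<delta> where "\<delta> = u - s"
      have d: "\<delta> > 0" "\<delta> \<le> 1" using su by (auto simp: \<delta>_def)
      show "J s u \<le> (E * L ^ (N + 1)) * (u - s)\<^sup>2"
      proof -
        have "J s u \<le> E * (L * \<delta>) ^ (N + 1)"
          unfolding J_def E_def using su
          by (intro euler_scheme_error[OF V dV B N lipschitz_on_subset[OF x]
                solves_on_subinterval[OF V1 x y] _ length_control_lipschitz[OF lipschitz_on_subset[OF x]]])
            (auto simp: \<delta>_def right_diff_distrib)
        also have "\<dots> = E * L ^ (N + 1) * \<delta> ^ (N + 1)" by (simp add: power_mult_distrib)
        also have "\<dots> \<le> E * L ^ (N + 1) * \<delta>\<^sup>2"
          using E0 L0 d N by (intro mult_left_mono power_decreasing) auto
        finally show ?thesis by (simp add: \<delta>_def)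
      qed
      define t where "t = (s + u) / 2"
      define \<eta> where "\<eta> = \<delta> powr (1 / p)"
      define l where "l = 2 * M * \<eta>"
      have eta: "0 \<le> \<eta>" "\<eta> \<le> 1" using d p0 by (auto simp: \<eta>_def intro: powr_le1)
      have l: "l ^ (N + 1) = (2 * M) ^ (N + 1) * \<delta> powr \<theta>"
        using powr_inverse_power[OF d(1) p0 \<theta>] by (simp only: l_def \<eta>_def power_mult_distrib)
      have l2: "0 \<le> l" "l \<le> 2 * M" using eta M mult_left_mono[of \<eta> 1 "2 * M"] by (auto simp: l_def)
      have ex: "exp (k * l) - 1 \<le> A1 * \<eta>"
      proof -
        have "exp (k * l) - 1 \<le> k * l * exp (k * l)" by (rule exp_minus_one_le)
        also have "\<dots> \<le> k * l * exp (k * (2 * M))"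
          using l2 k0 by (intro mult_left_mono) auto
        finally show ?thesis by (simp add: l_def A1_def mult_ac)
      qed
      have ex1: "exp (k * l) - 1 \<le> A1"
        using ex mult_left_mono[OF eta(2) A10] by simp
      have J0: "J a b \<ge> 0" for a b by (simp add: J_def)
      have "J s u \<le> J s t + J t u + E * l ^ (N + 1) * (2 + 2 ^ (N + 1))
         + (J s t + E * l ^ (N + 1)) * (exp (k * l) - 1)"
        using euler_defect_midpoint[OF V dV B N C x h M p, of s t u y] su
        by (simp add: J_def E_def k_def l_def \<eta>_def \<delta>_def t_def)
      also have "\<dots> = J s t + J t u + J s t * (exp (k * l) - 1)
         + (E1 * \<delta> powr \<theta>) * (2 + 2 ^ (N + 1) + (exp (k * l) - 1))"
        unfolding l E1_def by (simp add: algebra_simps)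
      also have "\<dots> \<le> J s t + J t u + J s t * (A1 * \<eta>) + (E1 * \<delta> powr \<theta>) * (2 + 2 ^ (N + 1) + A1)"
        using ex ex1 J0 E10 by (intro add_mono mult_left_mono) auto
      also have "\<dots> \<le> J s t + J t u + J s t * (A * \<eta>) + A * \<delta> powr \<theta>"
      proof (intro add_mono mult_left_mono mult_right_mono order_refl)
        show "A1 \<le> A" using A10 E10 by (simp add: A_def)
        have "E1 * (2 + 2 ^ (N + 1) + A1) \<le> A" using A10 by (simp add: A_def)
        then show "E1 * \<delta> powr \<theta> * (2 + 2 ^ (N + 1) + A1) \<le> A * \<delta> powr \<theta>"
          using mult_right_mono[of "E1 * (2 + 2 ^ (N + 1) + A1)" A "\<delta> powr \<theta>"] by (simp add: mult_ac)
      qed (use J0 eta in auto)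
      finally show "J s u \<le> (1 + A * (u - s) powr (1 / p)) * J s ((s + u) / 2) + J ((s + u) / 2) u
          + A * (u - s) powr \<theta>"
        by (simp add: t_def \<eta>_def \<delta>_def algebra_simps)
    qed
    then show ?thesis by (simp add: J_def)
  qed
  then show ?thesis using D0 by (intro exI[of _ D]) blast
qed

lemma euler_scheme_refl:
  "euler_scheme V z N (signature N x s s) = 0"
proof -
  have "signature N x s s w = 0" if w: "length w \<ge> 1" for w
  proof -
    obtain i w' where "rev w = i # w'" using w by (cases "rev w") auto
    then show ?thesis by (simp add: signature_def iterated_integral_def)
  qed
  then show ?thesis unfolding euler_scheme_def by (intro sum.neutral ballI) auto
qed

text \<open>The scheme is close to the increment of a solution along a short path with the same signature, and
that increment is bounded by the length since the fields are bounded.\<close>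
lemma euler_scheme_bound:
  fixes V :: "'d::finite \<Rightarrow> real ^ 'e::finite \<Rightarrow> real ^ 'e" and x :: "real \<Rightarrow> real ^ 'd"
  assumes V: "\<And>w. w \<noteq> [] \<Longrightarrow> length w \<le> N \<Longrightarrow> C-lipschitz_on UNIV (field_word V w)"
    and dV: "\<And>w z. w \<noteq> [] \<Longrightarrow> length w < N \<Longrightarrow> field_word V w differentiable at z"
    and B: "\<And>i z. norm (V i z) \<le> B" and N: "N \<ge> 1" and C: "C > 0"
    and h: "holder_norm N p (signature N x) \<le> ereal M" and M: "M > 0"
    and st: "0 \<le> s" "s < t" "t \<le> 1"
  defines "l \<equiv> 2 * M * (t - s) powr (1 / p)"
  shows "norm (euler_scheme V z N (signature N x s t)) \<le> real CARD('d) * (B * l)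
     + real CARD('d) ^ N * (C * (real CARD('d) * B)) * l ^ (N + 1)"
proof -
  have V1: "C-lipschitz_on UNIV (V i)" for i
    using V[of "[i]"] N by (simp add: field_word_letter)
  obtain g L v where g: "L-lipschitz_on {0..1} g" "signature N g 0 1 = signature N x s t"
    "length_control 0 1 g v" "v 1 - v 0 \<le> l"
    using holder_norm_near_geodesic[OF h M st] unfolding l_def by blast
  obtain Y where Y: "solves_on V 0 1 z g Y"
    using solves_on_exists[where V = V, OF V1 C g(1)] by auto
  have Y0: "Y 0 = z" using solves_on_initial[OF Y] by simp
  have B0: "B \<ge> 0" using order_trans[OF norm_ge_zero B] .
  have "norm (Y 1 - Y 0) \<le> real CARD('d) * (B * (v 1 - v 0))"
    by (rule solves_on_increment_bound[OF V1 B g(1,3) Y]) auto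
  also have "\<dots> \<le> real CARD('d) * (B * l)" using g(4) B0 by (intro mult_left_mono) auto
  finally have n1: "norm (Y 1 - Y 0) \<le> real CARD('d) * (B * l)" .
  have n2: "norm (Y 1 - Y 0 - euler_scheme V z N (signature N x s t))
      \<le> real CARD('d) ^ N * (C * (real CARD('d) * B)) * l ^ (N + 1)"
    using euler_scheme_error[OF V dV B N g(1) Y _ g(3,4)] by (simp add: Y0 g(2))
  have "norm (euler_scheme V z N (signature N x s t))
      \<le> norm (Y 1 - Y 0) + norm (Y 1 - Y 0 - euler_scheme V z N (signature N x s t))"
    using norm_triangle_ineq4[of "Y 1 - Y 0" "Y 1 - Y 0 - euler_scheme V z N (signature N x s t)"] by simp
  then show ?thesis using n1 n2 by linarith
qed

theorem lemma16:
  fixes V :: "'d::finite \<Rightarrow> real ^ 'e::finite \<Rightarrow> real ^ 'e"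
    and p \<theta> M\<^sub>1 M\<^sub>2 :: real and N :: nat
  assumes "p \<ge> 1" and "real N > p - 1"
    and "\<forall>i. V i \<in> Lip_fields N"
    and "\<theta> = (real N + 1) / p"
    and "M\<^sub>1 > 0" and "M\<^sub>2 > 0"
  shows
    "(\<exists>C>0. \<forall>(x :: real \<Rightarrow> real ^ 'd) (y\<^sub>0 :: real ^ 'e).
        lipschitz_path 0 1 x \<longrightarrow>
        holder_norm N p (signature N x) \<le> ereal M\<^sub>1 \<longrightarrow>
        norm y\<^sub>0 \<le> M\<^sub>2 \<longrightarrow>
        (let y = ode_sol V 0 1 y\<^sub>0 x in
          \<forall>s t. 0 \<le> s \<and> s \<le> t \<and> t \<le> 1 \<longrightarrow>
            norm (path_increment y s t) \<le> C * (t - s) powr (1 / p) \<and>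
            norm (path_increment y s t - euler_scheme V (y s) N (signature N x s t))
              \<le> C * (t - s) powr \<theta>))
     \<and>
     (\<forall>K>0. \<exists>C'. \<forall>(x :: real \<Rightarrow> real ^ 'd) (y\<^sub>0 :: real ^ 'e)
          (xx :: real \<Rightarrow> real \<Rightarrow> real \<Rightarrow> real ^ 'd).
        lipschitz_path 0 1 x \<longrightarrow>
        holder_norm N p (signature N x) \<le> ereal M\<^sub>1 \<longrightarrow>
        norm y\<^sub>0 \<le> M\<^sub>2 \<longrightarrow>
        (\<forall>s t. 0 \<le> s \<and> s < t \<and> t \<le> 1 \<longrightarrow>
           lipschitz_path s t (xx s t) \<and>
           signature N (xx s t) s t = signature N x s t \<and>
           path_len s t (xx s t) \<le> ereal (K * M\<^sub>1 * (t - s) powr (1 / p))) \<longrightarrow>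
        (let y = ode_sol V 0 1 y\<^sub>0 x in
          \<forall>s t. 0 \<le> s \<and> s < t \<and> t \<le> 1 \<longrightarrow>
            norm (path_increment y s t - path_increment (ode_sol V s t (y s) (xx s t)) s t)
              \<le> C' * (t - s) powr \<theta>))"
proof -
  have N: "N \<ge> 1" using assms(1,2) by linarith
  have p0: "p > 0" using assms(1) by simp
  obtain B C where B0: "B > 0" and C: "C > 0" and B: "\<And>i z. norm (V i z) \<le> B"
    and V: "\<And>w. w \<noteq> [] \<Longrightarrow> length w \<le> N \<Longrightarrow> C-lipschitz_on UNIV (field_word V w)"
    and dV: "\<And>w z. w \<noteq> [] \<Longrightarrow> length w < N \<Longrightarrow> field_word V w differentiable at z"
    using Lip_fields_regularity[OF _ N, of V] assms(3) by blast
  have V1: "C-lipschitz_on UNIV (V i)" for i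
    using V[of "[i]"] N by (simp add: field_word_letter)
  define d where "d = real CARD('d)"
  define E where "E = d ^ N * (C * (d * B))"
  have E0: "E \<ge> 0" using B0 C by (simp add: E_def d_def)
  obtain D where D0: "D \<ge> 0" and D: "\<And>(x :: real \<Rightarrow> real ^ 'd) y y0 L s u.
      L-lipschitz_on {0..1} x \<Longrightarrow> holder_norm N p (signature N x) \<le> ereal M\<^sub>1 \<Longrightarrow>
      solves_on V 0 1 y0 x y \<Longrightarrow> 0 \<le> s \<Longrightarrow> s < u \<Longrightarrow> u \<le> 1 \<Longrightarrow>
      norm (y u - y s - euler_scheme V (y s) N (signature N x s u)) \<le> D * (u - s) powr \<theta>"
    using euler_defect_bound[OF V dV B N C assms(5,1,4,2)] by metis
  have pow: "(r powr (1 / p)) ^ (N + 1) = r powr \<theta>" if "r > 0" for r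
    by (rule powr_inverse_power[OF that p0 assms(4)])
  \<comment> \<open>The summands bound the defect and the two terms of \<open>euler_scheme_bound\<close>; the last one makes the
    constant positive.\<close>
  define C1 where "C1 = D + d * (B * (2 * M\<^sub>1)) + E * (2 * M\<^sub>1) ^ (N + 1) + 1"
  have d0: "d > 0" by (simp add: d_def)
  have rest: "d * (B * (2 * M\<^sub>1)) \<ge> 0" "E * (2 * M\<^sub>1) ^ (N + 1) \<ge> 0"
    using B0 E0 d0 assms(5) by auto
  have C1: "C1 > 0" "D \<le> C1" using D0 rest unfolding C1_def by linarith+
  have part1: "norm (path_increment y s t) \<le> C1 * (t - s) powr (1 / p) \<and>
      norm (path_increment y s t - euler_scheme V (y s) N (signature N x s t)) \<le> C1 * (t - s) powr \<theta>"
    if x: "L-lipschitz_on {0..1} x" and h: "holder_norm N p (signature N x) \<le> ereal M\<^sub>1"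
      and y: "solves_on V 0 1 y0 x y" and st: "0 \<le> s" "s \<le> t" "t \<le> 1"
    for x :: "real \<Rightarrow> real ^ 'd" and y y0 L s t
  proof (cases "s = t")
    case True
    then show ?thesis by (simp add: path_increment_def euler_scheme_refl)
  next
    case False
    then have st': "s < t" using st by simp
    define \<delta> where "\<delta> = t - s"
    have dl: "0 < \<delta>" "\<delta> \<le> 1" using st st' by (auto simp: \<delta>_def)
    let ?e = "euler_scheme V (y s) N (signature N x s t)"
    have n1: "norm (y t - y s - ?e) \<le> D * \<delta> powr \<theta>"
      unfolding \<delta>_def by (rule D[OF x h y st(1) st' st(3)])
    have "norm ?e \<le> d * (B * (2 * M\<^sub>1 * \<delta> powr (1 / p))) + E * (2 * M\<^sub>1 * \<delta> powr (1 / p)) ^ (N + 1)"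
      unfolding \<delta>_def E_def d_def by (rule euler_scheme_bound[OF V dV B N C h assms(5) st(1) st' st(3)])
    also have "\<dots> = d * (B * (2 * M\<^sub>1)) * \<delta> powr (1 / p) + E * (2 * M\<^sub>1) ^ (N + 1) * \<delta> powr \<theta>"
      unfolding power_mult_distrib[of "2 * M\<^sub>1"] pow[OF dl(1)] by simp
    finally have n2: "norm ?e \<le> \<dots>" .
    have "1 / p \<le> \<theta>" using p0 by (simp add: assms(4) divide_right_mono)
    then have dle: "\<delta> powr \<theta> \<le> \<delta> powr (1 / p)" using dl by (intro powr_mono') auto
    have "norm (y t - y s) \<le> norm (y t - y s - ?e) + norm ?e"
      using norm_triangle_ineq[of "y t - y s - ?e" ?e] by simp
    also have "\<dots> \<le> D * \<delta> powr (1 / p) + (d * (B * (2 * M\<^sub>1)) * \<delta> powr (1 / p)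
        + E * (2 * M\<^sub>1) ^ (N + 1) * \<delta> powr (1 / p))"
      using n1 n2 mult_left_mono[OF dle D0] mult_left_mono[OF dle rest(2)] by linarith
    also have "\<dots> \<le> C1 * \<delta> powr (1 / p)"
      by (simp add: C1_def algebra_simps)
    finally have "norm (y t - y s) \<le> C1 * \<delta> powr (1 / p)" .
    moreover have "norm (y t - y s - ?e) \<le> C1 * \<delta> powr \<theta>"
      using n1 mult_right_mono[OF C1(2), of "\<delta> powr \<theta>"] by simp
    ultimately show ?thesis by (simp add: path_increment_def \<delta>_def)
  qed
  have part2: "norm (path_increment y s t - path_increment (ode_sol V s t (y s) z) s t)
      \<le> (D + E * (K * M\<^sub>1) ^ (N + 1)) * (t - s) powr \<theta>"
    if x: "L-lipschitz_on {0..1} x" and h: "holder_norm N p (signature N x) \<le> ereal M\<^sub>1"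
      and y: "solves_on V 0 1 y0 x y" and st: "0 \<le> s" "s < t" "t \<le> 1"
      and z: "lipschitz_path s t z" and sig: "signature N z s t = signature N x s t"
      and len: "path_len s t z \<le> ereal (K * M\<^sub>1 * (t - s) powr (1 / p))"
    for x :: "real \<Rightarrow> real ^ 'd" and z y y0 L K s t
  proof -
    define \<delta> where "\<delta> = t - s"
    have dl: "0 < \<delta>" using st by (simp add: \<delta>_def)
    define l where "l = K * M\<^sub>1 * \<delta> powr (1 / p)"
    obtain Lz where Lz: "Lz-lipschitz_on {s..t} z" using z unfolding lipschitz_path_def by blast
    have st': "s \<le> t" using st by simp
    obtain v where v: "length_control s t z v" "v t - v s \<le> l"
      using path_len_imp_length_control[OF len st'] unfolding l_def \<delta>_def by blast
    define Y where "Y = ode_sol V s t (y s) z"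
    have Y: "solves_on V s t (y s) z Y"
      unfolding Y_def by (rule solves_on_ode_sol[where V = V, OF V1 C Lz st'])
    have Ys: "Y s = y s" by (rule solves_on_initial[OF Y st'])
    let ?e = "euler_scheme V (y s) N (signature N x s t)"
    have "norm (Y t - Y s - ?e) \<le> E * l ^ (N + 1)"
      using euler_scheme_error[OF V dV B N Lz Y st' v] by (simp add: Ys sig E_def d_def)
    also have "\<dots> = E * (K * M\<^sub>1) ^ (N + 1) * \<delta> powr \<theta>"
      unfolding l_def power_mult_distrib[of "K * M\<^sub>1"] pow[OF dl] by simp
    finally have n2: "norm (Y t - Y s - ?e) \<le> \<dots>" .
    have n1: "norm (y t - y s - ?e) \<le> D * \<delta> powr \<theta>"
      unfolding \<delta>_def by (rule D[OF x h y st])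
    have "norm ((y t - y s) - (Y t - Y s)) \<le> norm (y t - y s - ?e) + norm (Y t - Y s - ?e)"
    proof -
      have "(y t - y s) - (Y t - Y s) = (y t - y s - ?e) - (Y t - Y s - ?e)" by simp
      then show ?thesis using norm_triangle_ineq4 by metis
    qed
    also have "\<dots> \<le> (D + E * (K * M\<^sub>1) ^ (N + 1)) * \<delta> powr \<theta>"
      using n1 n2 by (simp add: distrib_right)
    finally show ?thesis by (simp add: path_increment_def Y_def \<delta>_def)
  qed
  have sol: "solves_on V 0 1 y0 x (ode_sol V 0 1 y0 x)" if "L-lipschitz_on {0..1} x"
    for L y0 and x :: "real \<Rightarrow> real ^ 'd"
    using solves_on_ode_sol[where V = V, OF V1 C that] by simp
  show ?thesis
  proof (rule conjI)
    show "\<exists>C>0. \<forall>(x :: real \<Rightarrow> real ^ 'd) (y\<^sub>0 :: real ^ 'e).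
        lipschitz_path 0 1 x \<longrightarrow>
        holder_norm N p (signature N x) \<le> ereal M\<^sub>1 \<longrightarrow>
        norm y\<^sub>0 \<le> M\<^sub>2 \<longrightarrow>
        (let y = ode_sol V 0 1 y\<^sub>0 x in
          \<forall>s t. 0 \<le> s \<and> s \<le> t \<and> t \<le> 1 \<longrightarrow>
            norm (path_increment y s t) \<le> C * (t - s) powr (1 / p) \<and>
            norm (path_increment y s t - euler_scheme V (y s) N (signature N x s t))
              \<le> C * (t - s) powr \<theta>)"
      unfolding lipschitz_path_def Let_def
      using C1(1) part1[OF _ _ sol] by (intro exI[of _ C1]) blast
  next
    show "\<forall>K>0. \<exists>C'. \<forall>(x :: real \<Rightarrow> real ^ 'd) (y\<^sub>0 :: real ^ 'e)
          (xx :: real \<Rightarrow> real \<Rightarrow> real \<Rightarrow> real ^ 'd).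
        lipschitz_path 0 1 x \<longrightarrow>
        holder_norm N p (signature N x) \<le> ereal M\<^sub>1 \<longrightarrow>
        norm y\<^sub>0 \<le> M\<^sub>2 \<longrightarrow>
        (\<forall>s t. 0 \<le> s \<and> s < t \<and> t \<le> 1 \<longrightarrow>
           lipschitz_path s t (xx s t) \<and>
           signature N (xx s t) s t = signature N x s t \<and>
           path_len s t (xx s t) \<le> ereal (K * M\<^sub>1 * (t - s) powr (1 / p))) \<longrightarrow>
        (let y = ode_sol V 0 1 y\<^sub>0 x in
          \<forall>s t. 0 \<le> s \<and> s < t \<and> t \<le> 1 \<longrightarrow>
            norm (path_increment y s t - path_increment (ode_sol V s t (y s) (xx s t)) s t)
              \<le> C' * (t - s) powr \<theta>)"
      unfolding Let_def
    proof (intro allI impI exI)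
      fix K :: real and x :: "real \<Rightarrow> real ^ 'd" and y0 :: "real ^ 'e"
        and xx :: "real \<Rightarrow> real \<Rightarrow> real \<Rightarrow> real ^ 'd" and s t :: real
      assume x: "lipschitz_path 0 1 x" and h: "holder_norm N p (signature N x) \<le> ereal M\<^sub>1"
        and xx: "\<forall>s t. 0 \<le> s \<and> s < t \<and> t \<le> 1 \<longrightarrow> lipschitz_path s t (xx s t) \<and>
           signature N (xx s t) s t = signature N x s t \<and>
           path_len s t (xx s t) \<le> ereal (K * M\<^sub>1 * (t - s) powr (1 / p))"
        and st: "0 \<le> s \<and> s < t \<and> t \<le> 1"
      obtain L where L: "L-lipschitz_on {0..1} x" using x unfolding lipschitz_path_def by blast
      show "norm (path_increment (ode_sol V 0 1 y0 x) s t
          - path_increment (ode_sol V s t (ode_sol V 0 1 y0 x s) (xx s t)) s t)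
        \<le> (D + E * (K * M\<^sub>1) ^ (N + 1)) * (t - s) powr \<theta>"
        using st xx by (intro part2[OF L h sol[OF L]]) auto
    qed
  qed
qed

end
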